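(* Let $v(\lambda)$ be a bounded spectral density, $\varepsilon>0$, $$D_\varepsilon=\Big\{f(\lambda)\ \Big|\ \frac1{2\pi}\int_{-\pi}^\pi|f(\lambda)-v(\lambda)|d\lambda\le\varepsilon\Big\},\qquad P_1=\varepsilon+\frac1{2\pi}\int_{-\pi}^\pi v(\lambda)d\lambda .$$ Consider the equation $$D^\mu AW^\mu\varphi=\alpha\overline\varphi,\qquad\alpha\in\mathbb C,\qquad(\mathrm E)$$ and densities of the form $$f^0(\lambda)=\max\Big\{v(\lambda),\Big|c\sum_{k=0}^\infty(D^\mu A\varphi_\mu)_ke^{i\lambda k}\Big|^2\Big\},\qquad \varphi_\mu=W^\mu\varphi,\ c\text{ a constant}.\qquad(\mathrm F)$$ Let $\nu_\varepsilon P_1$ be the maximum value of $\|D^\mu AW^\mu\varphi\|^2$ on the set of those solutions $\varphi$ of (E) which satisfy the inequality $v(\lambda)\le|\sum_{k=0}^\infty\varphi(k)e^{-i\lambda k}|^2$, satisfy $\|\varphi\|^2=P_1$ and determine the canonical factorization of the spectral density $f^0(\lambda)=|\sum_{k\ge0}\varphi(k)e^{-i\lambda k}|^2$. Let $\nu_\varepsilon^+P_1$ be the maximum value of $\|D^\mu AW^\mu\varphi\|^2$ on the set of those $\varphi$ which satisfy $\|\varphi\|^2=P_1$ and determine the canonical factorization of the spectral density $f^0(\lambda)$ given by (F). 1. If there exists a solution $\varphi^0=\{\varphi^0(m):m\ge0\}$ of (E) which satisfies $\|\varphi^0\|^2=P_1$ and $\nu_\varepsilon P_1=\nu_\varepsilon^+P_1=\|D^\mu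 AW^\mu\varphi^0\|^2$, then the spectral density $$f^0(\lambda)=\Big|\sum_{k=0}^\infty\varphi^0(k)e^{-i\lambda k}\Big|^2$$ is least favorable in the class $D_\varepsilon$ for the optimal extrapolation of the functional $A\xi=\sum_{k=0}^\infty a(k)\xi(k)$ of the unknown values $\xi(k)$, $k\ge0$, of the stochastic sequence with stationary $n$th increments, and the increment $\xi^{(n)}(m,\mu)$ admits a one-sided moving average representation. 2. If $\nu_\varepsilon<\nu_\varepsilon^+$, the density (F) which admits the canonical factorization is least favorable in the class $D_\varepsilon$. Here the sequence $c\varphi_\mu=\{c\varphi_\mu(k):k\ge0\}$ is determined by the equality $\varphi_\mu=W^\mu\varphi$, by the conditional extremum problem $$\|D^\mu A\varphi_\mu\|^2\to\max,\qquad f(\lambda)=\Big|\sum_{k=0}^\infty\varphi(k)e^{-i\lambda k}\Big|^2\in D_\varepsilon,$$ and by the condition $\int_{-\pi}^\pi f(\lambda)d\lambda=2\pi\varepsilon+\int_{-\pi}^\pi v(\lambda)d\lambda$. 3. The minimax-robust spectral characteristic is calculated by the formulas (with $f=f^0$ the least favorable density) $$h_\mu^{(a)}(\lambda)=A(e^{i\lambda})-r_\mu^{(a)}(e^{i\lambda})\Phi_\mu^{-1}(e^{-i\lambda}),\quad A(e^{i\lambda})=\sum_{k=0}^\infty(D^\mu a)_ke^{i\lambda k},\quad r_\mu^{(a)}(e^{i\lambda})=\sum_{j=0}^\infty(D^\mu A\varphi_\mu)_je^{i\lambda j}.$$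
   Context: Let $n\ge 1$ and $\mu>0$ be integers. For a stochastic sequence $\{\xi(m),m\in\mathbb Z\}$ put $\xi^{(n)}(m,\mu)=\sum_{l=0}^n(-1)^l\binom nl\xi(m-l\mu)$. The sequence has stationary $n$th increments if $\mathrm E\xi^{(n)}(m_0,\mu)$ and $\mathrm E\xi^{(n)}(m_0+m,\mu_1)\overline{\xi^{(n)}(m_0,\mu_2)}$ exist for all integers $m_0,m,\mu,\mu_1,\mu_2$ and do not depend on $m_0$; the mean of the increments is assumed to be $0$. It has spectral density $f$ if $\xi^{(n)}(m,\mu)=\int_{-\pi}^{\pi}e^{i\lambda m}(1-e^{-i\mu\lambda})^n(i\lambda)^{-n}dZ(\lambda)$ with an orthogonal stochastic measure $Z$, $\mathrm E|Z(d\lambda)|^2=\frac1{2\pi}f(\lambda)d\lambda$. A one-sided moving average representation is $\xi^{(n)}(m,\mu)=\sum_{k\ge0}\varphi^{(n)}(k,\mu)\varepsilon_{m-k}$ with $\{\varepsilon_m\}$ uncorrelated, mean $0$, variance $1$ and square summable coefficients. Canonical factorization of $f$: $f(\lambda)=|\Phi(e^{-i\lambda})|^2$, $\Phi(z)=\sum_{k\ge0}\varphi(k)z^k$, with convergence radius $>1$ and no zeros of $\Phi$ in $\{|z|\le1\}$; the sequence $\varphi=(\varphi(0),\varphi(1),\ldots)\in\ell_2$ is said to define (determine) the factorization. Let $w_\mu(z)=\sum_{k\ge0}w_\mu(k)z^k=\exp\{\frac1{4\pi}\int_{-\pi}^{\pi}\frac{e^{i\lambda}+z}{e^{i\lambda}-z}\ln\frac{|1-e^{-i\lambda\mu}|^{2n}}{\lambda^{2n}}d\lambda\}$,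 so $|w_\mu(e^{-i\lambda})|^2=|1-e^{-i\lambda\mu}|^{2n}\lambda^{-2n}$. $W^\mu$ is the operator in $\ell_2$ with elements $W^\mu_{j,k}=w_\mu(j-k)$ for $0\le k\le j$, $0$ for $j<k$; $\varphi_\mu=W^\mu\varphi$ and $\Phi_\mu(z)=\sum_k\varphi_\mu(k)z^k=w_\mu(z)\Phi(z)$. The numbers $d_\mu(k)$ are defined by $\sum_{k\ge0}d_\mu(k)x^k=(\sum_{j\ge0}x^{\mu j})^n$. $D^\mu$ is the operator in $\ell_2$ with elements $d_\mu(j-k)$ for $0\le k\le j$, $0$ for $j<k$; $A$ has elements $(A)_{k,j}=a(k+j)$, $k,j\ge0$; $a=(a(0),a(1),\ldots)^T$. Standing assumption: $\sum_k|(D^\mu a)_k|<\infty$, $\sum_k(k+1)|(D^\mu a)_k|^2<\infty$. Norms are $\ell_2$ norms; the bar is coordinatewise conjugation. Estimation: $A\xi$ is understood as $A\xi=B\xi-V\xi$, $B\xi=\sum_{k\ge0}b_\mu(k)\xi^{(n)}(k,\mu)$, $b_\mu(k)=(D^\mu a)_k$, $V\xi=\sum_{k=-\mu n}^{-1}v_\mu(k)\xi(k)$, $v_\mu(k)=\sum_{l=\lceil-k/\mu\rceil}^n(-1)^l\binom nlb_\mu(l\mu+k)$. The observations are $\xi(m)$, $m\le-1$. $L_2^{0-}(f)$ is the closed subspace of $L_2(f)$ generated by $e^{i\lambda k}(1-e^{-i\lambda\mu})^n(i\lambda)^{-n}$, $k\le-1$. A linear estimate with spectral characteristic $h$ is $\hat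 A\xi=-V\xi+\int h(\lambda)(1-e^{-i\lambda\mu})^n(i\lambda)^{-n}dZ(\lambda)$ with $h(\lambda)(1-e^{-i\lambda\mu})^n(i\lambda)^{-n}\in L_2^{0-}(f)$; $\Delta(h;f)=\mathrm E|A\xi-\hat A\xi|^2$ is its mean square error under $f$, and $h^{(a)}_\mu(f)$ is the spectral characteristic minimizing it. If $f$ admits the canonical factorization, $\Delta(h^{(a)}_\mu(f);f)=\|D^\mu A\varphi_\mu\|^2$. A density $f^0\in D$ is least favorable in a class $D$ for the optimal linear estimation of $A\xi$ if $\Delta(h^{(a)}_\mu(f^0);f^0)=\max_{f\in D}\Delta(h^{(a)}_\mu(f);f)$. Let $H_D$ be the set of $h$ with $h(\lambda)(1-e^{-i\lambda\mu})^n(i\lambda)^{-n}\in\bigcap_{f\in D}L_2^{0-}(f)$. A spectral characteristic $h^0\in H_D$ is minimax-robust if $\min_{h\in H_D}\max_{f\in D}\Delta(h;f)=\max_{f\in D}\Delta(h^0;f)$. *)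

theory Defs
  imports "HOL-Probability.Probability" "HOL-Complex_Analysis.Complex_Analysis"
begin

section \<open>Frequency domain\<close>

definition freq :: "real measure" where
  "freq = restrict_space lborel {-pi..pi}"

text \<open>Densities are determined only up to null sets, so relations between them are
  read almost everywhere with respect to \<^const>\<open>freq\<close>.\<close>

definition spectral_density :: "(real \<Rightarrow> real) \<Rightarrow> bool" where
  "spectral_density f \<longleftrightarrow> integrable freq f \<and> (\<forall>t\<in>{-pi..pi}. 0 \<le> f t)"

definition spectral_measure :: "(real \<Rightarrow> real) \<Rightarrow> real measure" where
  "spectral_measure f = density freq (\<lambda>t. ennreal (f t / (2 * pi)))"

definition D_eps :: "(real \<Rightarrow> real) \<Rightarrow> real \<Rightarrow> (real \<Rightarrow> real) set" where
  "D_eps v \<epsilon> = {f. spectral_density f \<and> 1 / (2 * pi) * (\<integral>t. \<bar>f t - v t\<bar> \<partial>freq) \<le> \<epsilon>}"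

definition P1 :: "(real \<Rightarrow> real) \<Rightarrow> real \<Rightarrow> real" where
  "P1 v \<epsilon> = \<epsilon> + 1 / (2 * pi) * (\<integral>t. v t \<partial>freq)"

text \<open>The value at \<open>t = 0\<close> is \<open>0\<close> by the convention \<open>x / 0 = 0\<close>; this is a null set of
  every spectral measure.\<close>

definition incr_kernel :: "nat \<Rightarrow> nat \<Rightarrow> real \<Rightarrow> complex" where
  "incr_kernel n \<mu> t = (1 - cis (- real \<mu> * t)) ^ n / (\<i> * complex_of_real t) ^ n"


section \<open>Stochastic sequences with stationary increments\<close>

definition incr :: "nat \<Rightarrow> (int \<Rightarrow> 'w \<Rightarrow> complex) \<Rightarrow> int \<Rightarrow> int \<Rightarrow> 'w \<Rightarrow> complex" where
  "incr n \<xi> s m \<omega> = (\<Sum>l=0..n. (-1) ^ l * of_nat (n choose l) * \<xi> (m - int l * s) \<omega>)"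

definition stationary_increments :: "'w measure \<Rightarrow> nat \<Rightarrow> (int \<Rightarrow> 'w \<Rightarrow> complex) \<Rightarrow> bool" where
  "stationary_increments M n \<xi> \<longleftrightarrow>
     prob_space M \<and> (\<forall>m. \<xi> m \<in> borel_measurable M) \<and>
     (\<forall>m s. integrable M (incr n \<xi> s m)) \<and>
     (\<forall>m m' s. (\<integral>\<omega>. incr n \<xi> s m \<omega> \<partial>M) = (\<integral>\<omega>. incr n \<xi> s m' \<omega> \<partial>M)) \<and>
     (\<forall>m0 m s1 s2. integrable M (\<lambda>\<omega>. incr n \<xi> s1 (m0 + m) \<omega> * cnj (incr n \<xi> s2 m0 \<omega>))) \<and>
     (\<forall>m0 m0' m s1 s2.
        (\<integral>\<omega>. incr n \<xi> s1 (m0 + m) \<omega> * cnj (incr n \<xi> s2 m0 \<omega>) \<partial>M) =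
        (\<integral>\<omega>. incr n \<xi> s1 (m0' + m) \<omega> * cnj (incr n \<xi> s2 m0' \<omega>) \<partial>M))"

definition zero_mean_increments :: "'w measure \<Rightarrow> nat \<Rightarrow> (int \<Rightarrow> 'w \<Rightarrow> complex) \<Rightarrow> bool" where
  "zero_mean_increments M n \<xi> \<longleftrightarrow> (\<forall>m s. (\<integral>\<omega>. incr n \<xi> s m \<omega> \<partial>M) = 0)"

text \<open>\<open>Z\<close> is defined on the Borel subsets of \<open>[-\<pi>, \<pi>]\<close>. Countable additivity in mean square
  follows from additivity, orthogonality and the structure function.\<close>

definition orthogonal_measure ::
    "'w measure \<Rightarrow> (real set \<Rightarrow> 'w \<Rightarrow> complex) \<Rightarrow> (real \<Rightarrow> real) \<Rightarrow> bool" where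
  "orthogonal_measure M Z f \<longleftrightarrow>
     (\<forall>A\<in>sets freq. Z A \<in> borel_measurable M \<and>
        (\<integral>\<^sup>+\<omega>. ennreal ((cmod (Z A \<omega>))\<^sup>2) \<partial>M) = emeasure (spectral_measure f) A) \<and>
     (\<forall>A\<in>sets freq. \<forall>B\<in>sets freq. A \<inter> B = {} \<longrightarrow>
        (AE \<omega> in M. Z (A \<union> B) \<omega> = Z A \<omega> + Z B \<omega>) \<and>
        (\<integral>\<omega>. Z A \<omega> * cnj (Z B \<omega>) \<partial>M) = 0)"

text \<open>A simple function is given by a list of pairs (coefficient, set).\<close>

definition simple_fun :: "(complex \<times> real set) list \<Rightarrow> real \<Rightarrow> complex" where
  "simple_fun S t = (\<Sum>(c, A)\<leftarrow>S. c * indicator A t)"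

definition simple_stoch_integral ::
    "(real set \<Rightarrow> 'w \<Rightarrow> complex) \<Rightarrow> (complex \<times> real set) list \<Rightarrow> 'w \<Rightarrow> complex" where
  "simple_stoch_integral Z S \<omega> = (\<Sum>(c, A)\<leftarrow>S. c * Z A \<omega>)"

definition has_stoch_integral ::
    "'w measure \<Rightarrow> (real set \<Rightarrow> 'w \<Rightarrow> complex) \<Rightarrow> (real \<Rightarrow> real) \<Rightarrow>
     (real \<Rightarrow> complex) \<Rightarrow> ('w \<Rightarrow> complex) \<Rightarrow> bool" where
  "has_stoch_integral M Z f g Y \<longleftrightarrow>
     g \<in> borel_measurable freq \<and> Y \<in> borel_measurable M \<and>
     (\<exists>S :: nat \<Rightarrow> (complex \<times> real set) list.
        (\<forall>k. \<forall>(c, A)\<in>set (S k). A \<in> sets freq) \<and>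
        (\<lambda>k. \<integral>\<^sup>+t. ennreal ((cmod (g t - simple_fun (S k) t))\<^sup>2) \<partial>spectral_measure f)
          \<longlonglongrightarrow> 0 \<and>
        (\<lambda>k. \<integral>\<^sup>+\<omega>. ennreal ((cmod (Y \<omega> - simple_stoch_integral Z (S k) \<omega>))\<^sup>2) \<partial>M)
          \<longlonglongrightarrow> 0)"

text \<open>Unique only almost surely.\<close>

definition stoch_integral ::
    "'w measure \<Rightarrow> (real set \<Rightarrow> 'w \<Rightarrow> complex) \<Rightarrow> (real \<Rightarrow> real) \<Rightarrow>
     (real \<Rightarrow> complex) \<Rightarrow> 'w \<Rightarrow> complex" where
  "stoch_integral M Z f g = (SOME Y. has_stoch_integral M Z f g Y)"

definition has_spectral_density ::
    "'w measure \<Rightarrow> nat \<Rightarrow> (int \<Rightarrow> 'w \<Rightarrow> complex) \<Rightarrow> (real set \<Rightarrow> 'w \<Rightarrow> complex) \<Rightarrow>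
     (real \<Rightarrow> real) \<Rightarrow> bool" where
  "has_spectral_density M n \<xi> Z f \<longleftrightarrow>
     orthogonal_measure M Z f \<and>
     (\<forall>m. \<forall>s::nat. s > 0 \<longrightarrow>
        has_stoch_integral M Z f (\<lambda>t. cis (t * real_of_int m) * incr_kernel n s t)
          (incr n \<xi> (int s) m))"

definition one_sided_moving_average :: "'w measure \<Rightarrow> (int \<Rightarrow> 'w \<Rightarrow> complex) \<Rightarrow> bool" where
  "one_sided_moving_average M X \<longleftrightarrow>
     (\<exists>(\<phi> :: nat \<Rightarrow> complex) (e :: int \<Rightarrow> 'w \<Rightarrow> complex).
        summable (\<lambda>k. (cmod (\<phi> k))\<^sup>2) \<and>
        (\<forall>m. e m \<in> borel_measurable M \<and> integrable M (\<lambda>\<omega>. (cmod (e m \<omega>))\<^sup>2) \<and>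
             (\<integral>\<omega>. e m \<omega> \<partial>M) = 0) \<and>
        (\<forall>m k. (\<integral>\<omega>. e m \<omega> * cnj (e k \<omega>) \<partial>M) = (if m = k then 1 else 0)) \<and>
        (\<forall>m. (\<lambda>N. \<integral>\<^sup>+\<omega>. ennreal ((cmod (X m \<omega> - (\<Sum>k<N. \<phi> k * e (m - int k) \<omega>)))\<^sup>2) \<partial>M)
               \<longlonglongrightarrow> 0))"


section \<open>Infinite matrices and the canonical factorization\<close>

definition mat_vec :: "(nat \<Rightarrow> nat \<Rightarrow> complex) \<Rightarrow> (nat \<Rightarrow> complex) \<Rightarrow> nat \<Rightarrow> complex" where
  "mat_vec T x i = (\<Sum>j. T i j * x j)"

definition mat_mul ::
    "(nat \<Rightarrow> nat \<Rightarrow> complex) \<Rightarrow> (nat \<Rightarrow> nat \<Rightarrow> complex) \<Rightarrow> nat \<Rightarrow> nat \<Rightarrow> complex" where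
  "mat_mul S T i j = (\<Sum>l. S i l * T l j)"

definition l2_sq :: "(nat \<Rightarrow> complex) \<Rightarrow> real" where
  "l2_sq x = (\<Sum>k. (cmod (x k))\<^sup>2)"

definition power_ser :: "(nat \<Rightarrow> complex) \<Rightarrow> complex \<Rightarrow> complex" where
  "power_ser x z = (\<Sum>k. x k * z ^ k)"

definition d_coeff :: "nat \<Rightarrow> nat \<Rightarrow> nat \<Rightarrow> complex" where
  "d_coeff n \<mu> k = fps_nth (Abs_fps (\<lambda>i. if \<mu> dvd i then 1 else 0) ^ n) k"

text \<open>Upper triangular, row index first: \<open>(D a)\<^sub>k\<close> is the sum of \<open>d (j - k) * a j\<close> over
  \<open>j \<ge> k\<close>. This is the orientation for which \<open>A\<xi> = B\<xi> - V\<xi>\<close> with \<open>b = D a\<close>.\<close>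

definition D_mat :: "nat \<Rightarrow> nat \<Rightarrow> nat \<Rightarrow> nat \<Rightarrow> complex" where
  "D_mat n \<mu> k j = (if k \<le> j then d_coeff n \<mu> (j - k) else 0)"

definition A_mat :: "(nat \<Rightarrow> complex) \<Rightarrow> nat \<Rightarrow> nat \<Rightarrow> complex" where
  "A_mat a k j = a (k + j)"

definition w_fun :: "nat \<Rightarrow> nat \<Rightarrow> complex \<Rightarrow> complex" where
  "w_fun n \<mu> z = exp (1 / (4 * pi) *
     (\<integral>t. (cis t + z) / (cis t - z) *
          complex_of_real (ln (cmod (1 - cis (- real \<mu> * t)) ^ (2 * n) / t ^ (2 * n))) \<partial>freq))"

definition w_coeff :: "nat \<Rightarrow> nat \<Rightarrow> nat \<Rightarrow> complex" where
  "w_coeff n \<mu> k = fps_nth (fps_expansion (w_fun n \<mu>) 0) k"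

definition W_mat :: "nat \<Rightarrow> nat \<Rightarrow> nat \<Rightarrow> nat \<Rightarrow> complex" where
  "W_mat n \<mu> j k = (if k \<le> j then w_coeff n \<mu> (j - k) else 0)"

definition phi_mu :: "nat \<Rightarrow> nat \<Rightarrow> (nat \<Rightarrow> complex) \<Rightarrow> nat \<Rightarrow> complex" where
  "phi_mu n \<mu> \<phi> = mat_vec (W_mat n \<mu>) \<phi>"

text \<open>\<open>D\<close> alone is unbounded on square summable sequences; \<open>D A\<close> is the operator given by the
  matrix product.\<close>

definition DAW :: "nat \<Rightarrow> nat \<Rightarrow> (nat \<Rightarrow> complex) \<Rightarrow> (nat \<Rightarrow> complex) \<Rightarrow> nat \<Rightarrow> complex" where
  "DAW n \<mu> a \<phi> = mat_vec (mat_mul (D_mat n \<mu>) (A_mat a)) (phi_mu n \<mu> \<phi>)"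

definition seq_density :: "(nat \<Rightarrow> complex) \<Rightarrow> real \<Rightarrow> real" where
  "seq_density \<phi> t = (cmod (power_ser \<phi> (cis (- t))))\<^sup>2"

definition canonical_factorization :: "(nat \<Rightarrow> complex) \<Rightarrow> (real \<Rightarrow> real) \<Rightarrow> bool" where
  "canonical_factorization \<phi> f \<longleftrightarrow>
     conv_radius \<phi> > 1 \<and> (\<forall>z. cmod z \<le> 1 \<longrightarrow> power_ser \<phi> z \<noteq> 0) \<and>
     (AE t in freq. f t = seq_density \<phi> t)"


section \<open>Estimation and the minimax problem\<close>

definition b_coeff :: "nat \<Rightarrow> nat \<Rightarrow> (nat \<Rightarrow> complex) \<Rightarrow> nat \<Rightarrow> complex" where
  "b_coeff n \<mu> a = mat_vec (D_mat n \<mu>) a"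

definition v_coeff :: "nat \<Rightarrow> nat \<Rightarrow> (nat \<Rightarrow> complex) \<Rightarrow> int \<Rightarrow> complex" where
  "v_coeff n \<mu> a k =
     (\<Sum>l = nat \<lceil>- real_of_int k / real \<mu>\<rceil>..n.
        (-1) ^ l * of_nat (n choose l) * b_coeff n \<mu> a (nat (int l * int \<mu> + k)))"

definition B_functional ::
    "nat \<Rightarrow> nat \<Rightarrow> (nat \<Rightarrow> complex) \<Rightarrow> (int \<Rightarrow> 'w \<Rightarrow> complex) \<Rightarrow> 'w \<Rightarrow> complex" where
  "B_functional n \<mu> a \<xi> \<omega> = (\<Sum>k. b_coeff n \<mu> a k * incr n \<xi> (int \<mu>) (int k) \<omega>)"

definition V_functional ::
    "nat \<Rightarrow> nat \<Rightarrow> (nat \<Rightarrow> complex) \<Rightarrow> (int \<Rightarrow> 'w \<Rightarrow> complex) \<Rightarrow> 'w \<Rightarrow> complex" where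
  "V_functional n \<mu> a \<xi> \<omega> = (\<Sum>k = - (int \<mu> * int n)..-1. v_coeff n \<mu> a k * \<xi> k \<omega>)"

definition A_functional ::
    "nat \<Rightarrow> nat \<Rightarrow> (nat \<Rightarrow> complex) \<Rightarrow> (int \<Rightarrow> 'w \<Rightarrow> complex) \<Rightarrow> 'w \<Rightarrow> complex" where
  "A_functional n \<mu> a \<xi> \<omega> = B_functional n \<mu> a \<xi> \<omega> - V_functional n \<mu> a \<xi> \<omega>"

definition A_estimate ::
    "nat \<Rightarrow> nat \<Rightarrow> (nat \<Rightarrow> complex) \<Rightarrow> 'w measure \<Rightarrow> (int \<Rightarrow> 'w \<Rightarrow> complex) \<Rightarrow>
     (real set \<Rightarrow> 'w \<Rightarrow> complex) \<Rightarrow> (real \<Rightarrow> real) \<Rightarrow> (real \<Rightarrow> complex) \<Rightarrow> 'w \<Rightarrow> complex" where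
  "A_estimate n \<mu> a M \<xi> Z f h \<omega> =
     - V_functional n \<mu> a \<xi> \<omega> + stoch_integral M Z f (\<lambda>t. h t * incr_kernel n \<mu> t) \<omega>"

text \<open>The closed linear span in \<open>L\<^sub>2(f)\<close> of \<open>cis (k t) * incr_kernel n \<mu> t\<close>, \<open>k \<le> -1\<close>.\<close>

definition L2_past :: "nat \<Rightarrow> nat \<Rightarrow> (real \<Rightarrow> real) \<Rightarrow> (real \<Rightarrow> complex) set" where
  "L2_past n \<mu> f = {g \<in> borel_measurable freq.
     \<forall>\<delta>>0. \<exists>(N::nat) (c :: nat \<Rightarrow> complex).
       (\<integral>\<^sup>+t. ennreal ((cmod (g t - (\<Sum>k=1..N. c k * (cis (- real k * t) * incr_kernel n \<mu> t))))\<^sup>2)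
          \<partial>spectral_measure f) < \<delta>}"

definition admissible :: "nat \<Rightarrow> nat \<Rightarrow> (real \<Rightarrow> real) \<Rightarrow> (real \<Rightarrow> complex) set" where
  "admissible n \<mu> f = {h. (\<lambda>t. h t * incr_kernel n \<mu> t) \<in> L2_past n \<mu> f}"

text \<open>From here on \<open>M\<close>, \<open>\<xi>\<close>, \<open>Z\<close> are families indexed by the density: \<open>\<xi> f\<close> is a sequence with
  spectral density \<open>f\<close> on the probability space \<open>M f\<close>, with orthogonal measure \<open>Z f\<close>.\<close>

type_synonym 'w spaces = "(real \<Rightarrow> real) \<Rightarrow> 'w measure"
type_synonym 'w sequences = "(real \<Rightarrow> real) \<Rightarrow> int \<Rightarrow> 'w \<Rightarrow> complex"
type_synonym 'w stoch_measures = "(real \<Rightarrow> real) \<Rightarrow> real set \<Rightarrow> 'w \<Rightarrow> complex"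

definition mse ::
    "nat \<Rightarrow> nat \<Rightarrow> (nat \<Rightarrow> complex) \<Rightarrow> 'w spaces \<Rightarrow> 'w sequences \<Rightarrow> 'w stoch_measures \<Rightarrow>
     (real \<Rightarrow> complex) \<Rightarrow> (real \<Rightarrow> real) \<Rightarrow> ennreal" where
  "mse n \<mu> a M \<xi> Z h f =
     (\<integral>\<^sup>+\<omega>. ennreal ((cmod (A_functional n \<mu> a (\<xi> f) \<omega> -
                          A_estimate n \<mu> a (M f) (\<xi> f) (Z f) f h \<omega>))\<^sup>2) \<partial>M f)"

definition optimal_char ::
    "nat \<Rightarrow> nat \<Rightarrow> (nat \<Rightarrow> complex) \<Rightarrow> 'w spaces \<Rightarrow> 'w sequences \<Rightarrow> 'w stoch_measures \<Rightarrow>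
     (real \<Rightarrow> real) \<Rightarrow> (real \<Rightarrow> complex) \<Rightarrow> bool" where
  "optimal_char n \<mu> a M \<xi> Z f h \<longleftrightarrow>
     h \<in> admissible n \<mu> f \<and> (\<forall>h'\<in>admissible n \<mu> f. mse n \<mu> a M \<xi> Z h f \<le> mse n \<mu> a M \<xi> Z h' f)"

text \<open>All minimizers for a given density give the same error, so it does not matter which one
  represents the optimal spectral characteristic.\<close>

definition least_favorable ::
    "nat \<Rightarrow> nat \<Rightarrow> (nat \<Rightarrow> complex) \<Rightarrow> 'w spaces \<Rightarrow> 'w sequences \<Rightarrow> 'w stoch_measures \<Rightarrow>
     (real \<Rightarrow> real) set \<Rightarrow> (real \<Rightarrow> real) \<Rightarrow> bool" where
  "least_favorable n \<mu> a M \<xi> Z D f0 \<longleftrightarrow>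
     f0 \<in> D \<and>
     (\<exists>h0. optimal_char n \<mu> a M \<xi> Z f0 h0 \<and>
        (\<forall>f\<in>D. \<exists>h. optimal_char n \<mu> a M \<xi> Z f h \<and>
           mse n \<mu> a M \<xi> Z h f \<le> mse n \<mu> a M \<xi> Z h0 f0))"

definition H_class :: "nat \<Rightarrow> nat \<Rightarrow> (real \<Rightarrow> real) set \<Rightarrow> (real \<Rightarrow> complex) set" where
  "H_class n \<mu> D = {h. \<forall>f\<in>D. h \<in> admissible n \<mu> f}"

text \<open>The maximum over \<open>D\<close> need not be attained for every competitor \<open>h\<close>, so it is a supremum
  there; for \<open>h0\<close> itself it is attained.\<close>

definition minimax_robust ::
    "nat \<Rightarrow> nat \<Rightarrow> (nat \<Rightarrow> complex) \<Rightarrow> 'w spaces \<Rightarrow> 'w sequences \<Rightarrow> 'w stoch_measures \<Rightarrow>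
     (real \<Rightarrow> real) set \<Rightarrow> (real \<Rightarrow> complex) \<Rightarrow> bool" where
  "minimax_robust n \<mu> a M \<xi> Z D h0 \<longleftrightarrow>
     h0 \<in> H_class n \<mu> D \<and>
     (\<exists>f1\<in>D. \<forall>f\<in>D. mse n \<mu> a M \<xi> Z h0 f \<le> mse n \<mu> a M \<xi> Z h0 f1) \<and>
     (INF h\<in>H_class n \<mu> D. SUP f\<in>D. mse n \<mu> a M \<xi> Z h f) = (SUP f\<in>D. mse n \<mu> a M \<xi> Z h0 f)"


section \<open>The equation, the densities and the extremal values\<close>

definition solves_eq :: "nat \<Rightarrow> nat \<Rightarrow> (nat \<Rightarrow> complex) \<Rightarrow> (nat \<Rightarrow> complex) \<Rightarrow> bool" where
  "solves_eq n \<mu> a \<phi> \<longleftrightarrow> (\<exists>\<alpha>. \<forall>k. DAW n \<mu> a \<phi> k = \<alpha> * cnj (\<phi> k))"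

definition r_fun :: "nat \<Rightarrow> nat \<Rightarrow> (nat \<Rightarrow> complex) \<Rightarrow> (nat \<Rightarrow> complex) \<Rightarrow> real \<Rightarrow> complex" where
  "r_fun n \<mu> a \<phi> t = power_ser (DAW n \<mu> a \<phi>) (cis t)"

definition max_density ::
    "nat \<Rightarrow> nat \<Rightarrow> (nat \<Rightarrow> complex) \<Rightarrow> (real \<Rightarrow> real) \<Rightarrow> complex \<Rightarrow> (nat \<Rightarrow> complex) \<Rightarrow>
     real \<Rightarrow> real" where
  "max_density n \<mu> a v c \<phi> t = max (v t) ((cmod (c * r_fun n \<mu> a \<phi> t))\<^sup>2)"

definition nu_set ::
    "nat \<Rightarrow> nat \<Rightarrow> (nat \<Rightarrow> complex) \<Rightarrow> (real \<Rightarrow> real) \<Rightarrow> real \<Rightarrow> (nat \<Rightarrow> complex) set" where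
  "nu_set n \<mu> a v \<epsilon> = {\<phi>. solves_eq n \<mu> a \<phi> \<and> (AE t in freq. v t \<le> seq_density \<phi> t) \<and>
     l2_sq \<phi> = P1 v \<epsilon> \<and> canonical_factorization \<phi> (seq_density \<phi>)}"

definition nu_plus_set ::
    "nat \<Rightarrow> nat \<Rightarrow> (nat \<Rightarrow> complex) \<Rightarrow> (real \<Rightarrow> real) \<Rightarrow> real \<Rightarrow> (nat \<Rightarrow> complex) set" where
  "nu_plus_set n \<mu> a v \<epsilon> = {\<phi>. l2_sq \<phi> = P1 v \<epsilon> \<and>
     (\<exists>c. canonical_factorization \<phi> (max_density n \<mu> a v c \<phi>))}"

text \<open>Suprema, which are the maximum values whenever these exist; the value is \<open>0\<close> for an empty
  set.\<close>

definition nu_eps ::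
    "nat \<Rightarrow> nat \<Rightarrow> (nat \<Rightarrow> complex) \<Rightarrow> (real \<Rightarrow> real) \<Rightarrow> real \<Rightarrow> ennreal" where
  "nu_eps n \<mu> a v \<epsilon> =
     (SUP \<phi>\<in>nu_set n \<mu> a v \<epsilon>. ennreal (l2_sq (DAW n \<mu> a \<phi>))) / ennreal (P1 v \<epsilon>)"

definition nu_plus ::
    "nat \<Rightarrow> nat \<Rightarrow> (nat \<Rightarrow> complex) \<Rightarrow> (real \<Rightarrow> real) \<Rightarrow> real \<Rightarrow> ennreal" where
  "nu_plus n \<mu> a v \<epsilon> =
     (SUP \<phi>\<in>nu_plus_set n \<mu> a v \<epsilon>. ennreal (l2_sq (DAW n \<mu> a \<phi>))) / ennreal (P1 v \<epsilon>)"

text \<open>\<open>\<phi>\<close> solves the conditional extremum problem over the densities of \<open>D_eps v \<epsilon>\<close> that admit a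
  canonical factorization.\<close>

definition extremal_seq ::
    "nat \<Rightarrow> nat \<Rightarrow> (nat \<Rightarrow> complex) \<Rightarrow> (real \<Rightarrow> real) \<Rightarrow> real \<Rightarrow> (nat \<Rightarrow> complex) \<Rightarrow> bool" where
  "extremal_seq n \<mu> a v \<epsilon> \<phi> \<longleftrightarrow>
     seq_density \<phi> \<in> D_eps v \<epsilon> \<and> canonical_factorization \<phi> (seq_density \<phi>) \<and>
     (\<forall>\<psi>. seq_density \<psi> \<in> D_eps v \<epsilon> \<and> canonical_factorization \<psi> (seq_density \<psi>) \<longrightarrow>
        l2_sq (DAW n \<mu> a \<psi>) \<le> l2_sq (DAW n \<mu> a \<phi>))"

definition determines_max_density ::
    "nat \<Rightarrow> nat \<Rightarrow> (nat \<Rightarrow> complex) \<Rightarrow> (real \<Rightarrow> real) \<Rightarrow> real \<Rightarrow> complex \<Rightarrow> (nat \<Rightarrow> complex) \<Rightarrow>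
     bool" where
  "determines_max_density n \<mu> a v \<epsilon> c \<phi> \<longleftrightarrow>
     canonical_factorization \<phi> (max_density n \<mu> a v c \<phi>) \<and>
     extremal_seq n \<mu> a v \<epsilon> \<phi> \<and>
     (\<integral>t. max_density n \<mu> a v c \<phi> t \<partial>freq) = 2 * pi * \<epsilon> + (\<integral>t. v t \<partial>freq)"

definition h_char ::
    "nat \<Rightarrow> nat \<Rightarrow> (nat \<Rightarrow> complex) \<Rightarrow> (nat \<Rightarrow> complex) \<Rightarrow> real \<Rightarrow> complex" where
  "h_char n \<mu> a \<phi> t =
     power_ser (b_coeff n \<mu> a) (cis t) -
     r_fun n \<mu> a \<phi> t * inverse (power_ser (phi_mu n \<mu> \<phi>) (cis (- t)))"

end

theory Submission
  imports Defs
begin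

text \<open>
  The error of a spectral characteristic \<open>h\<close> under a density \<open>f\<close> is, by the isometry of the stochastic
  integral, the squared norm in \<open>L\<^sub>2(f)\<close> of \<open>(A - h) K\<close>, where \<open>K\<close> is the kernel of the increments
  (\<open>estimation_error\<close>). It is linear in \<open>f\<close> and quadratic in \<open>h\<close>, and the theorem describes the saddle
  points of this function.

  Let \<open>f0 = |\<Phi>|\<^sup>2\<close> be canonically factorized by \<open>\<phi>\<close>, let \<open>\<Phi>\<^sub>\<mu> = w \<Phi>\<close> and let \<open>r\<close> be the series
  with the coefficients \<open>D A W \<phi>\<close>. Since \<open>D A\<close> is a Hankel matrix, \<open>r\<close> is the part of \<open>A \<Phi>\<^sub>\<mu>\<close> with
  nonnegative frequencies (\<open>hankel_toeplitz_split\<close>). So the characteristic \<open>h0 = A - r / \<Phi>\<^sub>\<mu>\<close> is a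
  series of negative frequencies divided by \<open>\<Phi>\<^sub>\<mu>\<close>, and its error \<open>r K / \<Phi>\<^sub>\<mu>\<close> is orthogonal in \<open>L\<^sub>2(f0)\<close>
  to the past (\<open>err_h0_orthogonal\<close>). Consequently \<open>h0\<close> is optimal for \<open>f0\<close>, and any other optimal
  characteristic agrees with it almost everywhere.
  Because \<open>|w| = |K|\<close> on the circle, its error under another density \<open>f\<close> is the mean of
  \<open>(|r|\<^sup>2 / |\<Phi>|\<^sup>2) f\<close> (\<open>mse_freq_h0\<close>).

  A mean of this kind is maximal on the ball \<open>D_eps v \<epsilon>\<close> at a density that exhausts the radius, lies above
  \<open>v\<close> and exceeds \<open>v\<close> only where the weight \<open>|r|\<^sup>2 / |\<Phi>|\<^sup>2\<close> attains its maximum (\<open>Lagrange_saddle\<close>). Both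
  families of candidates have this property: for a solution of the equation the weight is constant
  (\<open>nu_saddle\<close>), and for a density \<open>max v |c r|\<^sup>2\<close> it equals \<open>1 / |c|\<^sup>2\<close> wherever \<open>v\<close> is exceeded
  (\<open>max_density_saddle\<close>). A saddle point is least favorable, which gives the first two parts. For the third
  part the saddle point has to be recovered from maximality of \<open>f0\<close>: the optimal characteristics of
  mixtures of \<open>f0\<close> with \<open>f\<close> converge to \<open>h0\<close> (\<open>saddle_of_least_favorable\<close>).

  The analytic work lies in the admissibility of \<open>h0\<close> for all densities of the class simultaneously. The
  function \<open>w\<close> vanishes on the circle at the zeros of \<open>1 + z + ... + z ^ (\<mu> - 1)\<close>, so \<open>h0\<close> may be unbounded.
  An explicit factorization separates these zeros from a factor that is invertible in the Wiener algebra
  (\<open>w_coeff_factorization\<close>), and division by the zeros is justified by an approximation that is bounded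
  uniformly against the kernel (\<open>kernel_quotient_approx\<close>). The same approximation shows that the
  innovations of the moving average have mean zero.
\<close>

section \<open>Square integrable functions\<close>

definition square_integrable :: "'a measure \<Rightarrow> ('a \<Rightarrow> complex) \<Rightarrow> bool" where
  "square_integrable M g \<longleftrightarrow> g \<in> borel_measurable M \<and> integrable M (\<lambda>x. (cmod (g x))\<^sup>2)"

definition L2_norm :: "'a measure \<Rightarrow> ('a \<Rightarrow> complex) \<Rightarrow> real" where
  "L2_norm M g = sqrt (\<integral>x. (cmod (g x))\<^sup>2 \<partial>M)"

lemma square_integrable_measurable [measurable_dest]:
  "square_integrable M g \<Longrightarrow> g \<in> borel_measurable M"
  by (simp add: square_integrable_def)

lemma square_integrableD: "square_integrable M g \<Longrightarrow> integrable M (\<lambda>x. (cmod (g x))\<^sup>2)"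
  by (simp add: square_integrable_def)

lemma L2_norm_nonneg [simp]: "0 \<le> L2_norm M g"
  by (simp add: L2_norm_def)

lemma L2_norm_square: "(L2_norm M g)\<^sup>2 = (\<integral>x. (cmod (g x))\<^sup>2 \<partial>M)"
  by (simp add: L2_norm_def)

lemma norm_add_square_le:
  fixes a b :: complex
  shows "(cmod (a + b))\<^sup>2 \<le> 2 * (cmod a)\<^sup>2 + 2 * (cmod b)\<^sup>2"
proof -
  have "(cmod (a + b))\<^sup>2 \<le> (cmod a + cmod b)\<^sup>2"
    by (intro power_mono norm_triangle_ineq) auto
  also have "\<dots> \<le> 2 * (cmod a)\<^sup>2 + 2 * (cmod b)\<^sup>2"
    using sum_squares_bound[of "cmod a" "cmod b"] by (simp add: power2_sum)
  finally show ?thesis .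
qed

lemma square_integrable_add [intro]:
  assumes "square_integrable M f" "square_integrable M g"
  shows "square_integrable M (\<lambda>x. f x + g x)"
proof -
  have [measurable]: "f \<in> borel_measurable M" "g \<in> borel_measurable M"
    using assms by (auto simp: square_integrable_def)
  have "integrable M (\<lambda>x. (cmod (f x + g x))\<^sup>2)"
    by (rule Bochner_Integration.integrable_bound[where f = "\<lambda>x. 2 * (cmod (f x))\<^sup>2 + 2 * (cmod (g x))\<^sup>2"])
      (use assms norm_add_square_le in \<open>auto simp: square_integrable_def intro!: AE_I2\<close>)
  then show ?thesis
    by (simp add: square_integrable_def)
qed

lemma square_integrable_cmult [intro]:
  "square_integrable M f \<Longrightarrow> square_integrable M (\<lambda>x. c * f x)"
  by (auto simp: square_integrable_def norm_mult power_mult_distrib)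

lemma square_integrable_uminus:
  "square_integrable M f \<Longrightarrow> square_integrable M (\<lambda>x. - f x)"
  by (auto simp: square_integrable_def)

lemma square_integrable_diff [intro]:
  "square_integrable M f \<Longrightarrow> square_integrable M g \<Longrightarrow> square_integrable M (\<lambda>x. f x - g x)"
  using square_integrable_add[OF _ square_integrable_uminus, of M f g] by simp

lemma square_integrable_zero [simp]: "square_integrable M (\<lambda>x. 0)"
  by (simp add: square_integrable_def)

lemma square_integrable_sum:
  "(\<And>i. i \<in> I \<Longrightarrow> square_integrable M (f i)) \<Longrightarrow> square_integrable M (\<lambda>x. \<Sum>i\<in>I. f i x)"
  by (induction I rule: infinite_finite_induct) auto

lemma square_integrable_cong_AE:
  assumes "square_integrable M f" "g \<in> borel_measurable M" "AE x in M. f x = g x"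
  shows "square_integrable M g"
proof -
  have "integrable M (\<lambda>x. (cmod (f x))\<^sup>2) = integrable M (\<lambda>x. (cmod (g x))\<^sup>2)"
    using assms by (intro integrable_cong_AE) (auto simp: square_integrable_def)
  then show ?thesis
    using assms by (auto simp: square_integrable_def)
qed

lemma nn_integral_square:
  assumes "square_integrable M g"
  shows "(\<integral>\<^sup>+x. ennreal ((cmod (g x))\<^sup>2) \<partial>M) = ennreal ((L2_norm M g)\<^sup>2)"
  using assms unfolding L2_norm_square square_integrable_def
  by (intro nn_integral_eq_integral) auto

lemma square_integrableI_nn:
  assumes "g \<in> borel_measurable M" "(\<integral>\<^sup>+x. ennreal ((cmod (g x))\<^sup>2) \<partial>M) < \<infinity>"
  shows "square_integrable M g"
  using assms unfolding square_integrable_def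
  by (intro conjI integrableI_nonneg) auto

lemma square_integrable_prod:
  assumes "square_integrable M f" "square_integrable M g"
  shows "integrable M (\<lambda>x. f x * g x)"
proof -
  have [measurable]: "f \<in> borel_measurable M" "g \<in> borel_measurable M"
    using assms by (auto simp: square_integrable_def)
  show ?thesis
  proof (rule Bochner_Integration.integrable_bound)
    show "integrable M (\<lambda>x. (cmod (f x))\<^sup>2 + (cmod (g x))\<^sup>2)"
      using assms by (auto simp: square_integrable_def)
    have "norm (f x * g x) \<le> norm ((cmod (f x))\<^sup>2 + (cmod (g x))\<^sup>2)" for x
    proof -
      have "2 * (cmod (f x) * cmod (g x)) \<le> (cmod (f x))\<^sup>2 + (cmod (g x))\<^sup>2"
        using sum_squares_bound[of "cmod (f x)" "cmod (g x)"] by simp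
      moreover have "0 \<le> cmod (f x) * cmod (g x)" by simp
      ultimately have "cmod (f x) * cmod (g x) \<le> (cmod (f x))\<^sup>2 + (cmod (g x))\<^sup>2"
        by linarith
      then show ?thesis
        by (simp add: norm_mult)
    qed
    then show "AE x in M. norm (f x * g x) \<le> norm ((cmod (f x))\<^sup>2 + (cmod (g x))\<^sup>2)"
      by simp
  qed simp
qed

lemma borel_measurable_cnj [measurable]:
  "f \<in> borel_measurable M \<Longrightarrow> (\<lambda>x. cnj (f x)) \<in> borel_measurable M"
  by (rule borel_measurable_continuous_on[where f = cnj]) (auto intro: continuous_intros)

lemma square_integrable_cnj: "square_integrable M f \<Longrightarrow> square_integrable M (\<lambda>x. cnj (f x))"
  by (simp add: square_integrable_def borel_measurable_cnj)

lemma L2_norm_eq_0_iff: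
  assumes "square_integrable M g"
  shows "L2_norm M g = 0 \<longleftrightarrow> (AE x in M. g x = 0)"
  using integral_nonneg_eq_0_iff_AE[of M "\<lambda>x. (cmod (g x))\<^sup>2"] assms
  by (simp add: L2_norm_def square_integrable_def)

text \<open>Pointwise, the product is at most half of the sum of the two squares with weights
  \<open>\<parallel>g\<parallel> / \<parallel>f\<parallel>\<close> and \<open>\<parallel>f\<parallel>
  / \<parallel>g\<parallel>\<close>; these weights make both halves integrate to the same number. If a
  norm vanishes, so does the product almost everywhere.\<close>

lemma Cauchy_Schwarz_integral:
  assumes f: "square_integrable M f" and g: "square_integrable M g"
  shows "(\<integral>x. cmod (f x) * cmod (g x) \<partial>M) \<le> L2_norm M f * L2_norm M g"
proof (cases "L2_norm M f = 0 \<or> L2_norm M g = 0")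
  case True
  then have "AE x in M. cmod (f x) * cmod (g x) = 0"
    using L2_norm_eq_0_iff[OF f] L2_norm_eq_0_iff[OF g] by (auto elim: AE_mp)
  then have "(\<integral>x. cmod (f x) * cmod (g x) \<partial>M) = 0"
    using square_integrable_measurable[OF f] square_integrable_measurable[OF g]
    by (intro integral_eq_zero_AE)
  then show ?thesis
    using True by auto
next
  case False
  let ?a = "L2_norm M f" and ?b = "L2_norm M g"
  have pos: "?a > 0" "?b > 0"
    using False by (metis L2_norm_nonneg less_le)+
  have "integrable M (\<lambda>x. cmod (f x) * cmod (g x))"
    using integrable_norm[OF square_integrable_prod[OF f g]] by (simp add: norm_mult)
  moreover have "integrable M (\<lambda>x. (?b / ?a * (cmod (f x))\<^sup>2 + ?a / ?b * (cmod (g x))\<^sup>2) / 2)"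
    using square_integrableD[OF f] square_integrableD[OF g] by auto
  moreover have "cmod (f x) * cmod (g x) \<le> (?b / ?a * (cmod (f x))\<^sup>2 + ?a / ?b * (cmod (g x))\<^sup>2) / 2" for x
  proof -
    have "0 \<le> (sqrt (?b / ?a) * cmod (f x) - sqrt (?a / ?b) * cmod (g x))\<^sup>2" by simp
    also have "\<dots> = ?b / ?a * (cmod (f x))\<^sup>2 + ?a / ?b * (cmod (g x))\<^sup>2
        - 2 * (sqrt (?b / ?a) * sqrt (?a / ?b)) * (cmod (f x) * cmod (g x))"
      using pos by (simp add: power2_diff power_mult_distrib)
    also have "sqrt (?b / ?a) * sqrt (?a / ?b) = 1"
      using pos by (simp flip: real_sqrt_mult)
    finally show ?thesis by simp
  qed
  ultimately have "(\<integral>x. cmod (f x) * cmod (g x) \<partial>M)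
      \<le> (\<integral>x. (?b / ?a * (cmod (f x))\<^sup>2 + ?a / ?b * (cmod (g x))\<^sup>2) / 2 \<partial>M)"
    by (intro integral_mono)
  also have "\<dots> = (?b / ?a * ?a\<^sup>2 + ?a / ?b * ?b\<^sup>2) / 2"
    unfolding L2_norm_square using square_integrableD[OF f] square_integrableD[OF g] by simp
  also have "\<dots> = ?a * ?b"
    using pos by (simp add: power2_eq_square)
  finally show ?thesis .
qed

lemma L2_norm_triangle:
  assumes f: "square_integrable M f" and g: "square_integrable M g"
  shows "L2_norm M (\<lambda>x. f x + g x) \<le> L2_norm M f + L2_norm M g"
proof -
  have int: "integrable M (\<lambda>x. cmod (f x) * cmod (g x))"
    using integrable_norm[OF square_integrable_prod[OF f g]] by (simp add: norm_mult)
  have "(L2_norm M (\<lambda>x. f x + g x))\<^sup>2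
      \<le> (\<integral>x. (cmod (f x))\<^sup>2 + (cmod (g x))\<^sup>2 + 2 * (cmod (f x) * cmod (g x)) \<partial>M)"
    unfolding L2_norm_square
  proof (intro integral_mono)
    show "integrable M (\<lambda>x. (cmod (f x + g x))\<^sup>2)"
      using square_integrable_add[OF f g] by (rule square_integrableD)
    fix x
    have "(cmod (f x + g x))\<^sup>2 \<le> (cmod (f x) + cmod (g x))\<^sup>2"
      by (intro power_mono norm_triangle_ineq) auto
    then show "(cmod (f x + g x))\<^sup>2 \<le> (cmod (f x))\<^sup>2 + (cmod (g x))\<^sup>2 + 2 * (cmod (f x) * cmod (g x))"
      by (simp add: power2_sum)
  qed (use int square_integrableD[OF f] square_integrableD[OF g] in auto)
  also have "\<dots> = (L2_norm M f)\<^sup>2 + (L2_norm M g)\<^sup>2 + 2 * (\<integral>x. cmod (f x) * cmod (g x) \<partial>M)"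
    unfolding L2_norm_square
    using int square_integrableD[OF f] square_integrableD[OF g] by simp
  also have "\<dots> \<le> (L2_norm M f + L2_norm M g)\<^sup>2"
    using Cauchy_Schwarz_integral[OF f g] by (simp add: power2_sum)
  finally show ?thesis
    by (rule power2_le_imp_le) simp
qed

lemma L2_norm_cmult: "L2_norm M (\<lambda>x. c * f x) = cmod c * L2_norm M f"
  by (simp add: L2_norm_def norm_mult power_mult_distrib real_sqrt_mult)

lemma L2_norm_uminus: "L2_norm M (\<lambda>x. - f x) = L2_norm M f"
  by (simp add: L2_norm_def)

lemma L2_norm_commute: "L2_norm M (\<lambda>x. f x - g x) = L2_norm M (\<lambda>x. g x - f x)"
  by (simp add: L2_norm_def norm_minus_commute)

lemma L2_norm_triangle_diff:
  assumes "square_integrable M f" "square_integrable M g" "square_integrable M h"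
  shows "L2_norm M (\<lambda>x. f x - h x) \<le> L2_norm M (\<lambda>x. f x - g x) + L2_norm M (\<lambda>x. g x - h x)"
  using L2_norm_triangle[OF square_integrable_diff[OF assms(1,2)] square_integrable_diff[OF assms(2,3)]]
  by simp

lemma L2_norm_diff_abs:
  assumes f: "square_integrable M f" and g: "square_integrable M g"
  shows "\<bar>L2_norm M f - L2_norm M g\<bar> \<le> L2_norm M (\<lambda>x. f x - g x)"
  using L2_norm_triangle_diff[OF f g square_integrable_zero]
    L2_norm_triangle_diff[OF g f square_integrable_zero] L2_norm_commute[of M f g]
  by simp

lemma L2_norm_tendsto:
  assumes "\<And>k. square_integrable M (f k)" "square_integrable M g"
    and "(\<lambda>k. L2_norm M (\<lambda>x. f k x - g x)) \<longlonglongrightarrow> 0"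
  shows "(\<lambda>k. L2_norm M (f k)) \<longlonglongrightarrow> L2_norm M g"
proof (rule LIM_zero_cancel, rule Lim_null_comparison[OF _ assms(3)])
  show "\<forall>\<^sub>F k in sequentially. norm (L2_norm M (f k) - L2_norm M g) \<le> L2_norm M (\<lambda>x. f k x - g x)"
    using L2_norm_diff_abs[OF assms(1,2)] by simp
qed

lemma L2_norm_cong_AE:
  assumes "f \<in> borel_measurable M" "g \<in> borel_measurable M" "AE x in M. f x = g x"
  shows "L2_norm M f = L2_norm M g"
  unfolding L2_norm_def using assms by (intro arg_cong[where f = sqrt] integral_cong_AE) auto

lemma AE_summable_of_summable_integral:
  fixes h :: "nat \<Rightarrow> 'a \<Rightarrow> real"
  assumes int: "\<And>k. integrable M (h k)" and nonneg: "\<And>k x. 0 \<le> h k x"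
    and sum: "summable (\<lambda>k. \<integral>x. h k x \<partial>M)"
  shows "AE x in M. summable (\<lambda>k. h k x)"
proof -
  have [measurable]: "h k \<in> borel_measurable M" for k
    using int by auto
  have "(\<integral>\<^sup>+x. (\<Sum>k. ennreal (h k x)) \<partial>M) = (\<Sum>k. \<integral>\<^sup>+x. ennreal (h k x) \<partial>M)"
    by (intro nn_integral_suminf) auto
  also have "\<dots> = (\<Sum>k. ennreal (\<integral>x. h k x \<partial>M))"
    using int nonneg by (intro suminf_cong nn_integral_eq_integral) auto
  also have "\<dots> < \<infinity>"
    using sum nonneg by (simp add: suminf_ennreal2 integral_nonneg_AE)
  finally have "AE x in M. (\<Sum>k. ennreal (h k x)) \<noteq> \<infinity>"
    by (intro nn_integral_PInf_AE) auto
  then show ?thesis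
    by eventually_elim (use nonneg summable_suminf_not_top in auto)
qed

text \<open>The sum of the squared moduli has a finite integral, so it is finite almost everywhere
  and its terms tend to zero.\<close>

lemma AE_tendsto_0_of_summable_L2:
  assumes int: "\<And>k. square_integrable M (g k)" and sum: "summable (\<lambda>k. (L2_norm M (g k))\<^sup>2)"
  shows "AE x in M. (\<lambda>k. g k x) \<longlonglongrightarrow> 0"
proof -
  have "AE x in M. summable (\<lambda>k. (cmod (g k x))\<^sup>2)"
    using sum square_integrableD[OF int]
    by (intro AE_summable_of_summable_integral) (auto simp: L2_norm_square)
  then show ?thesis
  proof eventually_elim
    case (elim x)
    then have "(\<lambda>k. sqrt ((cmod (g k x))\<^sup>2)) \<longlonglongrightarrow> sqrt 0"
      by (intro tendsto_real_sqrt summable_LIMSEQ_zero)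
    then show ?case
      by (simp add: tendsto_norm_zero_iff)
  qed
qed

text \<open>Norm bounds survive almost everywhere limits. This is how convergence in mean is
  obtained from pointwise convergence, both in the proof of completeness and for the optimal errors
  along a mixture.\<close>

lemma L2_Fatou:
  assumes int: "\<And>k. square_integrable M (f k)" and g: "g \<in> borel_measurable M"
    and lim: "AE x in M. (\<lambda>k. f k x) \<longlonglongrightarrow> g x"
    and bound: "\<forall>\<^sub>F k in sequentially. L2_norm M (f k) \<le> C"
  shows "square_integrable M g \<and> L2_norm M g \<le> C"
proof -
  have [measurable]: "f k \<in> borel_measurable M" for k
    using int by (auto simp: square_integrable_def)
  have C: "C \<ge> 0"
    using bound L2_norm_nonneg order_trans unfolding eventually_sequentially by blast
  have "(\<integral>\<^sup>+x. ennreal ((cmod (g x))\<^sup>2) \<partial>M)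
      = (\<integral>\<^sup>+x. liminf (\<lambda>k. ennreal ((cmod (f k x))\<^sup>2)) \<partial>M)"
  proof (rule nn_integral_cong_AE)
    show "AE x in M. ennreal ((cmod (g x))\<^sup>2) = liminf (\<lambda>k. ennreal ((cmod (f k x))\<^sup>2))"
      using lim
    proof eventually_elim
      case (elim x)
      then have "(\<lambda>k. ennreal ((cmod (f k x))\<^sup>2)) \<longlonglongrightarrow> ennreal ((cmod (g x))\<^sup>2)"
        by (intro tendsto_ennrealI tendsto_intros)
      then show ?case
        by (simp add: lim_imp_Liminf[symmetric])
    qed
  qed
  also have "\<dots> \<le> liminf (\<lambda>k. \<integral>\<^sup>+x. ennreal ((cmod (f k x))\<^sup>2) \<partial>M)"
    by (intro nn_integral_liminf) auto
  also have "\<dots> \<le> limsup (\<lambda>k. \<integral>\<^sup>+x. ennreal ((cmod (f k x))\<^sup>2) \<partial>M)"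
    by (intro Liminf_le_Limsup) auto
  also have "\<dots> \<le> ennreal (C\<^sup>2)"
  proof (rule Limsup_bounded)
    show "\<forall>\<^sub>F k in sequentially. (\<integral>\<^sup>+x. ennreal ((cmod (f k x))\<^sup>2) \<partial>M) \<le> ennreal (C\<^sup>2)"
      using bound by eventually_elim (auto simp: nn_integral_square[OF int] intro!: ennreal_leI power_mono)
  qed
  finally have *: "(\<integral>\<^sup>+x. ennreal ((cmod (g x))\<^sup>2) \<partial>M) \<le> ennreal (C\<^sup>2)" .
  then have sq: "square_integrable M g"
    by (intro square_integrableI_nn g) (auto intro: le_less_trans)
  have "(L2_norm M g)\<^sup>2 \<le> C\<^sup>2"
    using * C by (simp add: nn_integral_square[OF sq])
  then show ?thesis
    using sq C power2_le_imp_le by blast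
qed

text \<open>Riesz--Fischer: a subsequence whose increments are geometrically small converges almost
  everywhere, and Fatou's lemma shows that its limit is also the limit in mean of the whole
  sequence.\<close>

lemma L2_complete:
  assumes int: "\<And>k. square_integrable M (f k)"
    and Cauchy: "\<And>e. e > 0 \<Longrightarrow> \<exists>N. \<forall>i\<ge>N. \<forall>j\<ge>N. L2_norm M (\<lambda>x. f i x - f j x) < e"
  obtains g where "square_integrable M g" "(\<lambda>k. L2_norm M (\<lambda>x. f k x - g x)) \<longlonglongrightarrow> 0"
proof -
  have "\<exists>N. \<forall>i\<ge>N. \<forall>j\<ge>N. L2_norm M (\<lambda>x. f i x - f j x) < (1/2) ^ k" for k :: nat
    using Cauchy by simp
  then obtain R where R: "\<And>k i j. i \<ge> R k \<Longrightarrow> j \<ge> R k \<Longrightarrow> L2_norm M (\<lambda>x. f i x - f j x) < (1/2) ^ k"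
    by metis
  define r where "r k = (\<Sum>i\<le>k. R i + 1)" for k
  have r_ge: "r k \<ge> R k" for k
    unfolding r_def by (induction k) auto
  have r_mono: "strict_mono r"
    by (auto simp: strict_mono_Suc_iff r_def)
  define X where "X k = f (r k)" for k
  have X_int: "square_integrable M (X k)" for k
    by (simp add: X_def int)
  have [measurable]: "X k \<in> borel_measurable M" for k
    using X_int by (simp add: square_integrable_def)
  have X_int': "square_integrable M (\<lambda>x. X (Suc k) x - X k x)" for k
    by (intro square_integrable_diff X_int)
  have step: "L2_norm M (\<lambda>x. X (Suc k) x - X k x) \<le> (1/2) ^ k" for k
    unfolding X_def using r_ge[of k] strict_monoD[OF r_mono, of k "Suc k"]
    by (intro less_imp_le[OF R[of k]]) auto
  let ?h = "\<lambda>k x. 2 ^ k * (cmod (X (Suc k) x - X k x))\<^sup>2"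
  \<comment> \<open>The weight \<open>2 ^ k\<close> leaves the integrals summable, and by the inequality between the means
    each increment is at most \<open>(1/2) ^ k + ?h k x\<close>.\<close>
  have "AE x in M. summable (\<lambda>k. ?h k x)"
  proof (rule AE_summable_of_summable_integral)
    show "summable (\<lambda>k. \<integral>x. ?h k x \<partial>M)"
    proof (rule summable_comparison_test')
      show "summable (\<lambda>k. (1/2::real) ^ k)"
        by (rule summable_geometric) simp
      fix k :: nat
      have "(L2_norm M (\<lambda>x. X (Suc k) x - X k x))\<^sup>2 \<le> ((1/2) ^ k)\<^sup>2"
        using step by (intro power_mono) auto
      then have "2 ^ k * (L2_norm M (\<lambda>x. X (Suc k) x - X k x))\<^sup>2 \<le> 2 ^ k * ((1/2) ^ k)\<^sup>2"
        by (intro mult_left_mono) auto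
      also have "\<dots> = (1/2) ^ k"
        by (simp add: power2_eq_square field_simps)
      finally show "norm (\<integral>x. ?h k x \<partial>M) \<le> (1/2) ^ k"
        by (simp add: L2_norm_square)
    qed
  qed (use square_integrableD[OF X_int'] in auto)
  then have conv: "AE x in M. convergent (\<lambda>k. X k x)"
  proof eventually_elim
    case (elim x)
    have "summable (\<lambda>k. X (Suc k) x - X k x)"
    proof (rule summable_comparison_test')
      show "summable (\<lambda>k. (1/2) ^ k + ?h k x)"
        using elim by (intro summable_add summable_geometric) auto
      fix k :: nat
      let ?d = "cmod (X (Suc k) x - X k x)"
      have "0 \<le> (1 - 2 ^ k * ?d)\<^sup>2" by simp
      then have "2 * (2 ^ k * ?d) \<le> 1 + 2 ^ k * (2 ^ k * ?d\<^sup>2)"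
        by (simp add: power2_eq_square algebra_simps)
      then have "(1/2) ^ k * (2 * (2 ^ k * ?d)) \<le> (1/2) ^ k * (1 + 2 ^ k * (2 ^ k * ?d\<^sup>2))"
        by (intro mult_left_mono) auto
      then have "2 * ?d \<le> (1/2) ^ k + 2 ^ k * ?d\<^sup>2"
        by (simp add: field_simps power_one_over)
      moreover have "?d \<ge> 0" by simp
      ultimately show "norm (X (Suc k) x - X k x) \<le> (1/2) ^ k + ?h k x"
        by linarith
    qed
    then have "convergent (\<lambda>n. \<Sum>k<n. X (Suc k) x - X k x)"
      by (simp add: summable_iff_convergent)
    then have "convergent (\<lambda>n. X n x - X 0 x)"
      by (simp only: sum_lessThan_telescope[of "\<lambda>k. X k x"])
    from convergent_add[OF this convergent_const[of "X 0 x"]] show ?case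
      by simp
  qed
  define g where "g x = lim (\<lambda>k. X k x)" for x
  have g: "g \<in> borel_measurable M"
    unfolding g_def by measurable
  have lim: "AE x in M. (\<lambda>k. X k x) \<longlonglongrightarrow> g x"
    using conv by eventually_elim (simp add: g_def convergent_LIMSEQ_iff)
  have main: "square_integrable M (\<lambda>x. g x - f i x) \<and> L2_norm M (\<lambda>x. g x - f i x) \<le> (1/2) ^ k"
    if "i \<ge> R k" for i k
  proof (rule L2_Fatou)
    show "square_integrable M (\<lambda>x. X l x - f i x)" for l
      by (intro square_integrable_diff X_int int)
    show "(\<lambda>x. g x - f i x) \<in> borel_measurable M"
      using g square_integrable_measurable[OF int] by (rule borel_measurable_diff)
    show "AE x in M. (\<lambda>l. X l x - f i x) \<longlonglongrightarrow> g x - f i x"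
      using lim by eventually_elim (intro tendsto_intros)
    show "\<forall>\<^sub>F l in sequentially. L2_norm M (\<lambda>x. X l x - f i x) \<le> (1/2) ^ k"
      using eventually_ge_at_top[of k]
    proof eventually_elim
      case (elim l)
      have "R k \<le> r l"
        using r_ge[of k] strict_mono_less_eq[OF r_mono, of k l] elim by simp
      then show ?case
        unfolding X_def using R[of k "r l" i] that by (simp add: less_imp_le)
    qed
  qed
  have "square_integrable M (\<lambda>x. (g x - f (R 0) x) + f (R 0) x)"
    using main[where i = "R 0" and k = 0] int
    by (intro square_integrable_add[of M "\<lambda>x. g x - f (R 0) x" "f (R 0)"]) auto
  then have "square_integrable M g" by simp
  moreover have "(\<lambda>k. L2_norm M (\<lambda>x. f k x - g x)) \<longlonglongrightarrow> 0"
  proof (rule LIMSEQ_I)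
    fix e :: real assume "e > 0"
    then obtain k :: nat where k: "(1/2) ^ k < e"
      using real_arch_pow_inv[of e "1/2"] by auto
    show "\<exists>N. \<forall>i\<ge>N. norm (L2_norm M (\<lambda>x. f i x - g x) - 0) < e"
      using main[of k] k by (intro exI[of _ "R k"]) (auto simp: L2_norm_commute[of M _ g] intro: le_less_trans)
  qed
  ultimately show ?thesis ..
qed

section \<open>Stochastic integrals\<close>

lemma space_freq [simp]: "space freq = {-pi..pi}"
  by (simp add: freq_def space_restrict_space)

lemma sets_freq: "sets freq = sets (restrict_space borel {-pi..pi})"
  by (simp add: freq_def sets_restrict_space)

lemma borel_measurable_freq: "g \<in> borel_measurable borel \<Longrightarrow> g \<in> borel_measurable freq"
  by (simp add: freq_def measurable_restrict_space1)

lemma emeasure_freq: "emeasure freq {-pi..pi} = ennreal (2 * pi)"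
  by (simp add: freq_def emeasure_restrict_space)

lemma whole_in_freq [simp]: "{-pi..pi} \<in> sets freq"
  using sets.top[of freq] by simp

interpretation freq: finite_measure freq
  by standard (simp add: emeasure_freq)

lemma sets_spectral_measure [simp, measurable_cong]: "sets (spectral_measure f) = sets freq"
  by (simp add: spectral_measure_def)

lemma space_spectral_measure [simp]: "space (spectral_measure f) = {-pi..pi}"
  by (simp add: spectral_measure_def)

lemma measurable_spectral_measure [simp]:
  "borel_measurable (spectral_measure f) = borel_measurable freq"
  by (rule measurable_cong_sets) auto

lemma spectral_densityD:
  assumes "spectral_density f"
  shows "integrable freq f" "f \<in> borel_measurable freq" "\<And>t. t \<in> {-pi..pi} \<Longrightarrow> 0 \<le> f t"
    "AE t in freq. 0 \<le> f t"
  using assms by (auto simp: spectral_density_def intro!: AE_I2)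

lemma finite_spectral_measure:
  assumes "spectral_density f"
  shows "finite_measure (spectral_measure f)"
proof
  have "emeasure (spectral_measure f) (space freq) = (\<integral>\<^sup>+t. ennreal (f t / (2 * pi)) \<partial>freq)"
    unfolding spectral_measure_def
    by (subst emeasure_density)
      (use spectral_densityD[OF assms] in \<open>auto intro!: nn_integral_cong simp: indicator_def\<close>)
  also have "\<dots> < \<infinity>"
    using spectral_densityD[OF assms] by (subst nn_integral_eq_integral) auto
  finally show "emeasure (spectral_measure f) (space (spectral_measure f)) \<noteq> \<infinity>"
    by simp
qed

lemma integral_spectral_measure:
  fixes g :: "real \<Rightarrow> 'b::{banach, second_countable_topology}"
  assumes "spectral_density f" "g \<in> borel_measurable freq"
  shows "(\<integral>t. g t \<partial>spectral_measure f) = (\<integral>t. (f t / (2 * pi)) *\<^sub>R g t \<partial>freq)"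
  unfolding spectral_measure_def
  using spectral_densityD[OF assms(1)] assms(2) by (intro integral_density) auto

lemma integrable_spectral_measure:
  fixes g :: "real \<Rightarrow> 'b::{banach, second_countable_topology}"
  assumes "spectral_density f" "g \<in> borel_measurable freq"
  shows "integrable (spectral_measure f) g \<longleftrightarrow> integrable freq (\<lambda>t. (f t / (2 * pi)) *\<^sub>R g t)"
  unfolding spectral_measure_def
  using spectral_densityD[OF assms(1)] assms(2) by (intro integrable_density) auto

lemma AE_spectral_measure:
  assumes "spectral_density f" "AE t in freq. P t"
  shows "AE t in spectral_measure f. P t"
  unfolding spectral_measure_def
  using spectral_densityD[OF assms(1)] assms(2) by (subst AE_density) (auto elim: eventually_mono)

definition simple_list :: "(complex \<times> real set) list \<Rightarrow> bool" where
  "simple_list S \<longleftrightarrow> (\<forall>(c, A)\<in>set S. A \<in> sets freq)"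

lemma simple_list_simps [simp]:
  "simple_list []"
  "simple_list ((c, A) # S) \<longleftrightarrow> A \<in> sets freq \<and> simple_list S"
  "simple_list (S @ T) \<longleftrightarrow> simple_list S \<and> simple_list T"
  by (auto simp: simple_list_def)

text \<open>Together with concatenation of lists this gives simple functions their vector space
  structure.\<close>

definition scale_simple :: "complex \<Rightarrow> (complex \<times> real set) list \<Rightarrow> (complex \<times> real set) list" where
  "scale_simple c S = map (\<lambda>(d, A). (c * d, A)) S"

lemma simple_list_scale [simp]: "simple_list (scale_simple c S) \<longleftrightarrow> simple_list S"
  by (auto simp: simple_list_def scale_simple_def)

lemma simple_fun_simps [simp]:
  "simple_fun [] t = 0"
  "simple_fun ((c, A) # S) t = c * indicator A t + simple_fun S t"
  "simple_fun (S @ T) t = simple_fun S t + simple_fun T t"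
  by (auto simp: simple_fun_def)

lemma simple_fun_scale [simp]: "simple_fun (scale_simple c S) t = c * simple_fun S t"
  by (induction S) (auto simp: scale_simple_def simple_fun_def algebra_simps)

lemma simple_stoch_integral_simps [simp]:
  "simple_stoch_integral Z [] \<omega> = 0"
  "simple_stoch_integral Z ((c, A) # S) \<omega> = c * Z A \<omega> + simple_stoch_integral Z S \<omega>"
  "simple_stoch_integral Z (S @ T) \<omega> = simple_stoch_integral Z S \<omega> + simple_stoch_integral Z T \<omega>"
  by (auto simp: simple_stoch_integral_def)

lemma simple_stoch_integral_scale [simp]:
  "simple_stoch_integral Z (scale_simple c S) \<omega> = c * simple_stoch_integral Z S \<omega>"
  by (induction S) (auto simp: scale_simple_def simple_stoch_integral_def algebra_simps)

text \<open>Inner products are determined by norms, so a linear isometry preserves them.\<close>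

lemma L2_polarization:
  assumes f: "square_integrable M f" and g: "square_integrable M g"
  shows "4 * (\<integral>x. f x * cnj (g x) \<partial>M) =
    complex_of_real ((L2_norm M (\<lambda>x. f x + g x))\<^sup>2 - (L2_norm M (\<lambda>x. f x + (-1) * g x))\<^sup>2)
    + \<i> * complex_of_real ((L2_norm M (\<lambda>x. f x + \<i> * g x))\<^sup>2 - (L2_norm M (\<lambda>x. f x + (-\<i>) * g x))\<^sup>2)"
proof -
  have pointwise: "4 * (a * cnj b) =
    complex_of_real ((cmod (a + b))\<^sup>2 - (cmod (a + (-1) * b))\<^sup>2)
    + \<i> * complex_of_real ((cmod (a + \<i> * b))\<^sup>2 - (cmod (a + (-\<i>) * b))\<^sup>2)" for a b :: complex
    unfolding cmod_power2 by (auto simp: complex_eq_iff power2_eq_square algebra_simps)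
  have int: "integrable M (\<lambda>x. (cmod (f x + c * g x))\<^sup>2)" for c
    by (intro square_integrableD square_integrable_add square_integrable_cmult f g)
  have int1: "integrable M (\<lambda>x. (cmod (f x + g x))\<^sup>2)"
    by (intro square_integrableD square_integrable_add f g)
  have "4 * (\<integral>x. f x * cnj (g x) \<partial>M) = (\<integral>x. 4 * (f x * cnj (g x)) \<partial>M)"
    by simp
  also have "\<dots> = (\<integral>x. complex_of_real ((cmod (f x + g x))\<^sup>2 - (cmod (f x + (-1) * g x))\<^sup>2)
    + \<i> * complex_of_real ((cmod (f x + \<i> * g x))\<^sup>2 - (cmod (f x + (-\<i>) * g x))\<^sup>2) \<partial>M)"
    by (simp only: pointwise)
  also have "\<dots> = complex_of_real (\<integral>x. (cmod (f x + g x))\<^sup>2 - (cmod (f x + (-1) * g x))\<^sup>2 \<partial>M)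
    + \<i> * complex_of_real (\<integral>x. (cmod (f x + \<i> * g x))\<^sup>2 - (cmod (f x + (-\<i>) * g x))\<^sup>2 \<partial>M)"
    using int int1
    by (subst Bochner_Integration.integral_add)
      (auto simp only: integral_complex_of_real integral_mult_right_zero
        intro!: integrable_of_real integrable_mult_right Bochner_Integration.integrable_diff)
  also have "\<dots> = complex_of_real ((L2_norm M (\<lambda>x. f x + g x))\<^sup>2 - (L2_norm M (\<lambda>x. f x + (-1) * g x))\<^sup>2)
    + \<i> * complex_of_real ((L2_norm M (\<lambda>x. f x + \<i> * g x))\<^sup>2 - (L2_norm M (\<lambda>x. f x + (-\<i>) * g x))\<^sup>2)"
    unfolding L2_norm_square using int int1 by (simp only: Bochner_Integration.integral_diff)
  finally show ?thesis .
qed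

lemma L2_norm_eq_inner:
  assumes "square_integrable M f"
  shows "complex_of_real ((L2_norm M f)\<^sup>2) = (\<integral>x. f x * cnj (f x) \<partial>M)"
  by (simp add: L2_norm_square complex_mult_cnj cmod_power2 del: of_real_add of_real_power flip: integral_complex_of_real)

locale stochastic_measure =
  fixes M :: "'w measure" and Z :: "real set \<Rightarrow> 'w \<Rightarrow> complex" and f :: "real \<Rightarrow> real"
  assumes density: "spectral_density f" and orthogonal: "orthogonal_measure M Z f"
begin

abbreviation F :: "real measure" where "F \<equiv> spectral_measure f"

sublocale F: finite_measure F
  by (rule finite_spectral_measure[OF density])

lemma Z_square_integrable:
  assumes "A \<in> sets freq"
  shows "square_integrable M (Z A)"
  using orthogonal assms F.emeasure_finite[of A]
  by (intro square_integrableI_nn) (auto simp: orthogonal_measure_def less_top[symmetric])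

lemma Z_norm:
  assumes "A \<in> sets freq"
  shows "(L2_norm M (Z A))\<^sup>2 = measure F A"
proof -
  have "ennreal ((L2_norm M (Z A))\<^sup>2) = emeasure F A"
    using orthogonal assms nn_integral_square[OF Z_square_integrable[OF assms]]
    by (simp add: orthogonal_measure_def)
  then show ?thesis
    by (simp add: F.emeasure_eq_measure)
qed

lemma Z_split:
  assumes "A \<in> sets freq" "B \<in> sets freq"
  shows "AE \<omega> in M. Z A \<omega> = Z (A - B) \<omega> + Z (A \<inter> B) \<omega>"
proof -
  have "AE \<omega> in M. Z ((A - B) \<union> (A \<inter> B)) \<omega> = Z (A - B) \<omega> + Z (A \<inter> B) \<omega>"
  proof -
    have "(A - B) \<inter> (A \<inter> B) = {}" "A - B \<in> sets freq" "A \<inter> B \<in> sets freq"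
      using assms by auto
    then show ?thesis
      using orthogonal unfolding orthogonal_measure_def by blast
  qed
  moreover have "(A - B) \<union> (A \<inter> B) = A" by auto
  ultimately show ?thesis by simp
qed

lemma Z_inner_disjoint:
  "A \<in> sets freq \<Longrightarrow> B \<in> sets freq \<Longrightarrow> A \<inter> B = {} \<Longrightarrow> (\<integral>\<omega>. Z A \<omega> * cnj (Z B \<omega>) \<partial>M) = 0"
  using orthogonal unfolding orthogonal_measure_def by auto

lemma Z_prod_integrable:
  "A \<in> sets freq \<Longrightarrow> B \<in> sets freq \<Longrightarrow> integrable M (\<lambda>\<omega>. Z A \<omega> * cnj (Z B \<omega>))"
  by (intro square_integrable_prod square_integrable_cnj Z_square_integrable)

text \<open>Both values are split along \<open>A \<inter> B\<close>. Of the four products of the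
  pieces, three belong to disjoint sets and vanish by orthogonality.\<close>

lemma Z_inner:
  assumes A: "A \<in> sets freq" and B: "B \<in> sets freq"
  shows "(\<integral>\<omega>. Z A \<omega> * cnj (Z B \<omega>) \<partial>M) = complex_of_real (measure F (A \<inter> B))"
proof -
  have sets: "A - B \<in> sets freq" "B - A \<in> sets freq" "A \<inter> B \<in> sets freq"
    using A B by auto
  note sets' = A B sets
  have [measurable]: "Z A \<in> borel_measurable M" "Z B \<in> borel_measurable M"
    "Z (A - B) \<in> borel_measurable M" "Z (B - A) \<in> borel_measurable M" "Z (A \<inter> B) \<in> borel_measurable M"
    using sets' Z_square_integrable by (auto simp: square_integrable_def)
  have "(\<integral>\<omega>. Z A \<omega> * cnj (Z B \<omega>) \<partial>M) =
      (\<integral>\<omega>. (Z (A - B) \<omega> * cnj (Z (B - A) \<omega>) + Z (A - B) \<omega> * cnj (Z (A \<inter> B) \<omega>))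
        + (Z (A \<inter> B) \<omega> * cnj (Z (B - A) \<omega>) + Z (A \<inter> B) \<omega> * cnj (Z (A \<inter> B) \<omega>)) \<partial>M)"
  proof (rule integral_cong_AE)
    show "AE \<omega> in M. Z A \<omega> * cnj (Z B \<omega>) =
      (Z (A - B) \<omega> * cnj (Z (B - A) \<omega>) + Z (A - B) \<omega> * cnj (Z (A \<inter> B) \<omega>))
        + (Z (A \<inter> B) \<omega> * cnj (Z (B - A) \<omega>) + Z (A \<inter> B) \<omega> * cnj (Z (A \<inter> B) \<omega>))"
      using Z_split[OF A B] Z_split[OF B A]
      by eventually_elim (auto simp: algebra_simps Int_commute)
  qed measurable
  also have "\<dots> = (\<integral>\<omega>. Z (A \<inter> B) \<omega> * cnj (Z (A \<inter> B) \<omega>) \<partial>M)"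
  proof -
    have "(\<integral>\<omega>. Z (A - B) \<omega> * cnj (Z (B - A) \<omega>) \<partial>M) = 0"
      "(\<integral>\<omega>. Z (A - B) \<omega> * cnj (Z (A \<inter> B) \<omega>) \<partial>M) = 0"
      "(\<integral>\<omega>. Z (A \<inter> B) \<omega> * cnj (Z (B - A) \<omega>) \<partial>M) = 0"
      using sets by (intro Z_inner_disjoint; auto)+
    then show ?thesis
      using sets by (simp add: Z_prod_integrable)
  qed
  also have "\<dots> = complex_of_real ((L2_norm M (Z (A \<inter> B)))\<^sup>2)"
    by (rule L2_norm_eq_inner[symmetric]) (rule Z_square_integrable[OF sets(3)])
  finally show ?thesis
    by (simp only: Z_norm[OF sets(3)])
qed

lemma simple_stoch_square_integrable:
  "simple_list S \<Longrightarrow> square_integrable M (simple_stoch_integral Z S)"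
proof (induction S)
  case Nil
  have "simple_stoch_integral Z [] = (\<lambda>_. 0)" by (rule ext) simp
  then show ?case by simp
next
  case (Cons p S)
  obtain c A where p: "p = (c, A)" by fastforce
  have "square_integrable M (\<lambda>\<omega>. c * Z A \<omega> + simple_stoch_integral Z S \<omega>)"
    using Cons p by (intro square_integrable_add square_integrable_cmult Z_square_integrable) auto
  then show ?case
    by (simp add: p)
qed

lemma indicator_square_integrable:
  "A \<in> sets freq \<Longrightarrow> square_integrable F (indicator A)"
  unfolding square_integrable_def
  by (auto simp: indicator_def intro!: F.integrable_const_bound[where B = 1])

lemma simple_fun_square_integrable:
  "simple_list S \<Longrightarrow> square_integrable F (simple_fun S)"
proof (induction S)
  case Nil
  have "simple_fun [] = (\<lambda>_. 0)" by (rule ext) simp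
  then show ?case by simp
next
  case (Cons p S)
  obtain c A where p: "p = (c, A)" by fastforce
  have "square_integrable F (\<lambda>t. c * indicator A t + simple_fun S t)"
    using Cons p by (intro square_integrable_add square_integrable_cmult indicator_square_integrable) auto
  then show ?case
    by (simp add: p)
qed

lemma simple_inner1:
  assumes A: "A \<in> sets freq"
  shows "simple_list T \<Longrightarrow>
    (\<integral>\<omega>. Z A \<omega> * cnj (simple_stoch_integral Z T \<omega>) \<partial>M) = (\<integral>t. indicator A t * cnj (simple_fun T t) \<partial>F)"
proof (induction T)
  case (Cons p T)
  obtain c B where p: "p = (c, B)" by fastforce
  have B: "B \<in> sets freq" and T: "simple_list T"
    using Cons.prems p by auto
  have "(\<integral>\<omega>. Z A \<omega> * cnj (simple_stoch_integral Z (p # T) \<omega>) \<partial>M) =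
      (\<integral>\<omega>. cnj c * (Z A \<omega> * cnj (Z B \<omega>)) + Z A \<omega> * cnj (simple_stoch_integral Z T \<omega>) \<partial>M)"
    by (simp add: p algebra_simps)
  also have "\<dots> = cnj c * complex_of_real (measure F (A \<inter> B)) + (\<integral>t. indicator A t * cnj (simple_fun T t) \<partial>F)"
    using A B T Cons.IH
    by (subst Bochner_Integration.integral_add)
      (auto simp: Z_inner intro!: square_integrable_prod square_integrable_cnj
        Z_square_integrable simple_stoch_square_integrable integrable_mult_right)
  also have "complex_of_real (measure F (A \<inter> B)) = (\<integral>t. indicator A t * cnj (indicator B t) \<partial>F)"
  proof -
    have "(\<integral>t. indicator A t * cnj (indicator B t) \<partial>F) = (\<integral>t. complex_of_real (indicator (A \<inter> B) t) \<partial>F)"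
      by (intro Bochner_Integration.integral_cong) (auto simp: indicator_def)
    also have "\<dots> = complex_of_real (measure F (A \<inter> B))"
      using A B sets.sets_into_space[OF A] by (subst integral_complex_of_real) (auto intro!: arg_cong[where f = "measure F"])
    finally show ?thesis ..
  qed
  also have "cnj c * \<dots> + (\<integral>t. indicator A t * cnj (simple_fun T t) \<partial>F) =
     (\<integral>t. cnj c * (indicator A t * cnj (indicator B t)) + indicator A t * cnj (simple_fun T t) \<partial>F)"
    using A B T
    by (subst Bochner_Integration.integral_add)
      (auto intro!: square_integrable_prod square_integrable_cnj
        indicator_square_integrable simple_fun_square_integrable integrable_mult_right)
  finally show ?case
    by (simp add: p algebra_simps)
qed simp

lemma simple_inner:
  "simple_list S \<Longrightarrow> simple_list T \<Longrightarrow>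
    (\<integral>\<omega>. simple_stoch_integral Z S \<omega> * cnj (simple_stoch_integral Z T \<omega>) \<partial>M) =
    (\<integral>t. simple_fun S t * cnj (simple_fun T t) \<partial>F)"
proof (induction S)
  case (Cons p S)
  obtain c A where p: "p = (c, A)" by fastforce
  have A: "A \<in> sets freq" and S: "simple_list S" and T: "simple_list T"
    using Cons.prems p by auto
  have "(\<integral>\<omega>. simple_stoch_integral Z (p # S) \<omega> * cnj (simple_stoch_integral Z T \<omega>) \<partial>M) =
      (\<integral>\<omega>. c * (Z A \<omega> * cnj (simple_stoch_integral Z T \<omega>)) +
        simple_stoch_integral Z S \<omega> * cnj (simple_stoch_integral Z T \<omega>) \<partial>M)"
    by (simp add: p algebra_simps)
  also have "\<dots> = c * (\<integral>t. indicator A t * cnj (simple_fun T t) \<partial>F) + (\<integral>t. simple_fun S t * cnj (simple_fun T t) \<partial>F)"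
    using A S T Cons.IH
    by (subst Bochner_Integration.integral_add)
      (auto simp: simple_inner1 intro!: square_integrable_prod square_integrable_cnj
        Z_square_integrable simple_stoch_square_integrable integrable_mult_right)
  also have "\<dots> = (\<integral>t. c * (indicator A t * cnj (simple_fun T t)) + simple_fun S t * cnj (simple_fun T t) \<partial>F)"
    using A S T
    by (subst Bochner_Integration.integral_add)
      (auto intro!: square_integrable_prod square_integrable_cnj
        indicator_square_integrable simple_fun_square_integrable integrable_mult_right)
  finally show ?case
    by (simp add: p algebra_simps)
qed simp

lemma simple_isometry:
  assumes "simple_list S"
  shows "L2_norm M (simple_stoch_integral Z S) = L2_norm F (simple_fun S)"
proof -
  have "complex_of_real ((L2_norm M (simple_stoch_integral Z S))\<^sup>2)
      = complex_of_real ((L2_norm F (simple_fun S))\<^sup>2)"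
    using assms simple_inner[OF assms assms] simple_stoch_square_integrable simple_fun_square_integrable
    by (simp only: L2_norm_eq_inner)
  then show ?thesis
    by (simp only: of_real_eq_iff power2_eq_iff_nonneg L2_norm_nonneg)
qed

lemma simple_diff_isometry:
  assumes "simple_list S" "simple_list T"
  shows "L2_norm M (\<lambda>\<omega>. simple_stoch_integral Z S \<omega> - simple_stoch_integral Z T \<omega>)
    = L2_norm F (\<lambda>t. simple_fun S t - simple_fun T t)"
  using simple_isometry[of "S @ scale_simple (-1) T"] assms by (simp add: L2_norm_def)

lemma sequence_imp_approx:
  assumes "has_stoch_integral M Z f g Y"
  shows "square_integrable F g" "square_integrable M Y"
    "e > 0 \<Longrightarrow> \<exists>S. simple_list S \<and> L2_norm F (\<lambda>t. g t - simple_fun S t) < e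
      \<and> L2_norm M (\<lambda>\<omega>. Y \<omega> - simple_stoch_integral Z S \<omega>) < e"
proof -
  from assms obtain S where g: "g \<in> borel_measurable freq" and Y: "Y \<in> borel_measurable M"
    and S: "\<And>k. simple_list (S k)"
    and lim: "(\<lambda>k. \<integral>\<^sup>+t. ennreal ((cmod (g t - simple_fun (S k) t))\<^sup>2) \<partial>F) \<longlonglongrightarrow> 0"
      "(\<lambda>k. \<integral>\<^sup>+\<omega>. ennreal ((cmod (Y \<omega> - simple_stoch_integral Z (S k) \<omega>))\<^sup>2) \<partial>M) \<longlonglongrightarrow> 0"
    unfolding has_stoch_integral_def simple_list_def by blast
  have key: "square_integrable F g \<and> square_integrable M Y \<and>
      (\<exists>S. simple_list S \<and> L2_norm F (\<lambda>t. g t - simple_fun S t) < e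
      \<and> L2_norm M (\<lambda>\<omega>. Y \<omega> - simple_stoch_integral Z S \<omega>) < e)" if "e > 0" for e
  proof -
    have "\<forall>\<^sub>F k in sequentially. (\<integral>\<^sup>+t. ennreal ((cmod (g t - simple_fun (S k) t))\<^sup>2) \<partial>F) < ennreal (e\<^sup>2)
      \<and> (\<integral>\<^sup>+\<omega>. ennreal ((cmod (Y \<omega> - simple_stoch_integral Z (S k) \<omega>))\<^sup>2) \<partial>M) < ennreal (e\<^sup>2)"
      using lim that by (intro eventually_conj order_tendstoD(2)) auto
    then obtain k where k1: "(\<integral>\<^sup>+t. ennreal ((cmod (g t - simple_fun (S k) t))\<^sup>2) \<partial>F) < ennreal (e\<^sup>2)"
      and k2: "(\<integral>\<^sup>+\<omega>. ennreal ((cmod (Y \<omega> - simple_stoch_integral Z (S k) \<omega>))\<^sup>2) \<partial>M) < ennreal (e\<^sup>2)"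
      by (auto simp: eventually_sequentially)
    have 1: "square_integrable F (\<lambda>t. g t - simple_fun (S k) t)"
      using k1 g simple_fun_square_integrable[OF S[of k]]
      by (intro square_integrableI_nn) (auto simp: square_integrable_def intro: less_trans)
    have 2: "square_integrable M (\<lambda>\<omega>. Y \<omega> - simple_stoch_integral Z (S k) \<omega>)"
      using k2 Y simple_stoch_square_integrable[OF S[of k]]
      by (intro square_integrableI_nn) (auto simp: square_integrable_def intro: less_trans)
    have "square_integrable F (\<lambda>t. (g t - simple_fun (S k) t) + simple_fun (S k) t)"
      by (intro square_integrable_add 1 simple_fun_square_integrable S)
    moreover have "square_integrable M (\<lambda>\<omega>. (Y \<omega> - simple_stoch_integral Z (S k) \<omega>) + simple_stoch_integral Z (S k) \<omega>)"
      by (intro square_integrable_add 2 simple_stoch_square_integrable S)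
    moreover have "(L2_norm F (\<lambda>t. g t - simple_fun (S k) t))\<^sup>2 < e\<^sup>2"
      "(L2_norm M (\<lambda>\<omega>. Y \<omega> - simple_stoch_integral Z (S k) \<omega>))\<^sup>2 < e\<^sup>2"
      using k1 k2 by (simp_all add: nn_integral_square[OF 1] nn_integral_square[OF 2] ennreal_less_iff)
    ultimately show ?thesis
      using S that power2_less_imp_less[of _ e] by fastforce
  qed
  from key[of 1] show "square_integrable F g" "square_integrable M Y" by auto
  from key show "\<exists>S. simple_list S \<and> L2_norm F (\<lambda>t. g t - simple_fun S t) < e
      \<and> L2_norm M (\<lambda>\<omega>. Y \<omega> - simple_stoch_integral Z S \<omega>) < e" if "e > 0"
    using that by blast
qed

text \<open>One simple function for each tolerance replaces the approximating sequence of the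
  definition, so that sums, multiples and limits of stochastic integrals are obtained without diagonal
  sequences.\<close>

lemma approx_imp_has_stoch_integral:
  assumes g: "square_integrable F g" and Y: "square_integrable M Y"
    and approx: "\<And>e. e > 0 \<Longrightarrow> \<exists>S. simple_list S \<and> L2_norm F (\<lambda>t. g t - simple_fun S t) < e
      \<and> L2_norm M (\<lambda>\<omega>. Y \<omega> - simple_stoch_integral Z S \<omega>) < e"
  shows "has_stoch_integral M Z f g Y"
proof -
  have "\<exists>S. simple_list S \<and> L2_norm F (\<lambda>t. g t - simple_fun S t) < 1 / real (Suc k)
      \<and> L2_norm M (\<lambda>\<omega>. Y \<omega> - simple_stoch_integral Z S \<omega>) < 1 / real (Suc k)" for k
    by (rule approx) simp
  then obtain S where S: "\<And>k. simple_list (S k)"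
    and 1: "\<And>k. L2_norm F (\<lambda>t. g t - simple_fun (S k) t) < 1 / real (Suc k)"
    and 2: "\<And>k. L2_norm M (\<lambda>\<omega>. Y \<omega> - simple_stoch_integral Z (S k) \<omega>) < 1 / real (Suc k)"
    by metis
  have sq: "square_integrable F (\<lambda>t. g t - simple_fun (S k) t)"
    "square_integrable M (\<lambda>\<omega>. Y \<omega> - simple_stoch_integral Z (S k) \<omega>)" for k
    by (intro square_integrable_diff g Y simple_fun_square_integrable simple_stoch_square_integrable S)+
  have null: "(\<lambda>k. ennreal ((x k)\<^sup>2)) \<longlonglongrightarrow> 0"
    if "\<And>k. x k < 1 / real (Suc k)" "\<And>k. x k \<ge> 0" for x :: "nat \<Rightarrow> real"
  proof -
    have "x \<longlonglongrightarrow> 0"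
    proof (rule Lim_null_comparison)
      show "\<forall>\<^sub>F k in sequentially. norm (x k) \<le> 1 / real (Suc k)"
        using that by (simp add: less_imp_le)
      show "(\<lambda>k. 1 / real (Suc k)) \<longlonglongrightarrow> 0"
        using lim_1_over_n by (rule LIMSEQ_Suc)
    qed
    then have "(\<lambda>k. (x k)\<^sup>2) \<longlonglongrightarrow> 0\<^sup>2"
      by (intro tendsto_intros)
    then have "(\<lambda>k. ennreal ((x k)\<^sup>2)) \<longlonglongrightarrow> ennreal (0\<^sup>2)"
      by (rule tendsto_ennrealI)
    then show ?thesis by simp
  qed
  show ?thesis
    unfolding has_stoch_integral_def
  proof (intro conjI exI[of _ S])
    show "g \<in> borel_measurable freq" "Y \<in> borel_measurable M"
      using g Y by (auto simp: square_integrable_def)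
    show "\<forall>k. \<forall>(c, A)\<in>set (S k). A \<in> sets freq"
      using S by (auto simp: simple_list_def)
    show "(\<lambda>k. \<integral>\<^sup>+t. ennreal ((cmod (g t - simple_fun (S k) t))\<^sup>2) \<partial>F) \<longlonglongrightarrow> 0"
      unfolding nn_integral_square[OF sq(1)] using 1 by (rule null) simp
    show "(\<lambda>k. \<integral>\<^sup>+\<omega>. ennreal ((cmod (Y \<omega> - simple_stoch_integral Z (S k) \<omega>))\<^sup>2) \<partial>M) \<longlonglongrightarrow> 0"
      unfolding nn_integral_square[OF sq(2)] using 2 by (rule null) simp
  qed
qed

lemmas has_stoch_integralD = sequence_imp_approx(1,2)

lemma has_stoch_integral_simple:
  "simple_list S \<Longrightarrow> has_stoch_integral M Z f (simple_fun S) (simple_stoch_integral Z S)"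
  by (intro approx_imp_has_stoch_integral simple_fun_square_integrable simple_stoch_square_integrable)
    (auto simp: L2_norm_def intro!: exI[of _ S])

lemma has_stoch_integral_limit:
  assumes g: "square_integrable F g" and Y: "square_integrable M Y"
    and lim: "\<And>e. e > 0 \<Longrightarrow> \<exists>g' Y'. has_stoch_integral M Z f g' Y' \<and>
      L2_norm F (\<lambda>t. g t - g' t) < e \<and> L2_norm M (\<lambda>\<omega>. Y \<omega> - Y' \<omega>) < e"
  shows "has_stoch_integral M Z f g Y"
proof (rule approx_imp_has_stoch_integral[OF g Y])
  fix e :: real assume "e > 0"
  then obtain g' Y' where has: "has_stoch_integral M Z f g' Y'"
    and 1: "L2_norm F (\<lambda>t. g t - g' t) < e / 2" "L2_norm M (\<lambda>\<omega>. Y \<omega> - Y' \<omega>) < e / 2"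
    using lim[of "e / 2"] by auto
  obtain S where S: "simple_list S" and 2: "L2_norm F (\<lambda>t. g' t - simple_fun S t) < e / 2"
    "L2_norm M (\<lambda>\<omega>. Y' \<omega> - simple_stoch_integral Z S \<omega>) < e / 2"
    using sequence_imp_approx(3)[OF has, of "e / 2"] \<open>e > 0\<close> by auto
  have "L2_norm F (\<lambda>t. g t - simple_fun S t) < e"
    using L2_norm_triangle_diff[OF g has_stoch_integralD(1)[OF has] simple_fun_square_integrable[OF S]] 1 2
    by linarith
  moreover have "L2_norm M (\<lambda>\<omega>. Y \<omega> - simple_stoch_integral Z S \<omega>) < e"
    using L2_norm_triangle_diff[OF Y has_stoch_integralD(2)[OF has] simple_stoch_square_integrable[OF S]] 1 2
    by linarith
  ultimately show "\<exists>S. simple_list S \<and> L2_norm F (\<lambda>t. g t - simple_fun S t) < e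
      \<and> L2_norm M (\<lambda>\<omega>. Y \<omega> - simple_stoch_integral Z S \<omega>) < e"
    using S by blast
qed

lemma has_stoch_integral_add:
  assumes 1: "has_stoch_integral M Z f g Y" and 2: "has_stoch_integral M Z f g' Y'"
  shows "has_stoch_integral M Z f (\<lambda>t. g t + g' t) (\<lambda>\<omega>. Y \<omega> + Y' \<omega>)"
proof (rule approx_imp_has_stoch_integral)
  show "square_integrable F (\<lambda>t. g t + g' t)" "square_integrable M (\<lambda>\<omega>. Y \<omega> + Y' \<omega>)"
    using has_stoch_integralD[OF 1] has_stoch_integralD[OF 2] by auto
  fix e :: real assume "e > 0"
  then obtain S T where S: "simple_list S" "L2_norm F (\<lambda>t. g t - simple_fun S t) < e / 2"
    "L2_norm M (\<lambda>\<omega>. Y \<omega> - simple_stoch_integral Z S \<omega>) < e / 2"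
    and T: "simple_list T" "L2_norm F (\<lambda>t. g' t - simple_fun T t) < e / 2"
    "L2_norm M (\<lambda>\<omega>. Y' \<omega> - simple_stoch_integral Z T \<omega>) < e / 2"
    using sequence_imp_approx(3)[OF 1, of "e / 2"] sequence_imp_approx(3)[OF 2, of "e / 2"] by auto
  have "L2_norm F (\<lambda>t. (g t - simple_fun S t) + (g' t - simple_fun T t)) < e"
    by (rule le_less_trans[OF L2_norm_triangle])
      (use S T has_stoch_integralD[OF 1] has_stoch_integralD[OF 2] simple_fun_square_integrable in auto)
  moreover have "L2_norm M (\<lambda>\<omega>. (Y \<omega> - simple_stoch_integral Z S \<omega>) + (Y' \<omega> - simple_stoch_integral Z T \<omega>)) < e"
    by (rule le_less_trans[OF L2_norm_triangle])
      (use S T has_stoch_integralD[OF 1] has_stoch_integralD[OF 2] simple_stoch_square_integrable in auto)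
  ultimately show "\<exists>S. simple_list S \<and> L2_norm F (\<lambda>t. g t + g' t - simple_fun S t) < e
      \<and> L2_norm M (\<lambda>\<omega>. Y \<omega> + Y' \<omega> - simple_stoch_integral Z S \<omega>) < e"
    using S T by (intro exI[of _ "S @ T"]) (simp add: algebra_simps)
qed

lemma has_stoch_integral_cmult:
  assumes 1: "has_stoch_integral M Z f g Y"
  shows "has_stoch_integral M Z f (\<lambda>t. c * g t) (\<lambda>\<omega>. c * Y \<omega>)"
proof (rule approx_imp_has_stoch_integral)
  show "square_integrable F (\<lambda>t. c * g t)" "square_integrable M (\<lambda>\<omega>. c * Y \<omega>)"
    using has_stoch_integralD[OF 1] by auto
  fix e :: real assume e: "e > 0"
  have pos: "cmod c + 1 > 0" using norm_ge_zero[of c] by linarith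
  have "e / (cmod c + 1) > 0" using e pos by simp
  then obtain S where S: "simple_list S" "L2_norm F (\<lambda>t. g t - simple_fun S t) < e / (cmod c + 1)"
    "L2_norm M (\<lambda>\<omega>. Y \<omega> - simple_stoch_integral Z S \<omega>) < e / (cmod c + 1)"
    using sequence_imp_approx(3)[OF 1] by blast
  have less: "cmod c * x < e" if "x < e / (cmod c + 1)" "x \<ge> 0" for x
  proof -
    have "cmod c * x \<le> (cmod c + 1) * x" using that by (intro mult_right_mono) auto
    also have "\<dots> < e" using that pos by (simp add: field_simps)
    finally show ?thesis .
  qed
  have "L2_norm F (\<lambda>t. c * (g t - simple_fun S t)) < e"
    "L2_norm M (\<lambda>\<omega>. c * (Y \<omega> - simple_stoch_integral Z S \<omega>)) < e"
    unfolding L2_norm_cmult using S by (auto intro: less)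
  then show "\<exists>S. simple_list S \<and> L2_norm F (\<lambda>t. c * g t - simple_fun S t) < e
      \<and> L2_norm M (\<lambda>\<omega>. c * Y \<omega> - simple_stoch_integral Z S \<omega>) < e"
    using S by (intro exI[of _ "scale_simple c S"]) (simp add: algebra_simps)
qed

lemma has_stoch_integral_diff:
  assumes "has_stoch_integral M Z f g Y" "has_stoch_integral M Z f g' Y'"
  shows "has_stoch_integral M Z f (\<lambda>t. g t - g' t) (\<lambda>\<omega>. Y \<omega> - Y' \<omega>)"
  using has_stoch_integral_add[OF assms(1) has_stoch_integral_cmult[OF assms(2), of "-1"]] by simp

lemma has_stoch_integral_sum:
  assumes "\<And>i. i \<in> I \<Longrightarrow> has_stoch_integral M Z f (g i) (Y i)"
  shows "has_stoch_integral M Z f (\<lambda>t. \<Sum>i\<in>I. g i t) (\<lambda>\<omega>. \<Sum>i\<in>I. Y i \<omega>)"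
proof -
  have "simple_fun [] = (\<lambda>_. 0)" "simple_stoch_integral Z [] = (\<lambda>_. 0)"
    by (rule ext, simp)+
  then have zero: "has_stoch_integral M Z f (\<lambda>_. 0) (\<lambda>_. 0)"
    using has_stoch_integral_simple[of "[]"] by simp
  show ?thesis
    using assms
    by (induction I rule: infinite_finite_induct) (auto intro: has_stoch_integral_add zero)
qed

text \<open>Both norms are limits of the norms of the same simple functions, for which the isometry
  is known.\<close>

lemma stoch_integral_isometry:
  assumes "has_stoch_integral M Z f g Y"
  shows "L2_norm M Y = L2_norm F g"
proof (rule ccontr)
  let ?d = "\<bar>L2_norm M Y - L2_norm F g\<bar> / 2"
  assume "L2_norm M Y \<noteq> L2_norm F g"
  then have "?d > 0" by simp
  then obtain S where S: "simple_list S" "L2_norm F (\<lambda>t. g t - simple_fun S t) < ?d"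
    "L2_norm M (\<lambda>\<omega>. Y \<omega> - simple_stoch_integral Z S \<omega>) < ?d"
    using sequence_imp_approx(3)[OF assms] by blast
  have "\<bar>L2_norm F g - L2_norm F (simple_fun S)\<bar> < ?d"
    using L2_norm_diff_abs[OF has_stoch_integralD(1)[OF assms] simple_fun_square_integrable[OF S(1)]] S
    by linarith
  moreover have "\<bar>L2_norm M Y - L2_norm M (simple_stoch_integral Z S)\<bar> < ?d"
    using L2_norm_diff_abs[OF has_stoch_integralD(2)[OF assms] simple_stoch_square_integrable[OF S(1)]] S
    by linarith
  ultimately show False
    using simple_isometry[OF S(1)] by (smt (verit) field_sum_of_halves)
qed

lemma stoch_integral_inner:
  assumes 1: "has_stoch_integral M Z f g Y" and 2: "has_stoch_integral M Z f g' Y'"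
  shows "(\<integral>\<omega>. Y \<omega> * cnj (Y' \<omega>) \<partial>M) = (\<integral>t. g t * cnj (g' t) \<partial>F)"
proof -
  have "L2_norm M (\<lambda>\<omega>. Y \<omega> + c * Y' \<omega>) = L2_norm F (\<lambda>t. g t + c * g' t)" for c
    by (intro stoch_integral_isometry has_stoch_integral_add has_stoch_integral_cmult 1 2)
  moreover have "L2_norm M (\<lambda>\<omega>. Y \<omega> + Y' \<omega>) = L2_norm F (\<lambda>t. g t + g' t)"
    by (intro stoch_integral_isometry has_stoch_integral_add 1 2)
  ultimately have "4 * (\<integral>\<omega>. Y \<omega> * cnj (Y' \<omega>) \<partial>M) = 4 * (\<integral>t. g t * cnj (g' t) \<partial>F)"
    using has_stoch_integralD[OF 1] has_stoch_integralD[OF 2] by (simp only: L2_polarization)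
  then show ?thesis by simp
qed

lemma simple_approx:
  assumes g: "square_integrable F g" and e: "e > 0"
  shows "\<exists>S. simple_list S \<and> L2_norm F (\<lambda>t. g t - simple_fun S t) < e"
proof -
  have gm: "g \<in> borel_measurable F"
    using g by (simp add: square_integrable_def)
  obtain s where s: "\<And>i. simple_function F (s i)"
    and lim: "\<And>t. t \<in> space F \<Longrightarrow> (\<lambda>i. s i t) \<longlonglongrightarrow> g t"
    and bound: "\<And>i t. t \<in> space F \<Longrightarrow> cmod (s i t) \<le> 2 * cmod (g t)"
    using borel_measurable_implies_sequence_metric[OF gm, of 0] unfolding norm_conv_dist by metis
  have [measurable]: "s i \<in> borel_measurable F" "g \<in> borel_measurable F" for i
    using borel_measurable_simple_function[OF s] gm by auto
  have "(\<lambda>i. \<integral>t. (cmod (g t - s i t))\<^sup>2 \<partial>F) \<longlonglongrightarrow> (\<integral>t. 0 \<partial>F)"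
  proof (rule integral_dominated_convergence)
    show "integrable F (\<lambda>t. 9 * (cmod (g t))\<^sup>2)"
      using square_integrableD[OF g] by simp
    show "AE t in F. (\<lambda>i. (cmod (g t - s i t))\<^sup>2) \<longlonglongrightarrow> 0"
    proof (rule AE_I2)
      fix t assume "t \<in> space F"
      then have "(\<lambda>i. (cmod (g t - s i t))\<^sup>2) \<longlonglongrightarrow> (cmod (g t - g t))\<^sup>2"
        by (intro tendsto_intros lim)
      then show "(\<lambda>i. (cmod (g t - s i t))\<^sup>2) \<longlonglongrightarrow> 0" by simp
    qed
    show "AE t in F. norm ((cmod (g t - s i t))\<^sup>2) \<le> 9 * (cmod (g t))\<^sup>2" for i
    proof (rule AE_I2)
      fix t assume t: "t \<in> space F"
      have "cmod (g t - s i t) \<le> 3 * cmod (g t)"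
        using bound[OF t, of i] norm_triangle_ineq4[of "g t" "s i t"] by linarith
      then have "(cmod (g t - s i t))\<^sup>2 \<le> (3 * cmod (g t))\<^sup>2"
        by (intro power_mono) auto
      then show "norm ((cmod (g t - s i t))\<^sup>2) \<le> 9 * (cmod (g t))\<^sup>2"
        by (simp add: power_mult_distrib)
    qed
  qed measurable
  then have "\<forall>\<^sub>F i in sequentially. (\<integral>t. (cmod (g t - s i t))\<^sup>2 \<partial>F) < e\<^sup>2"
    using e by (intro order_tendstoD(2)) auto
  then obtain i where i: "(\<integral>t. (cmod (g t - s i t))\<^sup>2 \<partial>F) < e\<^sup>2"
    by (auto simp: eventually_sequentially)
  obtain cs where cs: "set cs = s i ` space F" "distinct cs"
    using finite_distinct_list[of "s i ` space F"] s[of i] by (auto simp: simple_function_def)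
  define S where "S = map (\<lambda>c. (c, s i -` {c} \<inter> space F)) cs"
  have S: "simple_list S"
    using s[of i] cs by (auto simp: S_def simple_list_def simple_function_def)
  have "simple_fun S t = s i t" if "t \<in> space F" for t
  proof -
    have "simple_fun S t = (\<Sum>c\<leftarrow>cs. c * indicator (s i -` {c} \<inter> space F) t)"
      by (simp add: S_def simple_fun_def comp_def)
    also have "\<dots> = (\<Sum>c\<in>set cs. c * indicator (s i -` {c} \<inter> space F) t)"
      using cs(2) by (simp add: sum_list_distinct_conv_sum_set)
    also have "\<dots> = (\<Sum>c\<in>set cs. if s i t = c then c else 0)"
      using that by (intro sum.cong) (auto simp: indicator_def)
    also have "\<dots> = (if s i t \<in> set cs then s i t else 0)"
      by (rule sum.delta'[OF finite_set])
    also have "\<dots> = s i t"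
      unfolding cs(1) using that by auto
    finally show ?thesis .
  qed
  then have "(\<integral>t. (cmod (g t - simple_fun S t))\<^sup>2 \<partial>F) = (\<integral>t. (cmod (g t - s i t))\<^sup>2 \<partial>F)"
    by (intro Bochner_Integration.integral_cong) auto
  then have "(L2_norm F (\<lambda>t. g t - simple_fun S t))\<^sup>2 < e\<^sup>2"
    using i by (simp add: L2_norm_square)
  then show ?thesis
    using S e power2_less_imp_less by (metis less_imp_le)
qed

text \<open>Simple functions approximating \<open>g\<close> form a Cauchy sequence. By the isometry
  so do their integrals, and these have a limit by completeness.\<close>

lemma stoch_integral_exists:
  assumes g: "square_integrable F g"
  shows "\<exists>Y. has_stoch_integral M Z f g Y"
proof -
  have "\<exists>S. simple_list S \<and> L2_norm F (\<lambda>t. g t - simple_fun S t) < 1 / real (Suc k)" for k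
    by (rule simple_approx[OF g]) simp
  then obtain S where S: "\<And>k. simple_list (S k)"
    and lt: "\<And>k. L2_norm F (\<lambda>t. g t - simple_fun (S k) t) < 1 / real (Suc k)"
    by metis
  have small: "\<exists>N. \<forall>i\<ge>N. L2_norm F (\<lambda>t. g t - simple_fun (S i) t) < e" if "e > 0" for e
  proof -
    obtain N where N: "1 / real (Suc N) < e"
      using nat_approx_posE[OF \<open>e > 0\<close>] by blast
    have "L2_norm F (\<lambda>t. g t - simple_fun (S i) t) < e" if "i \<ge> N" for i
    proof -
      have "1 / real (Suc i) \<le> 1 / real (Suc N)"
        using that by (intro divide_left_mono) auto
      then show ?thesis
        using lt[of i] N by linarith
    qed
    then show ?thesis by blast
  qed
  note sq = simple_fun_square_integrable[OF S] simple_stoch_square_integrable[OF S]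
  obtain Y where Y: "square_integrable M Y"
    and lim: "(\<lambda>k. L2_norm M (\<lambda>\<omega>. simple_stoch_integral Z (S k) \<omega> - Y \<omega>)) \<longlonglongrightarrow> 0"
  proof (rule L2_complete[OF sq(2)])
    fix e :: real assume "e > 0"
    then obtain N where N: "\<And>i. i \<ge> N \<Longrightarrow> L2_norm F (\<lambda>t. g t - simple_fun (S i) t) < e / 2"
      using small[of "e / 2"] by auto
    have "L2_norm M (\<lambda>\<omega>. simple_stoch_integral Z (S i) \<omega> - simple_stoch_integral Z (S j) \<omega>) < e"
      if "i \<ge> N" "j \<ge> N" for i j
      using L2_norm_triangle_diff[OF sq(1)[of i] g sq(1)[of j]] N[OF that(1)] N[OF that(2)]
      by (simp add: simple_diff_isometry S L2_norm_commute[of F _ g])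
    then show "\<exists>N. \<forall>i\<ge>N. \<forall>j\<ge>N.
        L2_norm M (\<lambda>x. simple_stoch_integral Z (S i) x - simple_stoch_integral Z (S j) x) < e"
      by blast
  qed
  have "has_stoch_integral M Z f g Y"
  proof (rule approx_imp_has_stoch_integral[OF g Y])
    fix e :: real assume "e > 0"
    then obtain N where N: "\<And>i. i \<ge> N \<Longrightarrow> L2_norm F (\<lambda>t. g t - simple_fun (S i) t) < e"
      using small by blast
    have "\<forall>\<^sub>F k in sequentially. L2_norm M (\<lambda>\<omega>. simple_stoch_integral Z (S k) \<omega> - Y \<omega>) < e \<and> k \<ge> N"
      using lim \<open>e > 0\<close> by (intro eventually_conj order_tendstoD(2) eventually_ge_at_top) auto
    then obtain k where "L2_norm M (\<lambda>\<omega>. simple_stoch_integral Z (S k) \<omega> - Y \<omega>) < e" "k \<ge> N"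
      by (auto simp: eventually_sequentially)
    then show "\<exists>S. simple_list S \<and> L2_norm F (\<lambda>t. g t - simple_fun S t) < e
      \<and> L2_norm M (\<lambda>\<omega>. Y \<omega> - simple_stoch_integral Z S \<omega>) < e"
      using S N by (intro exI[of _ "S k"]) (simp add: L2_norm_commute[of M Y])
  qed
  then show ?thesis
    by blast
qed

lemma has_stoch_integral_stoch_integral:
  "square_integrable F g \<Longrightarrow> has_stoch_integral M Z f g (stoch_integral M Z f g)"
  unfolding stoch_integral_def using stoch_integral_exists by (rule someI_ex)

end

section \<open>Absolutely convergent power series\<close>

lemma power_ser_abs_summable:
  assumes "summable (\<lambda>k. cmod (x k))" "cmod z \<le> 1"
  shows "summable (\<lambda>k. cmod (x k * z ^ k))"
proof (rule summable_comparison_test'[OF assms(1)])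
  fix k :: nat
  have "cmod z ^ k \<le> 1" using assms(2) by (intro power_le_one) auto
  then show "norm (cmod (x k * z ^ k)) \<le> cmod (x k)"
    by (simp add: norm_mult norm_power mult_left_le)
qed

lemma power_ser_sums:
  assumes "summable (\<lambda>k. cmod (x k))" "cmod z \<le> 1"
  shows "(\<lambda>k. x k * z ^ k) sums power_ser x z"
  unfolding power_ser_def by (intro summable_sums summable_norm_cancel[OF power_ser_abs_summable] assms)

lemma power_ser_tail:
  assumes x: "summable (\<lambda>k. cmod (x k))" and z: "cmod z \<le> 1"
  shows "cmod (power_ser x z - (\<Sum>k<N. x k * z ^ k)) \<le> (\<Sum>k. cmod (x (k + N)))"
proof -
  have "power_ser x z - (\<Sum>k<N. x k * z ^ k) = (\<Sum>k. x (k + N) * z ^ (k + N))"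
    using suminf_split_initial_segment[OF summable_norm_cancel[OF power_ser_abs_summable[OF x z]], of N]
    by (simp add: power_ser_def)
  also have "cmod \<dots> \<le> (\<Sum>k. cmod (x (k + N) * z ^ (k + N)))"
    using power_ser_abs_summable[OF x z] by (intro summable_norm) (subst summable_iff_shift)
  also have "\<dots> \<le> (\<Sum>k. cmod (x (k + N)))"
  proof (intro suminf_le)
    fix k
    have "cmod z ^ (k + N) \<le> 1" using z by (intro power_le_one) auto
    then show "cmod (x (k + N) * z ^ (k + N)) \<le> cmod (x (k + N))"
      by (simp add: norm_mult norm_power mult_left_le)
  qed (use x power_ser_abs_summable[OF x z] in
      \<open>auto simp: summable_iff_shift[of "\<lambda>k. cmod (x k)"] summable_iff_shift[of "\<lambda>k. cmod (x k * z ^ k)"]\<close>)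
  finally show ?thesis .
qed

lemma power_ser_bound:
  assumes "summable (\<lambda>k. cmod (x k))" "cmod z \<le> 1"
  shows "cmod (power_ser x z) \<le> (\<Sum>k. cmod (x k))"
  using power_ser_tail[OF assms, of 0] by simp

lemma summable_tail_tendsto_0:
  fixes x :: "nat \<Rightarrow> real"
  assumes "summable x"
  shows "(\<lambda>N. \<Sum>k. x (k + N)) \<longlonglongrightarrow> 0"
proof -
  have "(\<lambda>N. suminf x - (\<Sum>k<N. x k)) \<longlonglongrightarrow> suminf x - suminf x"
    using assms by (intro tendsto_intros summable_LIMSEQ)
  then show ?thesis
    using assms by (simp add: suminf_minus_initial_segment)
qed

definition conv :: "(nat \<Rightarrow> complex) \<Rightarrow> (nat \<Rightarrow> complex) \<Rightarrow> nat \<Rightarrow> complex" where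
  "conv x y k = (\<Sum>i\<le>k. x i * y (k - i))"

lemma conv_abs_summable:
  assumes x: "summable (\<lambda>k. cmod (x k))" and y: "summable (\<lambda>k. cmod (y k))"
  shows "summable (\<lambda>k. cmod (conv x y k))"
    "(\<Sum>k. cmod (conv x y k)) \<le> (\<Sum>k. cmod (x k)) * (\<Sum>k. cmod (y k))"
proof -
  have sums: "(\<lambda>k. \<Sum>i\<le>k. cmod (x i) * cmod (y (k - i))) sums ((\<Sum>k. cmod (x k)) * (\<Sum>k. cmod (y k)))"
    using x y by (intro Cauchy_product_sums) auto
  have le: "cmod (conv x y k) \<le> (\<Sum>i\<le>k. cmod (x i) * cmod (y (k - i)))" for k
    unfolding conv_def by (rule order_trans[OF norm_sum]) (simp add: norm_mult)
  show sum: "summable (\<lambda>k. cmod (conv x y k))"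
    by (rule summable_comparison_test'[OF sums_summable[OF sums]]) (use le in simp)
  show "(\<Sum>k. cmod (conv x y k)) \<le> (\<Sum>k. cmod (x k)) * (\<Sum>k. cmod (y k))"
    using suminf_le[OF le sum sums_summable[OF sums]] sums_unique[OF sums] by simp
qed

lemma power_ser_conv:
  assumes x: "summable (\<lambda>k. cmod (x k))" and y: "summable (\<lambda>k. cmod (y k))" and z: "cmod z \<le> 1"
  shows "power_ser (conv x y) z = power_ser x z * power_ser y z"
proof -
  have "(\<lambda>k. \<Sum>i\<le>k. x i * z ^ i * (y (k - i) * z ^ (k - i))) sums (power_ser x z * power_ser y z)"
    unfolding power_ser_def
    by (intro Cauchy_product_sums power_ser_abs_summable x y z)
  also have "(\<lambda>k. \<Sum>i\<le>k. x i * z ^ i * (y (k - i) * z ^ (k - i))) = (\<lambda>k. conv x y k * z ^ k)"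
  proof
    fix k
    have "x i * z ^ i * (y (k - i) * z ^ (k - i)) = x i * y (k - i) * z ^ k" if "i \<le> k" for i
      using that by (simp add: algebra_simps flip: power_add)
    then show "(\<Sum>i\<le>k. x i * z ^ i * (y (k - i) * z ^ (k - i))) = conv x y k * z ^ k"
      unfolding conv_def sum_distrib_right by (intro sum.cong) auto
  qed
  finally show ?thesis
    by (simp add: power_ser_def sums_iff)
qed

text \<open>Fubini's theorem for iterated series, obtained from the interchange of sum and integral
  for the counting measure on the natural numbers.\<close>

lemma double_series_swap:
  fixes f :: "nat \<Rightarrow> nat \<Rightarrow> complex"
  assumes 1: "\<And>m. summable (\<lambda>k. cmod (f m k))" and 2: "summable (\<lambda>m. \<Sum>k. cmod (f m k))"
  shows "summable (\<lambda>m. cmod (f m k))" "summable (\<lambda>k. cmod (\<Sum>m. f m k))"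
    "(\<Sum>m. \<Sum>k. f m k) = (\<Sum>k. \<Sum>m. f m k)"
proof -
  let ?C = "count_space (UNIV :: nat set)"
  have int: "integrable ?C (f m)" for m
    using 1 by (simp add: integrable_count_space_nat_iff)
  have int': "integrable ?C (\<lambda>k. cmod (f m k))" for m
    using 1 by (simp add: integrable_count_space_nat_iff)
  have sum: "summable (\<lambda>m. \<integral>k. cmod (f m k) \<partial>?C)"
    using 2 by (simp add: integral_count_space_nat[OF int'])
  have "AE k in ?C. summable (\<lambda>m. cmod (f m k))"
    by (rule AE_summable_of_summable_integral[OF int' _ sum]) simp
  then show 3: "summable (\<lambda>m. cmod (f m k))" for k
    by (simp add: AE_count_space)
  have "integrable ?C (\<lambda>k. \<Sum>m. f m k)"
    by (rule integrable_suminf[OF int _ sum]) (simp add: 3)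
  then show "summable (\<lambda>k. cmod (\<Sum>m. f m k))"
    by (simp add: integrable_count_space_nat_iff)
  have "(\<integral>k. (\<Sum>m. f m k) \<partial>?C) = (\<Sum>m. \<integral>k. f m k \<partial>?C)"
    by (rule integral_suminf[OF int _ sum]) (simp add: 3)
  then show "(\<Sum>m. \<Sum>k. f m k) = (\<Sum>k. \<Sum>m. f m k)"
    using \<open>integrable ?C (\<lambda>k. \<Sum>m. f m k)\<close> by (simp add: integral_count_space_nat int)
qed

text \<open>The analytic Wiener algebra, regarded as a property of the values on the closed disc, so
  that its closure properties apply directly to closed formulas.\<close>

definition wiener :: "(complex \<Rightarrow> complex) \<Rightarrow> bool" where
  "wiener F \<longleftrightarrow> (\<exists>x. summable (\<lambda>k. cmod (x k)) \<and> (\<forall>z. cmod z \<le> 1 \<longrightarrow> F z = power_ser x z))"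

lemma wienerI: "summable (\<lambda>k. cmod (x k)) \<Longrightarrow> (\<And>z. cmod z \<le> 1 \<Longrightarrow> F z = power_ser x z) \<Longrightarrow> wiener F"
  by (auto simp: wiener_def)

lemma wiener_power_ser: "summable (\<lambda>k. cmod (x k)) \<Longrightarrow> wiener (power_ser x)"
  by (rule wienerI) auto

text \<open>A series that converges absolutely in the norm of the algebra is summed coefficientwise.
  The exponential and the Hankel matrix \<open>D A\<close> are treated in this way.\<close>

lemma wiener_suminf:
  assumes 1: "\<And>m. summable (\<lambda>k. cmod (x m k))" and 2: "summable (\<lambda>m. \<Sum>k. cmod (x m k))"
  shows "summable (\<lambda>k. cmod (\<Sum>m. x m k))"
    "cmod z \<le> 1 \<Longrightarrow> power_ser (\<lambda>k. \<Sum>m. x m k) z = (\<Sum>m. power_ser (x m) z)"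
proof -
  show "summable (\<lambda>k. cmod (\<Sum>m. x m k))"
    by (rule double_series_swap(2)[OF 1 2])
  assume z: "cmod z \<le> 1"
  have "(\<Sum>m. \<Sum>k. x m k * z ^ k) = (\<Sum>k. \<Sum>m. x m k * z ^ k)"
  proof (rule double_series_swap(3))
    show 3: "summable (\<lambda>k. cmod (x m k * z ^ k))" for m
      by (rule power_ser_abs_summable[OF 1 z])
    have le: "cmod (x m k * z ^ k) \<le> cmod (x m k)" for m k
      using power_le_one[of "cmod z" k] z by (simp add: norm_mult norm_power mult_left_le)
    show "summable (\<lambda>m. \<Sum>k. cmod (x m k * z ^ k))"
    proof (rule summable_comparison_test'[OF 2])
      fix m
      show "norm (\<Sum>k. cmod (x m k * z ^ k)) \<le> (\<Sum>k. cmod (x m k))"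
        using suminf_le[OF le 3 1] suminf_nonneg[OF 3] by simp
    qed
  qed
  also have "\<dots> = (\<Sum>k. (\<Sum>m. x m k) * z ^ k)"
  proof (rule suminf_cong)
    fix k
    show "(\<Sum>m. x m k * z ^ k) = (\<Sum>m. x m k) * z ^ k"
      by (rule suminf_mult2[symmetric, OF summable_norm_cancel[OF double_series_swap(1)[OF 1 2]]])
  qed
  finally show "power_ser (\<lambda>k. \<Sum>m. x m k) z = (\<Sum>m. power_ser (x m) z)"
    by (simp add: power_ser_def)
qed

lemma power_ser_finite:
  assumes "\<And>k. k \<ge> N \<Longrightarrow> x k = 0"
  shows "summable (\<lambda>k. cmod (x k))" "power_ser x z = (\<Sum>k<N. x k * z ^ k)"
    "(\<Sum>k. cmod (x k)) = (\<Sum>k<N. cmod (x k))"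
proof -
  show "summable (\<lambda>k. cmod (x k))"
    using assms by (intro summable_finite[of "{..<N}"]) (auto simp: not_less)
  show "power_ser x z = (\<Sum>k<N. x k * z ^ k)"
    unfolding power_ser_def using assms by (intro suminf_finite) (auto simp: not_less)
  show "(\<Sum>k. cmod (x k)) = (\<Sum>k<N. cmod (x k))"
    using assms by (intro suminf_finite) (auto simp: not_less)
qed

lemma wiener_const: "wiener (\<lambda>z. c)"
proof (rule wienerI)
  let ?x = "\<lambda>k::nat. if k = 0 then c else 0"
  show "summable (\<lambda>k. cmod (?x k))" by (rule power_ser_finite(1)[of 1]) auto
  show "c = power_ser ?x z" for z using power_ser_finite(2)[of 1 ?x z] by simp
qed

lemma wiener_id: "wiener (\<lambda>z. z)"
proof (rule wienerI)
  let ?x = "\<lambda>k::nat. if k = 1 then 1 else 0 :: complex"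
  show "summable (\<lambda>k. cmod (?x k))" by (rule power_ser_finite(1)[of 2]) auto
  show "z = power_ser ?x z" for z using power_ser_finite(2)[of 2 ?x z] by (simp add: numeral_2_eq_2)
qed

lemma wiener_add:
  assumes "wiener F" "wiener G"
  shows "wiener (\<lambda>z. F z + G z)"
proof -
  obtain x y where x: "summable (\<lambda>k. cmod (x k))" "\<And>z. cmod z \<le> 1 \<Longrightarrow> F z = power_ser x z"
    and y: "summable (\<lambda>k. cmod (y k))" "\<And>z. cmod z \<le> 1 \<Longrightarrow> G z = power_ser y z"
    using assms unfolding wiener_def by blast
  show ?thesis
  proof (rule wienerI)
    show "summable (\<lambda>k. cmod (x k + y k))"
      by (rule summable_comparison_test'[OF summable_add[OF x(1) y(1)]]) (simp add: norm_triangle_ineq)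
    fix z :: complex assume z: "cmod z \<le> 1"
    show "F z + G z = power_ser (\<lambda>k. x k + y k) z"
      using sums_add[OF power_ser_sums[OF x(1) z] power_ser_sums[OF y(1) z]] x(2)[OF z] y(2)[OF z]
      by (simp add: power_ser_def sums_iff distrib_right)
  qed
qed

lemma wiener_mult:
  assumes "wiener F" "wiener G"
  shows "wiener (\<lambda>z. F z * G z)"
proof -
  obtain x y where x: "summable (\<lambda>k. cmod (x k))" "\<And>z. cmod z \<le> 1 \<Longrightarrow> F z = power_ser x z"
    and y: "summable (\<lambda>k. cmod (y k))" "\<And>z. cmod z \<le> 1 \<Longrightarrow> G z = power_ser y z"
    using assms unfolding wiener_def by blast
  show ?thesis
    by (rule wienerI[OF conv_abs_summable(1)[OF x(1) y(1)]]) (simp add: power_ser_conv x y)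
qed

lemma wiener_power: "wiener F \<Longrightarrow> wiener (\<lambda>z. F z ^ m)"
  by (induction m) (auto intro: wiener_const wiener_mult)

lemma wiener_diff:
  assumes "wiener F" "wiener G"
  shows "wiener (\<lambda>z. F z - G z)"
  using wiener_add[OF assms(1) wiener_mult[OF wiener_const[of "-1"] assms(2)]] by simp

text \<open>The norm is submultiplicative, so the exponential series converges absolutely in the
  algebra.\<close>

lemma wiener_exp:
  assumes "wiener F"
  shows "wiener (\<lambda>z. exp (F z))"
proof -
  obtain x where x: "summable (\<lambda>k. cmod (x k))" "\<And>z. cmod z \<le> 1 \<Longrightarrow> F z = power_ser x z"
    using assms unfolding wiener_def by blast
  let ?s = "\<Sum>k. cmod (x k)"
  define p where "p m = ((conv x) ^^ m) (\<lambda>k. if k = 0 then 1 else 0)" for m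
  have p: "summable (\<lambda>k. cmod (p m k)) \<and> (\<Sum>k. cmod (p m k)) \<le> ?s ^ m \<and>
      (\<forall>z. cmod z \<le> 1 \<longrightarrow> power_ser (p m) z = power_ser x z ^ m)" for m
  proof (induction m)
    case 0
    let ?x = "\<lambda>k::nat. if k = 0 then 1 else 0 :: complex"
    note fin = power_ser_finite[of 1 ?x]
    show ?case
      unfolding p_def using fin(1) fin(2) fin(3) by auto
  next
    case (Suc m)
    then have IH: "summable (\<lambda>k. cmod (p m k))" "(\<Sum>k. cmod (p m k)) \<le> ?s ^ m"
      "\<And>z. cmod z \<le> 1 \<Longrightarrow> power_ser (p m) z = power_ser x z ^ m"
      by auto
    have "p (Suc m) = conv x (p m)" by (simp add: p_def)
    moreover have "?s * (\<Sum>k. cmod (p m k)) \<le> ?s * ?s ^ m"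
      using IH(2) suminf_nonneg[OF x(1)] by (intro mult_left_mono) auto
    ultimately show ?case
      using conv_abs_summable[OF x(1) IH(1)] power_ser_conv[OF x(1) IH(1)] IH(3)
      by (auto intro: order_trans)
  qed
  define y where "y m k = p m k / fact m" for m k
  have y1: "summable (\<lambda>k. cmod (y m k))" for m
    using p[of m] by (simp add: y_def norm_divide summable_divide)
  have y1': "(\<Sum>k. cmod (y m k)) \<le> ?s ^ m /\<^sub>R fact m" for m
  proof -
    have "(\<Sum>k. cmod (y m k)) = (\<Sum>k. cmod (p m k)) / fact m"
      using p[of m] by (simp add: y_def norm_divide suminf_divide)
    also have "\<dots> \<le> ?s ^ m / fact m"
      using p[of m] by (intro divide_right_mono) auto
    finally show ?thesis
      by (simp add: divide_inverse mult.commute)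
  qed
  have y2: "summable (\<lambda>m. \<Sum>k. cmod (y m k))"
  proof (rule summable_comparison_test'[OF summable_exp_generic[of ?s]])
    fix m
    have "0 \<le> (\<Sum>k. cmod (y m k))"
      by (rule suminf_nonneg[OF y1]) simp
    then show "norm (\<Sum>k. cmod (y m k)) \<le> ?s ^ m /\<^sub>R fact m"
      using y1'[of m] by simp
  qed
  have "exp (F z) = power_ser (\<lambda>k. \<Sum>m. y m k) z" if z: "cmod z \<le> 1" for z
  proof -
    have "power_ser (y m) z = F z ^ m /\<^sub>R fact m" for m
    proof -
      have "(\<lambda>k. p m k * z ^ k / fact m) sums (power_ser (p m) z / fact m)"
        using p[of m] z by (intro sums_divide power_ser_sums) auto
      then have "power_ser (y m) z = power_ser (p m) z / fact m"
        by (simp add: y_def power_ser_def sums_iff)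
      then have "power_ser (y m) z = F z ^ m / fact m"
        using p[of m] z x(2)[OF z] by simp
      then show ?thesis
        by (simp add: scaleR_conv_of_real divide_inverse mult.commute)
    qed
    then show ?thesis
      using wiener_suminf(2)[OF y1 y2 z] by (simp add: exp_def)
  qed
  then show ?thesis
    by (rule wienerI[OF wiener_suminf(1)[OF y1 y2]])
qed

lemma abs_summable_of_conv_radius:
  fixes x :: "nat \<Rightarrow> complex"
  assumes "conv_radius x > 1"
  shows "summable (\<lambda>k. cmod (x k))"
proof -
  have "ereal (norm (1::complex)) < conv_radius x"
    using assms unfolding norm_one one_ereal_def .
  from abs_summable_in_conv_radius[OF this] show ?thesis
    by (simp only: power_one mult_1_right)
qed

lemma wiener_of_holomorphic:
  assumes "f holomorphic_on ball 0 R" "R > 1"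
  shows "wiener f"
proof -
  define y where "y n = (deriv ^^ n) f 0 / fact n" for n
  have y: "(\<lambda>n. y n * w ^ n) sums f w" if "w \<in> ball 0 R" for w
    using holomorphic_power_series[OF assms(1) that] by (simp add: y_def)
  define r where "r = (1 + R) / 2"
  have r: "1 < r" "r < R"
    using assms(2) by (auto simp: r_def field_simps)
  have "conv_radius y \<ge> norm (of_real r :: complex)"
    using r by (intro conv_radius_geI sums_summable[OF y]) simp
  moreover have "(1::ereal) < ereal (norm (of_real r :: complex))"
    using r unfolding one_ereal_def less_ereal.simps by simp
  ultimately have "conv_radius y > 1"
    by (rule order_less_le_trans[rotated])
  then show ?thesis
  proof (intro wienerI[OF abs_summable_of_conv_radius])
    fix z :: complex assume "cmod z \<le> 1"
    then have "z \<in> ball 0 R" using assms(2) by simp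
    then show "f z = power_ser y z"
      using sums_unique[OF y] by (simp add: power_ser_def)
  qed
qed

text \<open>The absence of zeros extends by compactness from the closed unit disc to a slightly
  larger disc, on which the reciprocal is holomorphic.\<close>

lemma wiener_inverse_of_analytic:
  assumes rad: "conv_radius x > 1" and nz: "\<And>z. cmod z \<le> 1 \<Longrightarrow> power_ser x z \<noteq> 0"
  shows "wiener (\<lambda>z. inverse (power_ser x z))"
proof -
  obtain r where r: "1 < ereal r" "ereal r < conv_radius x"
    using ereal_dense2[OF rad] by auto
  have holo: "power_ser x holomorphic_on ball 0 r"
  proof (rule power_series_holomorphic)
    fix w :: complex assume "w \<in> ball 0 r"
    then have "ereal (cmod w) < conv_radius x"
      using r(2) by (simp add: less_trans[of "ereal (cmod w)" "ereal r"])
    then show "(\<lambda>n. x n * (w - 0) ^ n) sums power_ser x w"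
      unfolding power_ser_def using summable_in_conv_radius[of w x] by (simp add: summable_sums)
  qed
  define U where "U = {z \<in> ball 0 r. power_ser x z \<noteq> 0}"
  have "open U"
  proof -
    have "open (ball 0 r \<inter> power_ser x -` (- {0}))"
      by (intro continuous_open_preimage holomorphic_on_imp_continuous_on[OF holo] open_ball open_Compl) simp
    moreover have "U = ball 0 r \<inter> power_ser x -` (- {0})"
      by (auto simp: U_def)
    ultimately show ?thesis by simp
  qed
  moreover have "cball 0 1 \<subseteq> U"
    using r(1) nz by (auto simp: U_def)
  ultimately obtain e where e: "e > 0" "(\<Union>z\<in>cball 0 1. ball z e) \<subseteq> U"
    using compact_subset_open_imp_ball_epsilon_subset[of "cball 0 1" U] by auto
  have ball: "ball 0 (1 + e) \<subseteq> U"
  proof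
    fix z :: complex assume z: "z \<in> ball 0 (1 + e)"
    show "z \<in> U"
    proof (cases "cmod z \<le> 1")
      case True
      then show ?thesis using e by force
    next
      case False
      then have "z \<noteq> 0" by (metis norm_zero zero_le_one)
      define u where "u = z / cmod z"
      have "dist u z = cmod z - 1"
      proof -
        have "u - z = (1 / cmod z - 1) *\<^sub>R z"
          using \<open>z \<noteq> 0\<close> by (simp add: u_def scaleR_conv_of_real field_simps)
        then have "dist u z = \<bar>1 / cmod z - 1\<bar> * cmod z"
          by (simp add: dist_norm)
        also have "\<dots> = cmod z - 1"
          using False \<open>z \<noteq> 0\<close> by (simp add: abs_if field_simps)
        finally show ?thesis .
      qed
      then have "z \<in> ball u e" "u \<in> cball 0 1"
        using z False by (auto simp: u_def norm_divide)
      then show ?thesis using e by blast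
    qed
  qed
  have "(\<lambda>z. inverse (power_ser x z)) holomorphic_on ball 0 (1 + e)"
  proof (rule holomorphic_on_inverse)
    show "power_ser x holomorphic_on ball 0 (1 + e)"
      using ball by (intro holomorphic_on_subset[OF holo]) (auto simp: U_def)
  qed (use ball in \<open>auto simp: U_def\<close>)
  then show ?thesis
    using e by (intro wiener_of_holomorphic) auto
qed

lemma integral_freq:
  fixes g :: "real \<Rightarrow> 'b::{banach, second_countable_topology}"
  shows "(\<integral>t. g t \<partial>freq) = (\<integral>t. indicator {-pi..pi} t *\<^sub>R g t \<partial>lborel)"
  unfolding freq_def by (rule integral_restrict_space) simp

lemma integrable_freq_bounded:
  fixes g :: "real \<Rightarrow> 'b::{banach, second_countable_topology}"
  assumes "g \<in> borel_measurable freq" "\<And>t. t \<in> {-pi..pi} \<Longrightarrow> norm (g t) \<le> B"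
  shows "integrable freq g"
  using assms by (intro freq.integrable_const_bound[where B = B] AE_I2) auto

lemma integrable_freq_continuous:
  fixes g :: "real \<Rightarrow> 'b::{banach, second_countable_topology}"
  assumes "continuous_on {-pi..pi} g"
  shows "integrable freq g"
proof -
  have m: "g \<in> borel_measurable freq"
    using borel_measurable_continuous_on_restrict[OF assms]
    unfolding measurable_cong_sets[OF sets_freq refl] .
  have "bounded (g ` {-pi..pi})"
    by (intro compact_imp_bounded compact_continuous_image assms compact_Icc)
  then obtain B where "\<forall>x\<in>g ` {-pi..pi}. norm x \<le> B"
    by (auto simp: bounded_iff)
  with m show ?thesis by (intro integrable_freq_bounded[where B = B]) auto
qed

lemma AE_freq_countable: "countable N \<Longrightarrow> AE t in freq. t \<notin> N"
proof -
  assume "countable N"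
  then have "AE t in lborel. t \<notin> N"
    by (intro AE_not_in countable_imp_null_set_lborel)
  then show ?thesis
    unfolding freq_def by (subst AE_restrict_space_iff) (simp, rule eventually_mono, auto)
qed

lemma integral_freq_FTC:
  fixes H :: "real \<Rightarrow> complex"
  assumes "\<And>t. t \<in> {-pi..pi} \<Longrightarrow> (H has_vector_derivative h t) (at t)" "continuous_on {-pi..pi} h"
  shows "(\<integral>t. h t \<partial>freq) = H pi - H (-pi)"
  unfolding integral_freq using assms
  by (intro integral_FTC_atLeastAtMost) (auto intro: has_vector_derivative_at_within)

text \<open>The Fourier coefficient without the factor \<open>1 / (2 \<pi>)\<close>.\<close>

definition fourier :: "(real \<Rightarrow> complex) \<Rightarrow> int \<Rightarrow> complex" where
  "fourier h k = (\<integral>t. h t * cis (- (of_int k * t)) \<partial>freq)"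

lemma holomorphic_real_segment:
  assumes "h holomorphic_on U" "complex_of_real ` {-pi..pi} \<subseteq> U"
  shows "continuous_on {-pi..pi} (\<lambda>t. h (complex_of_real t))"
  by (rule continuous_on_compose2[OF holomorphic_on_imp_continuous_on[OF assms(1)]
        continuous_on_of_real[OF continuous_on_id] assms(2)])

lemma cis_of_int_pi: "cis (- (of_int k * pi)) = cis (of_int k * pi)"
proof -
  have "sin (of_int k * pi) = 0"
    unfolding sin_zero_iff_int2 by blast
  then show ?thesis by (simp add: complex_eq_iff)
qed

lemma fourier_by_parts:
  assumes holo: "h holomorphic_on U" and U: "open U" "complex_of_real ` {-pi..pi} \<subseteq> U" and k: "k \<noteq> 0"
  shows "fourier (\<lambda>t. h (of_real t)) k =
    (fourier (\<lambda>t. deriv h (of_real t)) k - (h (of_real pi) - h (of_real (-pi))) * cis (of_int k * pi)) / (\<i> * of_int k)"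
proof -
  let ?c = "- (\<i> * of_int k) :: complex"
  have c: "?c \<noteq> 0" using k by simp
  have e: "exp (?c * of_real t) = cis (- (of_int k * t))" for t
    by (simp add: cis_conv_exp mult_ac)
  define f where "f z = h z * exp (?c * z) / ?c" for z
  note cont = holomorphic_real_segment[OF holo U(2)]
    holomorphic_real_segment[OF holomorphic_deriv[OF holo U(1)] U(2)]
  let ?f' = "\<lambda>t. deriv h (of_real t) * cis (- (of_int k * t)) / ?c + h (of_real t) * cis (- (of_int k * t))"
  have "((\<lambda>t. f (of_real t)) has_vector_derivative ?f' t) (at t)" if "t \<in> {-pi..pi}" for t
  proof (rule has_vector_derivative_real_field)
    let ?a = "complex_of_real t"
    have h': "(h has_field_derivative deriv h ?a) (at ?a)"
      using U that by (intro holomorphic_derivI[OF holo]) auto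
    have "(f has_field_derivative (deriv h ?a * exp (?c * ?a) + ?c * exp (?c * ?a) * h ?a) / ?c) (at ?a)"
      unfolding f_def
      by (intro DERIV_cdivide DERIV_mult h' DERIV_fun_exp[THEN DERIV_cong])
        (auto intro!: derivative_eq_intros)
    moreover have "(deriv h ?a * exp (?c * ?a) + ?c * exp (?c * ?a) * h ?a) / ?c = ?f' t"
      unfolding e using k by (simp add: field_simps)
    ultimately show "(f has_field_derivative ?f' t) (at ?a)"
      by simp
  qed
  moreover have "continuous_on {-pi..pi} ?f'"
    by (intro continuous_intros cont) (use c in auto)
  ultimately have "(\<integral>t. ?f' t \<partial>freq) = f (of_real pi) - f (of_real (-pi))"
    by (rule integral_freq_FTC)
  moreover have "(\<integral>t. ?f' t \<partial>freq) = fourier (\<lambda>t. deriv h (of_real t)) k / ?c + fourier (\<lambda>t. h (of_real t)) k"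
    unfolding fourier_def
    by (subst Bochner_Integration.integral_add)
      (auto intro!: integrable_freq_continuous continuous_intros cont simp: k)
  moreover have "f (of_real pi) = h (of_real pi) * cis (of_int k * pi) / ?c"
    unfolding f_def e cis_of_int_pi ..
  moreover have "f (of_real (-pi)) = h (of_real (-pi)) * cis (of_int k * pi) / ?c"
    unfolding f_def e by simp
  ultimately have eq: "fourier (\<lambda>t. deriv h (of_real t)) k / ?c + fourier (\<lambda>t. h (of_real t)) k
      = h (of_real pi) * cis (of_int k * pi) / ?c - h (of_real (-pi)) * cis (of_int k * pi) / ?c"
    by (simp only:)
  have solve: "x = (d - (p - m) * e) / y" if "d / (- y) + x = p * e / (- y) - m * e / (- y)" "y \<noteq> 0"
    for x d p m e y :: complex
    using that by (simp add: field_simps)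
  show ?thesis
    by (rule solve[OF eq]) (use k in simp)
qed

lemma fourier_bound:
  assumes "continuous_on {-pi..pi} h"
  shows "\<exists>B. \<forall>k. cmod (fourier h k) \<le> B"
proof (intro exI allI)
  show "cmod (fourier h k) \<le> (\<integral>t. cmod (h t) \<partial>freq)" for k
    unfolding fourier_def
    by (rule order_trans[OF integral_norm_bound]) (simp add: norm_mult)
qed

lemma fourier_decay:
  assumes holo: "h holomorphic_on U" and U: "open U" "complex_of_real ` {-pi..pi} \<subseteq> U"
  shows "\<exists>B. \<forall>k. k \<noteq> 0 \<longrightarrow> cmod (fourier (\<lambda>t. h (of_real t)) k) \<le> B / \<bar>of_int k\<bar>"
proof -
  obtain B where B: "\<And>k. cmod (fourier (\<lambda>t. deriv h (of_real t)) k) \<le> B"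
    using fourier_bound[OF holomorphic_real_segment[OF holomorphic_deriv[OF holo U(1)] U(2)]] by auto
  let ?D = "cmod (h (of_real pi) - h (of_real (-pi)))"
  have "cmod (fourier (\<lambda>t. h (of_real t)) k) \<le> (B + ?D) / \<bar>of_int k\<bar>" if "k \<noteq> 0" for k
  proof -
    have "cmod (fourier (\<lambda>t. deriv h (of_real t)) k - (h (of_real pi) - h (of_real (-pi))) * cis (of_int k * pi))
        \<le> B + ?D"
      by (rule order_trans[OF norm_triangle_ineq4]) (use B[of k] in \<open>simp add: norm_mult\<close>)
    then show ?thesis
      unfolding fourier_by_parts[OF holo U that] norm_divide norm_mult norm_ii norm_of_int mult_1_left
      by (intro divide_right_mono) auto
  qed
  then show ?thesis by blast
qed

text \<open>For equal boundary values the boundary term of the integration by parts vanishes, so a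
  second integration gains another factor \<open>1 / k\<close>. This makes the coefficients
  summable.\<close>

lemma fourier_decay_periodic:
  assumes holo: "h holomorphic_on U" and U: "open U" "complex_of_real ` {-pi..pi} \<subseteq> U"
    and per: "h (of_real pi) = h (of_real (-pi))"
  shows "\<exists>B. \<forall>k. k \<noteq> 0 \<longrightarrow> cmod (fourier (\<lambda>t. h (of_real t)) k) \<le> B / (of_int k)\<^sup>2"
proof -
  obtain B where B: "\<And>k. k \<noteq> 0 \<Longrightarrow> cmod (fourier (\<lambda>t. deriv h (of_real t)) k) \<le> B / \<bar>of_int k\<bar>"
    using fourier_decay[OF holomorphic_deriv[OF holo U(1)] U] by auto
  have "cmod (fourier (\<lambda>t. h (of_real t)) k) \<le> B / (of_int k)\<^sup>2" if k: "k \<noteq> 0" for k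
  proof -
    have "cmod (fourier (\<lambda>t. h (of_real t)) k) = cmod (fourier (\<lambda>t. deriv h (of_real t)) k) / \<bar>of_int k\<bar>"
      unfolding fourier_by_parts[OF holo U k] per norm_divide norm_mult norm_ii norm_of_int mult_1_left
      by simp
    also have "\<dots> \<le> (B / \<bar>of_int k\<bar>) / \<bar>of_int k\<bar>"
      using B[OF k] by (intro divide_right_mono) auto
    also have "\<dots> = B / (of_int k)\<^sup>2"
      by (simp only: divide_divide_eq_left abs_mult_self_eq power2_eq_square)
    finally show ?thesis .
  qed
  then show ?thesis by blast
qed

lemma integral_cis:
  "(\<integral>t. cis (of_int k * t) \<partial>freq) = (if k = 0 then complex_of_real (2 * pi) else 0)"
proof (cases "k = 0")
  case True
  then show ?thesis
    by (simp add: measure_def emeasure_freq scaleR_conv_of_real)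
next
  case False
  have "fourier (\<lambda>t. (\<lambda>z. 1) (complex_of_real t)) (- k) = 0"
    by (subst fourier_by_parts[where U = UNIV]) (use False in \<open>auto simp: fourier_def\<close>)
  then show ?thesis
    using False by (simp add: fourier_def)
qed

lemma fourier_const:
  fixes c :: complex
  shows "fourier (\<lambda>t. c) k = (if k = 0 then 2 * pi * c else 0)"
  using integral_cis[of "-k"] unfolding fourier_def by simp

lemma symmetric_int_sum:
  fixes f :: "int \<Rightarrow> complex"
  shows "(\<Sum>k=-int (Suc N)..int (Suc N). f k) = (\<Sum>k=-int N..int N. f k) + f (int (Suc N)) + f (- int (Suc N))"
proof -
  have "{-int (Suc N)..int (Suc N)} = insert (int (Suc N)) (insert (- int (Suc N)) {-int N..int N})"
    by auto
  then show ?thesis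
    by (simp add: algebra_simps)
qed

lemma one_minus_cis_nonzero:
  assumes "t \<noteq> 0" "\<bar>t\<bar> < 2 * pi"
  shows "cis t \<noteq> 1"
proof
  assume "cis t = 1"
  then have "cos t = 1" by (simp add: complex_eq_iff)
  then obtain n :: int where n: "t = of_int n * 2 * pi"
    by (auto simp: cos_one_2pi_int)
  then have "\<bar>of_int n :: real\<bar> < 1"
    using assms(2) by (simp add: abs_mult)
  then have "n = 0"
    by linarith
  then show False
    using n assms(1) by simp
qed

text \<open>Chernoff's argument: \<open>h t = h t0 + q t (1 - cis (t - t0))\<close> with
  \<open>q\<close> again analytic near the segment, because the simple zero of \<open>1 - cis (t -
  t0)\<close> is cancelled. Multiplication by \<open>1 - cis (t - t0)\<close> turns the symmetric
  partial sums of the Fourier series into telescoping sums, whose two end terms are Fourier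
  coefficients of \<open>q\<close> and tend to zero. The values of \<open>h\<close> at the two ends
  may differ, which is why \<open>t0\<close> is an interior point.\<close>

lemma fourier_inversion:
  fixes h :: "complex \<Rightarrow> complex"
  assumes holo: "h holomorphic_on U" and U: "open U" "complex_of_real ` {-pi..pi} \<subseteq> U"
    and t0: "-pi < t0" "t0 < pi"
  shows "(\<lambda>N. \<Sum>k=-int N..int N. fourier (\<lambda>t. h (of_real t)) k * cis (of_int k * t0))
    \<longlonglongrightarrow> 2 * pi * h (of_real t0)"
proof -
  let ?a = "complex_of_real t0"
  define E where "E z = (if z = ?a then deriv (\<lambda>z. - exp (\<i> * (z - ?a))) ?a
      else (- exp (\<i> * (z - ?a)) - - exp (\<i> * (?a - ?a))) / (z - ?a))" for z
  define D where "D z = (if z = ?a then deriv h ?a else (h z - h ?a) / (z - ?a))" for z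
  have E_holo: "E holomorphic_on UNIV"
    unfolding E_def by (intro pole_lemma_open holomorphic_intros) auto
  have D_holo: "D holomorphic_on U"
    unfolding D_def by (intro pole_lemma_open holo U)
  have "((\<lambda>z. - exp (\<i> * (z - ?a))) has_field_derivative - \<i>) (at ?a)"
    by (auto intro!: derivative_eq_intros)
  then have E0: "E ?a = - \<i>"
    by (simp add: E_def DERIV_imp_deriv)
  have E_eq: "E (of_real t) * (of_real t - ?a) = 1 - cis (t - t0)" for t
    by (cases "t = t0") (auto simp: E_def cis_conv_exp)
  have D_eq: "D (of_real t) * (of_real t - ?a) = h (of_real t) - h ?a" for t
    by (cases "t = t0") (auto simp: D_def)
  have E_nz: "E (of_real t) \<noteq> 0" if "t \<in> {-pi..pi}" for t
  proof (cases "t = t0")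
    case True
    then show ?thesis using E0 by simp
  next
    case False
    then have "cis (t - t0) \<noteq> 1"
      using that t0 by (intro one_minus_cis_nonzero) auto
    then show ?thesis using E_eq[of t] by auto
  qed
  define V where "V = U \<inter> E -` (- {0})"
  have V: "open V" "complex_of_real ` {-pi..pi} \<subseteq> V"
  proof -
    have "open (E -` (- {0}) \<inter> UNIV)"
      using continuous_open_preimage[OF holomorphic_on_imp_continuous_on[OF E_holo] open_UNIV, of "- {0}"]
      by (simp add: open_Compl Int_commute)
    then show "open V" using U(1) by (auto simp: V_def)
    show "complex_of_real ` {-pi..pi} \<subseteq> V"
      using U(2) E_nz by (auto simp: V_def)
  qed
  define q where "q z = D z / E z" for z
  have q_holo: "q holomorphic_on V"
    unfolding q_def
    by (intro holomorphic_on_divide holomorphic_on_subset[OF D_holo] holomorphic_on_subset[OF E_holo])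
      (auto simp: V_def)
  have q_eq: "h (of_real t) = h ?a + q (of_real t) * (1 - cis (t - t0))" if "t \<in> {-pi..pi}" for t
    unfolding q_def E_eq[symmetric] using E_nz[OF that] D_eq[of t] by simp
  note cont = holomorphic_real_segment[OF holo U(2)] holomorphic_real_segment[OF q_holo V(2)]
  let ?Q = "fourier (\<lambda>t. q (of_real t))" and ?H = "fourier (\<lambda>t. h (of_real t))"
  have rec: "?H k = fourier (\<lambda>t. h ?a) k + ?Q k - cis (- t0) * ?Q (k - 1)" for k
  proof -
    have "?H k = (\<integral>t. h ?a * cis (- (of_int k * t)) + q (of_real t) * cis (- (of_int k * t))
        - cis (- t0) * (q (of_real t) * cis (- (of_int (k - 1) * t))) \<partial>freq)"
      unfolding fourier_def
    proof (intro Bochner_Integration.integral_cong refl)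
      fix t assume "t \<in> space freq"
      then have t: "t \<in> {-pi..pi}" by simp
      have "cis (t - t0) * cis (- (of_int k * t)) = cis (- t0) * cis (- (of_int (k - 1) * t))"
        by (simp add: cis_mult algebra_simps)
      then show "h (of_real t) * cis (- (of_int k * t)) = h ?a * cis (- (of_int k * t)) + q (of_real t) * cis (- (of_int k * t))
        - cis (- t0) * (q (of_real t) * cis (- (of_int (k - 1) * t)))"
        unfolding q_eq[OF t] by (simp add: algebra_simps)
    qed
    also have "\<dots> = fourier (\<lambda>t. h ?a) k + ?Q k - cis (- t0) * ?Q (k - 1)"
      unfolding fourier_def
      by (subst Bochner_Integration.integral_diff Bochner_Integration.integral_add,
          (intro integrable_freq_continuous continuous_intros cont)+)+ simp
    finally show ?thesis .
  qed
  \<comment> \<open>The terms of the telescoping sum.\<close>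
  define T where "T k = cis (of_int k * t0) * ?Q k" for k
  have step: "?H k * cis (of_int k * t0) = (if k = 0 then 2 * pi * h ?a else 0) + (T k - T (k - 1))" for k
  proof -
    have "?H k * cis (of_int k * t0) = fourier (\<lambda>t. h ?a) k * cis (of_int k * t0)
      + (cis (of_int k * t0) * ?Q k - (cis (- t0) * cis (of_int k * t0)) * ?Q (k - 1))"
      unfolding rec by (simp add: algebra_simps)
    also have "cis (- t0) * cis (of_int k * t0) = cis (of_int (k - 1) * t0)"
      by (simp add: cis_mult algebra_simps)
    also have "fourier (\<lambda>t. h ?a) k * cis (of_int k * t0) = (if k = 0 then 2 * pi * h ?a else 0)"
      using fourier_const[of "h ?a" k] by simp
    finally show ?thesis
      by (simp only: T_def)
  qed
  have partial: "(\<Sum>k=-int N..int N. ?H k * cis (of_int k * t0)) = 2 * pi * h ?a + (T (int N) - T (- int N - 1))" for N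
  proof (induction N)
    case 0
    show ?case using step[of 0] by simp
  next
    case (Suc N)
    have "- int (Suc N) = - int N - 1" "int (Suc N) - 1 = int N" by auto
    then show ?case
      unfolding symmetric_int_sum Suc.IH step[of "int (Suc N)"] step[of "- int (Suc N)"]
      by (simp add: algebra_simps) (rule arg_cong[of _ _ T], simp)
  qed
  obtain B where B: "\<And>k. k \<noteq> 0 \<Longrightarrow> cmod (?Q k) \<le> B / \<bar>of_int k\<bar>"
    using fourier_decay[OF q_holo V] by auto
  have lim: "(\<lambda>N. B / real N) \<longlonglongrightarrow> 0" "(\<lambda>N. B / real (Suc N)) \<longlonglongrightarrow> 0"
    using lim_const_over_n[of B] LIMSEQ_Suc[OF lim_const_over_n[of B]] by auto
  have "(\<lambda>N. T (int N)) \<longlonglongrightarrow> 0"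
  proof (rule Lim_null_comparison[OF _ lim(1)])
    show "\<forall>\<^sub>F N in sequentially. norm (T (int N)) \<le> B / real N"
      using eventually_gt_at_top[of 0]
    proof eventually_elim
      case (elim N)
      then show ?case
        using B[of "int N"] by (simp add: T_def norm_mult)
    qed
  qed
  moreover have "(\<lambda>N. T (- int N - 1)) \<longlonglongrightarrow> 0"
  proof (rule Lim_null_comparison[OF _ lim(2)])
    show "\<forall>\<^sub>F N in sequentially. norm (T (- int N - 1)) \<le> B / real (Suc N)"
    proof (rule always_eventually, rule allI)
      fix N
      have "\<bar>of_int (- int N - 1)\<bar> = real (Suc N)" by simp
      then show "norm (T (- int N - 1)) \<le> B / real (Suc N)"
        using B[of "- int N - 1"] by (simp add: T_def norm_mult)
    qed
  qed
  ultimately have "(\<lambda>N. 2 * pi * h ?a + (T (int N) - T (- int N - 1))) \<longlonglongrightarrow> 2 * pi * h ?a + (0 - 0)"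
    by (intro tendsto_intros)
  then show ?thesis
    unfolding partial by simp
qed

text \<open>On the real axis this entire function is the quotient of \<open>1 - cis t\<close> by
  \<open>t\<close> up to a unimodular factor. It carries the part of the increment kernel that has no
  zeros on \<open>[-\<pi>, \<pi>]\<close>.\<close>

definition sinc_half :: "complex \<Rightarrow> complex" where
  "sinc_half z = (if z = 0 then 1 else 2 * sin (z / 2) / z)"

lemma sinc_half_holomorphic: "sinc_half holomorphic_on UNIV"
proof -
  have "((\<lambda>z::complex. 2 * sin (z / 2)) has_field_derivative 1) (at 0)"
    by (auto intro!: derivative_eq_intros)
  then have "deriv (\<lambda>z::complex. 2 * sin (z / 2)) 0 = 1"
    by (rule DERIV_imp_deriv)
  then have eq: "sinc_half = (\<lambda>z. if z = 0 then deriv (\<lambda>z. 2 * sin (z / 2)) 0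
      else (2 * sin (z / 2) - 2 * sin (0 / 2)) / (z - 0))"
    by (auto simp: sinc_half_def fun_eq_iff)
  show ?thesis
    unfolding eq by (intro pole_lemma_open holomorphic_intros) auto
qed

definition sinc_real :: "real \<Rightarrow> real" where
  "sinc_real t = (if t = 0 then 1 else 2 * sin (t / 2) / t)"

lemma sinc_half_of_real: "sinc_half (of_real t) = of_real (sinc_real t)"
  unfolding sinc_half_def sinc_real_def using sin_of_real[of "t / 2", where ?'a = complex] by simp

lemma sinc_real_minus: "sinc_real (- t) = sinc_real t"
  by (simp add: sinc_real_def)

lemma sinc_real_pos:
  assumes "\<bar>t\<bar> < 2 * pi"
  shows "sinc_real t > 0"
proof -
  have pos: "sinc_real u > 0" if "0 < u" "u < 2 * pi" for u
    using that by (simp add: sinc_real_def sin_gt_zero)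
  consider "t > 0" | "t = 0" | "- t > 0" by linarith
  then show ?thesis
  proof cases
    case 3
    then show ?thesis using pos[of "- t"] assms by (simp add: sinc_real_minus)
  qed (use pos[of t] assms in \<open>auto simp: sinc_real_def\<close>)
qed

lemma norm_one_minus_cis: "cmod (1 - cis t) = \<bar>t\<bar> * \<bar>sinc_real t\<bar>"
proof -
  have "(cmod (1 - cis t))\<^sup>2 = (1 - cos t)\<^sup>2 + (sin t)\<^sup>2"
    by (simp add: cmod_power2)
  also have "\<dots> = 2 - 2 * cos t"
    using sin_cos_squared_add[of t] by (simp add: power2_diff)
  also have "\<dots> = (2 * sin (t / 2))\<^sup>2"
    using cos_double_sin[of "t / 2"] by (simp add: power_mult_distrib)
  finally have "cmod (1 - cis t) = \<bar>2 * sin (t / 2)\<bar>"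
    by (metis norm_ge_zero real_sqrt_abs real_sqrt_unique)
  also have "\<dots> = \<bar>t\<bar> * \<bar>sinc_real t\<bar>"
    by (auto simp: sinc_real_def abs_mult[symmetric])
  finally show ?thesis .
qed

text \<open>The logarithm of the sinc function is analytic near \<open>[-\<pi>, \<pi>]\<close> and
  even, hence equal at both ends; its Fourier coefficients are therefore summable and recover it. It
  is real, so the series is twice the real part of a power series, with half of the mean value as
  constant term.\<close>

lemma sinc_log_series:
  obtains x where "summable (\<lambda>k. cmod (x k))" "Im (x 0) = 0"
    "\<And>t. -pi < t \<Longrightarrow> t < pi \<Longrightarrow> 2 * Re (power_ser x (cis t)) = 2 * ln (sinc_real t)"
proof -
  define U where "U = sinc_half -` (- \<real>\<^sub>\<le>\<^sub>0)"
  have U1: "open U"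
    unfolding U_def using continuous_open_preimage[OF holomorphic_on_imp_continuous_on[OF sinc_half_holomorphic] open_UNIV, of "- \<real>\<^sub>\<le>\<^sub>0"]
    by (simp add: open_Compl closed_nonpos_Reals_complex)
  have pos: "sinc_real t > 0" if "t \<in> {-pi..pi}" for t
    using that pi_gt_zero by (intro sinc_real_pos) (simp only: abs_less_iff atLeastAtMost_iff, linarith)
  have U2: "complex_of_real ` {-pi..pi} \<subseteq> U"
    using pos by (auto simp: U_def sinc_half_of_real complex_nonpos_Reals_iff not_le)
  define G where "G z = 2 * Ln (sinc_half z)" for z
  have holo: "G holomorphic_on U"
    unfolding G_def
    by (intro holomorphic_intros holomorphic_on_subset[OF sinc_half_holomorphic]) (auto simp: U_def)
  have G_real: "G (of_real t) = of_real (2 * ln (sinc_real t))" if "t \<in> {-pi..pi}" for t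
    using pos[OF that] by (simp add: G_def sinc_half_of_real Ln_of_real)
  have per: "G (of_real pi) = G (of_real (-pi))"
    by (subst (1 2) G_real) (auto simp: sinc_real_minus)
  let ?c = "fourier (\<lambda>t. G (of_real t))"
  have cnj: "?c (- k) = cnj (?c k)" for k
  proof -
    have "cnj (?c k) = (\<integral>t. cnj (G (of_real t) * cis (- (of_int k * t))) \<partial>freq)"
      unfolding fourier_def by (rule Bochner_Integration.integral_cnj[symmetric])
    also have "\<dots> = ?c (- k)"
      unfolding fourier_def by (intro Bochner_Integration.integral_cong) (auto simp: G_real cis_cnj)
    finally show ?thesis ..
  qed
  obtain B where B: "\<And>k. k \<noteq> 0 \<Longrightarrow> cmod (?c k) \<le> B / (of_int k)\<^sup>2"
    using fourier_decay_periodic[OF holo U1 U2 per] by auto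
  \<comment> \<open>Twice the real part doubles every coefficient; for the index zero the mean
    value is halved in compensation, for the others the conjugate half supplies the negative
    index.\<close>
  define x where "x k = (if k = 0 then ?c 0 / (4 * pi) else ?c (int k) / (2 * pi))" for k
  have sum: "summable (\<lambda>k. cmod (x k))"
  proof (rule summable_comparison_test_ev)
    show "summable (\<lambda>k. B / (2 * pi) * inverse (real k ^ 2))"
      by (intro summable_mult inverse_power_summable) auto
    show "\<forall>\<^sub>F k in sequentially. norm (cmod (x k)) \<le> B / (2 * pi) * inverse (real k ^ 2)"
      using eventually_gt_at_top[of 0]
    proof eventually_elim
      case (elim k)
      then have "cmod (?c (int k)) / (2 * pi) \<le> (B / (real k)\<^sup>2) / (2 * pi)"
        using B[of "int k"] by (intro divide_right_mono) auto
      then show ?case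
        using elim by (simp add: x_def norm_divide norm_mult field_simps)
    qed
  qed
  have Im0: "Im (?c 0) = 0"
    using cnj[of 0] by (simp add: complex_eq_iff)
  show ?thesis
  proof (rule that[OF sum])
    show "Im (x 0) = 0" using Im0 by (simp add: x_def)
    fix t assume t: "-pi < t" "t < pi"
    have partial: "(\<Sum>k=-int N..int N. ?c k * cis (of_int k * t))
        = of_real (2 * pi * (2 * Re (\<Sum>k<Suc N. x k * cis t ^ k)))" for N
    proof (induction N)
      case 0
      show ?case using Im0 by (simp add: x_def complex_eq_iff)
    next
      case (Suc N)
      have "?c (int (Suc N)) * cis (of_int (int (Suc N)) * t) + ?c (- int (Suc N)) * cis (of_int (- int (Suc N)) * t)
        = of_real (2 * Re (?c (int (Suc N)) * cis (of_int (int (Suc N)) * t)))"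
        unfolding cnj using complex_add_cnj[of "?c (int (Suc N)) * cis (of_int (int (Suc N)) * t)"]
        by (simp only: complex_cnj_mult cis_cnj of_int_minus mult_minus_left)
      also have "\<dots> = of_real (2 * pi * (2 * Re (x (Suc N) * cis t ^ Suc N)))"
      proof -
        have "cis (of_int (int (Suc N)) * t) = cis t ^ Suc N"
          by (simp only: Complex.DeMoivre of_int_of_nat_eq)
        moreover have "?c (int (Suc N)) = complex_of_real (2 * pi) * x (Suc N)"
          by (simp add: x_def)
        moreover have "Re (complex_of_real r * y * w) = r * Re (y * w)" for r y w
          by (simp add: algebra_simps)
        ultimately show ?thesis
          by (simp only:) simp
      qed
      finally show ?case
        unfolding symmetric_int_sum Suc.IH
        by (simp only: sum.lessThan_Suc[of _ "Suc N"] add.assoc plus_complex.sel distrib_left of_real_add)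
    qed
    have "(\<lambda>N. \<Sum>k<N. x k * cis t ^ k) \<longlonglongrightarrow> power_ser x (cis t)"
      using power_ser_sums[OF sum, of "cis t"] by (simp add: sums_def)
    then have "(\<lambda>N. complex_of_real (2 * pi * (2 * Re (\<Sum>k<Suc N. x k * cis t ^ k))))
        \<longlonglongrightarrow> of_real (2 * pi * (2 * Re (power_ser x (cis t))))"
      by (intro tendsto_intros) (rule LIMSEQ_Suc)
    then have "complex_of_real (2 * pi * (2 * Re (power_ser x (cis t)))) = 2 * pi * G (of_real t)"
      using fourier_inversion[OF holo U1 U2 t] unfolding partial by (rule LIMSEQ_unique)
    also have "\<dots> = of_real (2 * pi * (2 * ln (sinc_real t)))"
      using t by (simp add: G_real)
    finally have "2 * pi * (2 * Re (power_ser x (cis t))) = 2 * pi * (2 * ln (sinc_real t))"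
      by (simp only: of_real_eq_iff)
    then show "2 * Re (power_ser x (cis t)) = 2 * ln (sinc_real t)"
      by simp
  qed
qed

section \<open>Parseval identity and Schwarz formula\<close>

lemma cis_measurable [measurable]: "cis \<in> borel_measurable borel"
  by (intro borel_measurable_continuous_onI continuous_on_cis continuous_on_id)

lemma id_freq_measurable [measurable]: "(\<lambda>t. t) \<in> borel_measurable freq"
  by (intro borel_measurable_freq) simp

lemma cis_freq_measurable [measurable]:
  "(\<lambda>t. cis (c * t)) \<in> borel_measurable freq" "(\<lambda>t. cis (t * c)) \<in> borel_measurable freq"
  "(\<lambda>t. cis t) \<in> borel_measurable freq" "(\<lambda>t. cis (- t)) \<in> borel_measurable freq"
  by (intro borel_measurable_freq, measurable)+

lemma power_ser_measurable [measurable]: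
  assumes [measurable]: "u \<in> borel_measurable M"
  shows "(\<lambda>t. power_ser x (u t)) \<in> borel_measurable M"
  unfolding power_ser_def by measurable

text \<open>Termwise integration, dominated by the sum of the moduli of the coefficients.\<close>

lemma integral_power_ser:
  assumes x: "summable (\<lambda>k. cmod (x k))" and u[measurable]: "u \<in> borel_measurable M"
    and u1: "\<And>t. cmod (u t) \<le> 1" and g: "integrable M g"
  shows "integrable M (\<lambda>t. power_ser x (u t) * g t)"
    "(\<integral>t. power_ser x (u t) * g t \<partial>M) = (\<Sum>k. x k * (\<integral>t. u t ^ k * g t \<partial>M))"
proof -
  have [measurable]: "g \<in> borel_measurable M" using g by auto
  have le1: "cmod (u t) ^ k \<le> 1" for t k
    using u1[of t] by (intro power_le_one) auto
  have int: "integrable M (\<lambda>t. x k * u t ^ k * g t)" for k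
  proof (rule Bochner_Integration.integrable_bound)
    show "integrable M (\<lambda>t. cmod (x k) * cmod (g t))"
      using g by auto
    show "AE t in M. norm (x k * u t ^ k * g t) \<le> norm (cmod (x k) * cmod (g t))"
      using le1 by (auto simp: norm_mult norm_power intro!: AE_I2 mult_right_mono mult_left_le)
  qed measurable
  have sum: "summable (\<lambda>k. \<integral>t. norm (x k * u t ^ k * g t) \<partial>M)"
  proof (rule summable_comparison_test')
    show "summable (\<lambda>k. cmod (x k) * (\<integral>t. cmod (g t) \<partial>M))"
      by (intro summable_mult2 x)
    fix k
    have "(\<integral>t. norm (x k * u t ^ k * g t) \<partial>M) \<le> (\<integral>t. cmod (x k) * cmod (g t) \<partial>M)"
    proof (intro integral_mono)
      show "integrable M (\<lambda>t. norm (x k * u t ^ k * g t))"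
        by (rule integrable_norm[OF int])
      show "integrable M (\<lambda>t. cmod (x k) * cmod (g t))"
        using g by auto
      show "norm (x k * u t ^ k * g t) \<le> cmod (x k) * cmod (g t)" for t
        using le1 by (auto simp: norm_mult norm_power intro!: mult_right_mono mult_left_le)
    qed
    then show "norm (\<integral>t. norm (x k * u t ^ k * g t) \<partial>M) \<le> cmod (x k) * (\<integral>t. cmod (g t) \<partial>M)"
      by simp
  qed
  have pointwise: "summable (\<lambda>k. norm (x k * u t ^ k * g t))" for t
    using summable_mult2[OF power_ser_abs_summable[OF x u1[of t]], of "cmod (g t)"]
    by (simp add: norm_mult)
  have eq: "power_ser x (u t) * g t = (\<Sum>k. x k * u t ^ k * g t)" for t
    unfolding power_ser_def
    by (rule suminf_mult2[OF summable_norm_cancel[OF power_ser_abs_summable[OF x u1]]])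
  show "integrable M (\<lambda>t. power_ser x (u t) * g t)"
    unfolding eq by (rule integrable_suminf[OF int _ sum]) (simp add: pointwise)
  show "(\<integral>t. power_ser x (u t) * g t \<partial>M) = (\<Sum>k. x k * (\<integral>t. u t ^ k * g t \<partial>M))"
    unfolding eq
    by (subst integral_suminf[OF int _ sum], simp add: pointwise) (simp add: mult.assoc)
qed

lemma power_ser_integrable:
  assumes x: "summable (\<lambda>k. cmod (x k))" and u: "u \<in> borel_measurable freq"
    and u1: "\<And>t. cmod (u t) \<le> 1"
  shows "integrable freq (\<lambda>t. power_ser x (u t))"
  using integral_power_ser(1)[OF x u u1, of "\<lambda>_. 1"] by simp

lemma cis_power_int: "cis t ^ k = cis (of_int (int k) * t)"
  by (simp add: Complex.DeMoivre)

lemma cis_minus_power_int: "cis (- t) ^ k = cis (of_int (- int k) * t)"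
  by (simp add: Complex.DeMoivre)

lemma integral_power_ser_cis:
  fixes x :: "nat \<Rightarrow> complex"
  assumes x: "summable (\<lambda>k. cmod (x k))"
  shows "(\<integral>t. power_ser x (cis t) * cis (of_int m * t) \<partial>freq) = (if m \<le> 0 then 2 * pi * x (nat (- m)) else 0)"
proof -
  have "(\<integral>t. power_ser x (cis t) * cis (of_int m * t) \<partial>freq) =
      (\<Sum>k. x k * (\<integral>t. cis t ^ k * cis (of_int m * t) \<partial>freq))"
    by (rule integral_power_ser(2)[OF x]) (auto intro!: integrable_freq_bounded[where B = 1])
  also have "(\<lambda>k. \<integral>t. cis t ^ k * cis (of_int m * t) \<partial>freq) = (\<lambda>k. if int k + m = 0 then complex_of_real (2 * pi) else 0)"
  proof
    fix k
    have "(\<lambda>t. cis t ^ k * cis (of_int m * t)) = (\<lambda>t. cis (of_int (int k + m) * t))"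
      by (simp add: cis_power_int cis_mult algebra_simps fun_eq_iff)
    then show "(\<integral>t. cis t ^ k * cis (of_int m * t) \<partial>freq) = (if int k + m = 0 then complex_of_real (2 * pi) else 0)"
      by (simp only: integral_cis)
  qed
  also have "(\<Sum>k. x k * (if int k + m = 0 then complex_of_real (2 * pi) else 0)) = (if m \<le> 0 then 2 * pi * x (nat (- m)) else 0)"
  proof (cases "m \<le> 0")
    case True
    then have "(\<Sum>k. x k * (if int k + m = 0 then complex_of_real (2 * pi) else 0))
        = (\<Sum>k\<in>{nat (- m)}. x k * (if int k + m = 0 then complex_of_real (2 * pi) else 0))"
      by (intro suminf_finite) auto
    then show ?thesis using True by simp
  next
    case False
    then have "(\<lambda>k. x k * (if int k + m = 0 then complex_of_real (2 * pi) else 0)) = (\<lambda>k. 0)"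
      by auto
    then show ?thesis using False by simp
  qed
  finally show ?thesis by simp
qed

lemma summable_norm_square:
  fixes x :: "nat \<Rightarrow> complex"
  assumes "summable (\<lambda>k. cmod (x k))"
  shows "summable (\<lambda>k. (cmod (x k))\<^sup>2)"
proof (rule summable_comparison_test_ev[OF _ assms])
  have "\<forall>\<^sub>F k in sequentially. cmod (x k) < 1"
    using summable_LIMSEQ_zero[OF assms] by (intro order_tendstoD(2)) auto
  then show "\<forall>\<^sub>F k in sequentially. norm ((cmod (x k))\<^sup>2) \<le> cmod (x k)"
    by eventually_elim (simp add: power2_eq_square mult_left_le)
qed

lemma Parseval_power_ser:
  assumes x: "summable (\<lambda>k. cmod (x k))"
  shows "(\<integral>t. (cmod (power_ser x (cis t)))\<^sup>2 \<partial>freq) = 2 * pi * l2_sq x"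
proof -
  let ?X = "\<lambda>t. power_ser x (cis t)"
  have int: "integrable freq (\<lambda>t. cnj (?X t))"
    by (intro integrable_cnj power_ser_integrable x) auto
  have "complex_of_real (\<integral>t. (cmod (?X t))\<^sup>2 \<partial>freq) = (\<integral>t. ?X t * cnj (?X t) \<partial>freq)"
    by (simp add: complex_norm_square del: of_real_power flip: integral_complex_of_real)
  also have "\<dots> = (\<Sum>k. x k * (\<integral>t. cis t ^ k * cnj (?X t) \<partial>freq))"
    by (rule integral_power_ser(2)[OF x _ _ int]) auto
  also have "(\<lambda>k. \<integral>t. cis t ^ k * cnj (?X t) \<partial>freq) = (\<lambda>k. 2 * pi * cnj (x k))"
  proof
    fix k
    have "(\<integral>t. cis t ^ k * cnj (?X t) \<partial>freq) = (\<integral>t. cnj (?X t * cis (of_int (- int k) * t)) \<partial>freq)"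
      by (simp add: cis_power_int cis_cnj mult.commute)
    also have "\<dots> = cnj (\<integral>t. ?X t * cis (of_int (- int k) * t) \<partial>freq)"
      by (rule Bochner_Integration.integral_cnj)
    also have "\<dots> = 2 * pi * cnj (x k)"
      unfolding integral_power_ser_cis[OF x] by simp
    finally show "(\<integral>t. cis t ^ k * cnj (?X t) \<partial>freq) = 2 * pi * cnj (x k)" .
  qed
  also have "(\<Sum>k. x k * (2 * pi * cnj (x k))) = (\<Sum>k. complex_of_real (2 * pi * (cmod (x k))\<^sup>2))"
    unfolding of_real_mult complex_norm_square by (simp add: mult_ac)
  also have "\<dots> = complex_of_real (\<Sum>k. 2 * pi * (cmod (x k))\<^sup>2)"
    by (rule suminf_of_real[OF summable_mult[OF summable_norm_square[OF x]], symmetric])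
  finally have "(\<integral>t. (cmod (?X t))\<^sup>2 \<partial>freq) = (\<Sum>k. 2 * pi * (cmod (x k))\<^sup>2)"
    by (simp only: of_real_eq_iff)
  also have "\<dots> = 2 * pi * l2_sq x"
    unfolding l2_sq_def by (rule suminf_mult[OF summable_norm_square[OF x]])
  finally show ?thesis .
qed

text \<open>The Schwarz kernel, which reconstructs an analytic function in the disc from the real
  part of its boundary values.\<close>

definition schwarz :: "complex \<Rightarrow> real \<Rightarrow> complex" where
  "schwarz z t = (cis t + z) / (cis t - z)"

lemma schwarz_series:
  assumes "cmod z < 1"
  shows "schwarz z t = power_ser (\<lambda>k. if k = 0 then 1 else 2 * z ^ k) (cis (- t))"
    "summable (\<lambda>k. cmod (if k = 0 then 1 else 2 * z ^ k))"
proof -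
  let ?q = "z * cis (- t)"
  have q: "cmod ?q < 1" using assms by (simp add: norm_mult)
  have nz: "1 - ?q \<noteq> 0" using q by auto
  have cis: "cis t * cis (- t) = 1" by (simp add: cis_mult)
  have d: "cis t - z = cis t * (1 - ?q)"
    using cis by (simp add: algebra_simps)
  have n: "cis t + z = cis t * (1 + ?q)"
    using cis by (simp add: algebra_simps)
  have s: "schwarz z t = 2 * (1 / (1 - ?q)) - 1"
    unfolding schwarz_def d n using nz by (simp add: field_simps)
  have "(\<lambda>k. 2 * ?q ^ k - (if k = 0 then 1 else 0)) sums (2 * (1 / (1 - ?q)) - 1)"
    using geometric_sums[OF q] sums_single[of 0 "\<lambda>_. 1 :: complex"] by (intro sums_diff sums_mult) auto
  also have "(\<lambda>k. 2 * ?q ^ k - (if k = 0 then 1 else 0)) = (\<lambda>k. (if k = 0 then 1 else 2 * z ^ k) * cis (- t) ^ k)"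
    by (auto simp: fun_eq_iff power_mult_distrib)
  finally show "schwarz z t = power_ser (\<lambda>k. if k = 0 then 1 else 2 * z ^ k) (cis (- t))"
    unfolding s power_ser_def by (simp add: sums_iff)
  show "summable (\<lambda>k. cmod (if k = 0 then 1 else 2 * z ^ k))"
  proof (rule summable_comparison_test')
    show "summable (\<lambda>k. 2 * cmod z ^ k)"
      using assms by (intro summable_mult summable_geometric) auto
  qed (auto simp: norm_mult norm_power)
qed

lemma schwarz_measurable [measurable]: "schwarz z \<in> borel_measurable freq"
  unfolding schwarz_def[abs_def] by measurable

lemma schwarz_bound:
  assumes "cmod z < 1"
  shows "cmod (schwarz z t) \<le> 2 / (1 - cmod z)"
proof -
  have "cmod (cis t + z) \<le> 2"
    using norm_triangle_ineq[of "cis t" z] assms by simp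
  moreover have "1 - cmod z \<le> cmod (cis t - z)"
    using norm_triangle_ineq2[of "cis t" z] by simp
  ultimately show ?thesis
    unfolding schwarz_def norm_divide using assms by (intro frac_le) auto
qed

text \<open>The kernel is a power series in \<open>cis (- t)\<close>, so it meets the Fourier
  coefficients of index \<open>k \<ge> 0\<close> only. For \<open>k > 0\<close> the conjugate half of
  the real part has none, and for \<open>k = 0\<close> the two halves contribute equally.\<close>

lemma schwarz_formula:
  assumes y: "summable (\<lambda>k. cmod (y k))" "Im (y 0) = 0" and z: "cmod z < 1"
  shows "(\<integral>t. schwarz z t * complex_of_real (2 * Re (power_ser y (cis t))) \<partial>freq) = 4 * pi * power_ser y z"
proof -
  let ?Y = "\<lambda>t. power_ser y (cis t)"
  have intY: "integrable freq ?Y" "integrable freq (\<lambda>t. cnj (?Y t))"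
    by (auto intro!: power_ser_integrable y)
  have re: "complex_of_real (2 * Re (?Y t)) = ?Y t + cnj (?Y t)" for t
    by (rule complex_add_cnj[symmetric])
  have coeff: "(\<integral>t. cis (- t) ^ k * complex_of_real (2 * Re (?Y t)) \<partial>freq) = (if k = 0 then 4 * pi * y 0 else 2 * pi * y k)" for k
  proof -
    have i1: "integrable freq (\<lambda>t. ?Y t * cis (of_int (- int k) * t))"
      by (rule integral_power_ser(1)[OF y(1)]) (auto intro!: integrable_freq_bounded[where B = 1])
    have i2: "integrable freq (\<lambda>t. cnj (?Y t * cis (of_int (int k) * t)))"
      by (intro integrable_cnj, rule integral_power_ser(1)[OF y(1)]) (auto intro!: integrable_freq_bounded[where B = 1])
    have "(\<integral>t. cis (- t) ^ k * complex_of_real (2 * Re (?Y t)) \<partial>freq)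
      = (\<integral>t. ?Y t * cis (of_int (- int k) * t) + cnj (?Y t * cis (of_int (int k) * t)) \<partial>freq)"
      unfolding re cis_minus_power_int by (simp add: cis_cnj algebra_simps)
    also have "\<dots> = (\<integral>t. ?Y t * cis (of_int (- int k) * t) \<partial>freq) + cnj (\<integral>t. ?Y t * cis (of_int (int k) * t) \<partial>freq)"
      unfolding Bochner_Integration.integral_add[OF i1 i2] Bochner_Integration.integral_cnj ..
    also have "\<dots> = (if k = 0 then 4 * pi * y 0 else 2 * pi * y k)"
      unfolding integral_power_ser_cis[OF y(1)] using y(2) by (auto simp: complex_eq_iff)
    finally show ?thesis .
  qed
  have "(\<integral>t. schwarz z t * complex_of_real (2 * Re (?Y t)) \<partial>freq)
      = (\<Sum>k. (if k = 0 then 1 else 2 * z ^ k) * (\<integral>t. cis (- t) ^ k * complex_of_real (2 * Re (?Y t)) \<partial>freq))"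
    unfolding schwarz_series(1)[OF z]
    by (rule integral_power_ser(2)[OF schwarz_series(2)[OF z]])
      (auto simp: re simp del: of_real_mult intro!: intY)
  also have "\<dots> = (\<Sum>k. 4 * pi * (y k * z ^ k))"
    unfolding coeff by (intro suminf_cong) auto
  also have "\<dots> = 4 * pi * power_ser y z"
    unfolding power_ser_def using z
    by (intro suminf_mult sums_summable[OF power_ser_sums[OF y(1)]]) auto
  finally show ?thesis .
qed

section \<open>Factorization of the outer function of the increment kernel\<close>

text \<open>A comparison, uniform in the radius, that dominates the logarithms along \<open>\<rho>
  \<rightarrow> 1\<close>.\<close>

lemma norm_one_minus_unit_le:
  fixes w :: complex
  assumes "cmod w = 1" "0 \<le> \<rho>" "\<rho> \<le> 1"
  shows "cmod (1 - w) \<le> 2 * cmod (1 - of_real \<rho> * w)" "1 - \<rho> \<le> cmod (1 - of_real \<rho> * w)"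
    "cmod (1 - of_real \<rho> * w) \<le> 2"
proof -
  have 1: "cmod (of_real \<rho> * w) = \<rho>"
    using assms by (simp add: norm_mult)
  show 2: "1 - \<rho> \<le> cmod (1 - of_real \<rho> * w)"
    using norm_triangle_ineq2[of 1 "of_real \<rho> * w"] 1 by simp
  have "1 - w = (1 - of_real \<rho> * w) - of_real (1 - \<rho>) * w"
    by (simp add: algebra_simps)
  then have "cmod (1 - w) \<le> cmod (1 - of_real \<rho> * w) + cmod (of_real (1 - \<rho>) * w)"
    by (metis norm_triangle_ineq4)
  also have "cmod (of_real (1 - \<rho>) * w) = 1 - \<rho>"
    using assms by (simp only: norm_mult norm_of_real) simp
  finally show "cmod (1 - w) \<le> 2 * cmod (1 - of_real \<rho> * w)"
    using 2 by simp
  show "cmod (1 - of_real \<rho> * w) \<le> 2"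
    using norm_triangle_ineq4[of 1 "of_real \<rho> * w"] 1 assms by simp
qed

lemma AE_cis_power_neq_1:
  assumes "m \<ge> 1"
  shows "AE t in freq. cis t ^ m \<noteq> 1"
proof -
  have "{t. cis t ^ m = 1} \<subseteq> range (\<lambda>j::int. of_int j * 2 * pi / real m)"
  proof
    fix t assume "t \<in> {t. cis t ^ m = 1}"
    then have "cos (real m * t) = 1"
      by (simp add: Complex.DeMoivre complex_eq_iff)
    then obtain j :: int where "real m * t = of_int j * 2 * pi"
      by (auto simp: cos_one_2pi_int)
    then have "t = of_int j * 2 * pi / real m"
      using assms by (simp add: field_simps)
    then show "t \<in> range (\<lambda>j::int. of_int j * 2 * pi / real m)" by blast
  qed
  then have "countable {t. cis t ^ m = 1}"
    by (rule countable_subset) simp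
  from AE_freq_countable[OF this] show ?thesis by simp
qed

lemma log_measurable [measurable]:
  "(\<lambda>t. ln (cmod (1 - c * cis t ^ m))) \<in> borel_measurable freq"
  by measurable

lemma interior_log_bound:
  assumes "0 \<le> \<rho>" "\<rho> < 1"
  shows "\<bar>ln (cmod (1 - of_real \<rho> * cis t ^ m))\<bar> \<le> \<bar>ln (1 - \<rho>)\<bar> + ln 2"
proof -
  let ?u = "cmod (1 - of_real \<rho> * cis t ^ m)"
  have u: "1 - \<rho> \<le> ?u" "?u \<le> 2"
    using norm_one_minus_unit_le[of "cis t ^ m" \<rho>] assms by (auto simp: norm_power)
  have "0 < ?u" using u(1) assms by linarith
  then have "ln (1 - \<rho>) \<le> ln ?u" "ln ?u \<le> ln 2"
    using u assms by (simp_all only: ln_le_cancel_iff)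
  moreover have "0 \<le> ln (2::real)" by simp
  ultimately show ?thesis by linarith
qed

lemma radius_beyond_unit_disc:
  assumes m: "m \<ge> 1" and \<rho>: "0 \<le> \<rho>" "\<rho> < 1"
  obtains R where "R > 1" "\<And>\<zeta>. cmod \<zeta> < R \<Longrightarrow> Re (1 - of_real \<rho> * \<zeta> ^ m) > 0"
proof
  \<comment> \<open>This choice gives \<open>1 < R ^ m\<close> and \<open>\<rho> R ^ m <
    1\<close>.\<close>
  define R where "R = root m (2 / (1 + \<rho>))"
  show "R > 1"
    using m \<rho> by (simp add: R_def real_root_gt_1_iff)
  have Rm: "R ^ m = 2 / (1 + \<rho>)"
    using m \<rho> by (simp add: R_def)
  fix \<zeta> :: complex assume \<zeta>: "cmod \<zeta> < R"
  have "cmod (of_real \<rho> * \<zeta> ^ m) = \<rho> * cmod \<zeta> ^ m"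
    using \<rho> by (simp add: norm_mult norm_power)
  also have "\<dots> \<le> \<rho> * R ^ m"
    using \<zeta> \<rho> by (intro mult_left_mono power_mono) auto
  also have "\<dots> < 1"
    unfolding Rm using \<rho> by (simp add: field_simps)
  finally have "Re (of_real \<rho> * \<zeta> ^ m) < 1"
    using complex_Re_le_cmod[of "of_real \<rho> * \<zeta> ^ m"] by linarith
  then show "Re (1 - of_real \<rho> * \<zeta> ^ m) > 0"
    by simp
qed

lemma schwarz_log_interior:
  assumes m: "m \<ge> 1" and \<rho>: "0 \<le> \<rho>" "\<rho> < 1" and z: "cmod z < 1"
  shows "(\<integral>t. schwarz z t * complex_of_real (2 * ln (cmod (1 - of_real \<rho> * cis t ^ m))) \<partial>freq)
    = 4 * pi * Ln (1 - of_real \<rho> * z ^ m)"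
proof -
  obtain R where R1: "R > 1" and R: "\<And>\<zeta>. cmod \<zeta> < R \<Longrightarrow> Re (1 - of_real \<rho> * \<zeta> ^ m) > 0"
    using radius_beyond_unit_disc[OF m \<rho>] by metis
  let ?F = "\<lambda>\<zeta>. Ln (1 - of_real \<rho> * \<zeta> ^ m)"
  have pos: "1 - of_real \<rho> * \<zeta> ^ m \<notin> \<real>\<^sub>\<le>\<^sub>0" if "cmod \<zeta> < R" for \<zeta>
    using R[OF that] unfolding complex_nonpos_Reals_iff by linarith
  have "?F holomorphic_on ball 0 R"
    by (intro holomorphic_intros) (use pos in auto)
  then have "wiener ?F"
    using R1 by (rule wiener_of_holomorphic)
  then obtain y where y: "summable (\<lambda>k. cmod (y k))" "\<And>\<zeta>. cmod \<zeta> \<le> 1 \<Longrightarrow> ?F \<zeta> = power_ser y \<zeta>"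
    unfolding wiener_def by blast
  have y0: "y 0 = 0"
    using y(2)[of 0] m powser_zero[of y] by (simp add: power_ser_def power_0_left)
  have "2 * Re (power_ser y (cis t)) = 2 * ln (cmod (1 - of_real \<rho> * cis t ^ m))" for t
  proof -
    have "1 - of_real \<rho> * cis t ^ m \<noteq> 0"
      using pos[of "cis t"] R1 by auto
    then show ?thesis
      using y(2)[of "cis t"] by (metis Re_Ln norm_cis order_refl)
  qed
  then have "(\<integral>t. schwarz z t * complex_of_real (2 * ln (cmod (1 - of_real \<rho> * cis t ^ m))) \<partial>freq)
    = 4 * pi * power_ser y z"
    using schwarz_formula[OF y(1) _ z] y0 by simp
  also have "power_ser y z = Ln (1 - of_real \<rho> * z ^ m)"
    using y(2)[of z] z by simp
  finally show ?thesis .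
qed

definition radii :: "nat \<Rightarrow> real" where
  "radii i = 1 - inverse (real (Suc i))"

lemma radii: "0 \<le> radii i" "radii i < 1" "radii \<longlonglongrightarrow> 1"
proof -
  show "0 \<le> radii i" "radii i < 1" by (auto simp: radii_def field_simps)
  have "(\<lambda>i. 1 - inverse (real (Suc i))) \<longlonglongrightarrow> 1 - 0"
    by (intro tendsto_intros LIMSEQ_inverse_real_of_nat)
  then show "radii \<longlonglongrightarrow> 1" by (simp add: radii_def[abs_def])
qed

lemma log_radii_tendsto:
  assumes "cis t ^ m \<noteq> 1"
  shows "(\<lambda>i. ln (cmod (1 - of_real (radii i) * cis t ^ m))) \<longlonglongrightarrow> ln (cmod (1 - cis t ^ m))"
proof -
  have "(\<lambda>i. ln (cmod (1 - of_real (radii i) * cis t ^ m))) \<longlonglongrightarrow> ln (cmod (1 - of_real 1 * cis t ^ m))"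
    using assms by (intro tendsto_intros radii) auto
  then show ?thesis by simp
qed

text \<open>For \<open>\<rho> < 1\<close> the logarithm of \<open>|1 - \<rho> cis t ^ m|\<close> has
  mean zero, by the Schwarz formula at the origin, and it is at most \<open>ln 2\<close>. Fatou's
  lemma bounds the integral of \<open>ln 2 - ln |1 - cis t ^ m|\<close>.\<close>

lemma log_boundary_integrable:
  assumes m: "m \<ge> 1"
  shows "integrable freq (\<lambda>t. ln (cmod (1 - cis t ^ m)))"
proof -
  let ?u = "\<lambda>\<rho> t. ln (cmod (1 - complex_of_real \<rho> * cis t ^ m))"
  have int: "integrable freq (?u (radii i))" for i
    using interior_log_bound[OF radii(1,2)]
    by (intro integrable_freq_bounded[where B = "\<bar>ln (1 - radii i)\<bar> + ln 2"]) auto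
  have "complex_of_real (2 * (\<integral>t. ?u (radii i) t \<partial>freq)) = 0" for i
  proof -
    have "(\<integral>t. schwarz 0 t * complex_of_real (2 * ?u (radii i) t) \<partial>freq) = 0"
      using m by (subst schwarz_log_interior[OF m radii(1,2)]) (auto simp: power_0_left)
    moreover have "(\<integral>t. schwarz 0 t * complex_of_real (2 * ?u (radii i) t) \<partial>freq)
        = complex_of_real (\<integral>t. 2 * ?u (radii i) t \<partial>freq)"
      unfolding integral_complex_of_real[symmetric]
      by (intro Bochner_Integration.integral_cong) (auto simp: schwarz_def)
    ultimately show ?thesis
      by simp
  qed
  then have zero: "(\<integral>t. ?u (radii i) t \<partial>freq) = 0" for i
    by (simp del: of_real_mult)
  have nonneg: "0 \<le> ln 2 - ?u \<rho> t" if "0 \<le> \<rho>" "\<rho> \<le> 1" for \<rho> t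
  proof (cases "1 - complex_of_real \<rho> * cis t ^ m = 0")
    case False
    then have "?u \<rho> t \<le> ln 2"
      using norm_one_minus_unit_le(3)[of "cis t ^ m" \<rho>] that by (subst ln_le_cancel_iff) (auto simp: norm_power)
    then show ?thesis by simp
  qed simp
  have "(\<integral>\<^sup>+t. ennreal (ln 2 - ?u 1 t) \<partial>freq) = (\<integral>\<^sup>+t. liminf (\<lambda>i. ennreal (ln 2 - ?u (radii i) t)) \<partial>freq)"
  proof (rule nn_integral_cong_AE)
    show "AE t in freq. ennreal (ln 2 - ?u 1 t) = liminf (\<lambda>i. ennreal (ln 2 - ?u (radii i) t))"
      using AE_cis_power_neq_1[OF m]
    proof eventually_elim
      case (elim t)
      have "(\<lambda>i. ennreal (ln 2 - ?u (radii i) t)) \<longlonglongrightarrow> ennreal (ln 2 - ?u 1 t)"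
        using tendsto_ennrealI[OF tendsto_diff[OF tendsto_const log_radii_tendsto[OF elim]], of "ln 2"]
        by simp
      then show ?case
        by (intro lim_imp_Liminf[symmetric]) auto
    qed
  qed
  also have "\<dots> \<le> liminf (\<lambda>i. \<integral>\<^sup>+t. ennreal (ln 2 - ?u (radii i) t) \<partial>freq)"
    by (intro nn_integral_liminf) measurable
  also have "(\<lambda>i. \<integral>\<^sup>+t. ennreal (ln 2 - ?u (radii i) t) \<partial>freq) = (\<lambda>i. ennreal (2 * pi * ln 2))"
  proof
    fix i
    have "(\<integral>\<^sup>+t. ennreal (ln 2 - ?u (radii i) t) \<partial>freq) = ennreal (\<integral>t. ln 2 - ?u (radii i) t \<partial>freq)"
      using int nonneg radii(1,2)[of i] by (intro nn_integral_eq_integral) auto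
    also have "(\<integral>t. ln 2 - ?u (radii i) t \<partial>freq) = 2 * pi * ln 2"
      using int[of i] zero[of i] by (simp add: measure_def emeasure_freq)
    finally show "(\<integral>\<^sup>+t. ennreal (ln 2 - ?u (radii i) t) \<partial>freq) = ennreal (2 * pi * ln 2)" .
  qed
  also have "liminf (\<lambda>i::nat. ennreal (2 * pi * ln 2)) < \<infinity>"
    by (simp add: Liminf_const)
  finally have "integrable freq (\<lambda>t. ln 2 - ?u 1 t)"
    using nonneg[of 1] by (intro integrableI_nonneg) auto
  from Bochner_Integration.integrable_diff[OF freq.integrable_const[of "ln 2"] this]
  show ?thesis by simp
qed

lemma schwarz_times_integrable:
  assumes z: "cmod z < 1" and g: "integrable freq g"
  shows "integrable freq (\<lambda>t. schwarz z t * complex_of_real (g t))"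
proof (rule Bochner_Integration.integrable_bound)
  show "integrable freq (\<lambda>t. 2 / (1 - cmod z) * \<bar>g t\<bar>)"
    using g by auto
  have [measurable]: "g \<in> borel_measurable freq" using g by auto
  show "(\<lambda>t. schwarz z t * complex_of_real (g t)) \<in> borel_measurable freq"
    by measurable
  have "norm (schwarz z t * complex_of_real (g t)) \<le> 2 / (1 - cmod z) * \<bar>g t\<bar>" for t
    unfolding norm_mult norm_of_real by (intro mult_right_mono schwarz_bound z) simp
  then show "AE t in freq. norm (schwarz z t * complex_of_real (g t)) \<le> norm (2 / (1 - cmod z) * \<bar>g t\<bar>)"
    using z by (intro AE_I2) (auto intro: order_trans)
qed

text \<open>The formula holds for radii \<open>\<rho> < 1\<close> and passes to the limit by
  dominated convergence.\<close>

lemma schwarz_log_boundary: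
  assumes m: "m \<ge> 1" and z: "cmod z < 1"
  shows "(\<integral>t. schwarz z t * complex_of_real (2 * ln (cmod (1 - cis t ^ m))) \<partial>freq) = 4 * pi * Ln (1 - z ^ m)"
proof -
  let ?u = "\<lambda>\<rho> t. ln (cmod (1 - complex_of_real \<rho> * cis t ^ m))"
  have "(\<lambda>i. \<integral>t. schwarz z t * complex_of_real (2 * ?u (radii i) t) \<partial>freq)
      \<longlonglongrightarrow> (\<integral>t. schwarz z t * complex_of_real (2 * ln (cmod (1 - cis t ^ m))) \<partial>freq)"
  proof (rule integral_dominated_convergence)
    show "integrable freq (\<lambda>t. 2 / (1 - cmod z) * (2 * (\<bar>ln (cmod (1 - cis t ^ m))\<bar> + ln 2)))"
      using log_boundary_integrable[OF m] by auto
    show "AE t in freq. (\<lambda>i. schwarz z t * complex_of_real (2 * ?u (radii i) t))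
        \<longlonglongrightarrow> schwarz z t * complex_of_real (2 * ln (cmod (1 - cis t ^ m)))"
      using AE_cis_power_neq_1[OF m] by eventually_elim (intro tendsto_intros log_radii_tendsto)
    show "AE t in freq. norm (schwarz z t * complex_of_real (2 * ?u (radii i) t))
        \<le> 2 / (1 - cmod z) * (2 * (\<bar>ln (cmod (1 - cis t ^ m))\<bar> + ln 2))" for i
      using AE_cis_power_neq_1[OF m]
    proof eventually_elim
      case (elim t)
      let ?a = "cmod (1 - cis t ^ m)" and ?b = "cmod (1 - complex_of_real (radii i) * cis t ^ m)"
      have a: "?a > 0" using elim by auto
      have ab: "?a \<le> 2 * ?b" "?b \<le> 2"
        using norm_one_minus_unit_le[of "cis t ^ m" "radii i"] radii(1,2)[of i] by (auto simp: norm_power)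
      have b: "?b > 0" using a ab by linarith
      have "ln ?a \<le> ln (2 * ?b)" using a b ab by simp
      then have "ln ?a \<le> ln 2 + ln ?b" using b by (simp add: ln_mult)
      moreover have "ln ?b \<le> ln 2" using b ab by simp
      ultimately have "\<bar>2 * ln ?b\<bar> \<le> 2 * (\<bar>ln ?a\<bar> + ln 2)" by (simp add: abs_if)
      then show ?case
        unfolding norm_mult norm_of_real using z
        by (intro mult_mono schwarz_bound) auto
    qed
  qed measurable
  moreover have "(\<lambda>i. \<integral>t. schwarz z t * complex_of_real (2 * ?u (radii i) t) \<partial>freq)
      \<longlonglongrightarrow> 4 * pi * Ln (1 - of_real 1 * z ^ m)"
    unfolding schwarz_log_interior[OF m radii(1,2) z]
  proof (intro tendsto_intros radii)
    have "cmod (z ^ m) < 1"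
      using m z by (simp add: norm_power power_less_one_iff)
    then have "Re (z ^ m) < 1"
      using complex_Re_le_cmod[of "z ^ m"] by linarith
    then show "1 - complex_of_real 1 * z ^ m \<notin> \<real>\<^sub>\<le>\<^sub>0"
      by (auto simp: complex_nonpos_Reals_iff)
  qed
  ultimately show ?thesis
    using LIMSEQ_unique by fastforce
qed

lemma AE_freq_interior: "AE t in freq. -pi < t \<and> t < pi \<and> t \<noteq> 0"
proof -
  have "AE t in freq. t \<notin> {-pi, pi, 0}"
    by (rule AE_freq_countable) simp
  moreover have "AE t in freq. t \<in> {-pi..pi}"
    by (rule AE_I2) simp
  ultimately show ?thesis
    by eventually_elim auto
qed

lemma norm_one_minus_cis_minus: "cmod (1 - cis (- t)) = cmod (1 - cis t)"
  by (metis cis_cnj complex_cnj_diff complex_cnj_one complex_mod_cnj)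

text \<open>The modulus of the kernel is \<open>|1 - z ^ \<mu>| / |1 - z|\<close> times the sinc
  function, all to the power \<open>n\<close>, where \<open>z = cis (- t)\<close>. The Schwarz
  integral of the logarithm of each factor is known.\<close>

lemma w_fun_product:
  assumes \<mu>: "\<mu> \<ge> 1" and z: "cmod z < 1"
    and x: "summable (\<lambda>k. cmod (x k))" "Im (x 0) = 0"
    "\<And>t. -pi < t \<Longrightarrow> t < pi \<Longrightarrow> 2 * Re (power_ser x (cis t)) = 2 * ln (sinc_real t)"
  shows "w_fun n \<mu> z = (\<Sum>j<\<mu>. z ^ j) ^ n * exp (power_ser x z) ^ n"
proof -
  let ?L = "\<lambda>t. ln (cmod (1 - cis (- real \<mu> * t)) ^ (2 * n) / t ^ (2 * n))"
  let ?a = "\<lambda>t. 2 * ln (cmod (1 - cis t ^ \<mu>))" and ?b = "\<lambda>t. 2 * ln (cmod (1 - cis t ^ 1))"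
    and ?g = "\<lambda>t. 2 * Re (power_ser x (cis t))"
  have re: "integrable freq (\<lambda>t. Re (power_ser x (cis t)))"
    by (intro integrable_Re power_ser_integrable x) auto
  have int: "integrable freq (\<lambda>t. schwarz z t * complex_of_real (?a t))"
    "integrable freq (\<lambda>t. schwarz z t * complex_of_real (?b t))"
    "integrable freq (\<lambda>t. schwarz z t * complex_of_real (?g t))"
    using log_boundary_integrable[OF \<mu>] log_boundary_integrable[of 1] re
    by (auto simp del: of_real_mult intro!: schwarz_times_integrable[OF z])
  have "(\<integral>t. schwarz z t * complex_of_real (?L t) \<partial>freq)
      = (\<integral>t. of_nat n * (schwarz z t * complex_of_real (?a t) - schwarz z t * complex_of_real (?b t)
          + schwarz z t * complex_of_real (?g t)) \<partial>freq)"
  proof (rule integral_cong_AE)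
    show "AE t in freq. schwarz z t * complex_of_real (?L t)
      = of_nat n * (schwarz z t * complex_of_real (?a t) - schwarz z t * complex_of_real (?b t)
          + schwarz z t * complex_of_real (?g t))"
      using AE_cis_power_neq_1[OF \<mu>] AE_freq_interior
    proof eventually_elim
      case (elim t)
      then have t: "-pi < t" "t < pi" "t \<noteq> 0" by auto
      let ?A = "cmod (1 - cis t ^ \<mu>)"
      have A: "?A > 0" using elim(1) by auto
      have pos: "sinc_real t > 0" using t pi_gt_zero by (intro sinc_real_pos) linarith
      have A_eq: "cmod (1 - cis (- real \<mu> * t)) = ?A"
        using norm_one_minus_cis_minus[of "real \<mu> * t"] by (simp add: Complex.DeMoivre)
      have "t ^ (2 * n) = \<bar>t\<bar> ^ (2 * n)" by (simp add: power_mult)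
      then have "?L t = ln ((?A / \<bar>t\<bar>) ^ (2 * n))"
        unfolding A_eq by (simp add: power_divide)
      also have "\<dots> = real n * (2 * ln ?A - 2 * ln \<bar>t\<bar>)"
        using A t by (simp add: ln_realpow ln_div)
      also have "2 * ln \<bar>t\<bar> = ?b t - ?g t"
      proof -
        have "?b t = 2 * ln (\<bar>t\<bar> * sinc_real t)"
          using pos by (simp add: norm_one_minus_cis)
        also have "\<dots> = 2 * ln \<bar>t\<bar> + 2 * ln (sinc_real t)"
          using t pos by (simp add: ln_mult)
        finally show ?thesis using x(3)[OF t(1,2)] by simp
      qed
      finally have L: "?L t = real n * (?a t - ?b t + ?g t)" by simp
      show ?case
        unfolding L by (simp only: of_real_mult of_real_diff of_real_add of_real_of_nat_eq) (simp add: algebra_simps)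
    qed
  qed measurable
  also have "\<dots> = of_nat n * (4 * pi * Ln (1 - z ^ \<mu>) - 4 * pi * Ln (1 - z ^ 1) + 4 * pi * power_ser x z)"
    unfolding schwarz_log_boundary[OF \<mu> z, symmetric] schwarz_log_boundary[OF order_refl z, symmetric]
      schwarz_formula[OF x(1,2) z, symmetric]
    using int by (simp only: integral_mult_right_zero Bochner_Integration.integral_add
        Bochner_Integration.integral_diff Bochner_Integration.integrable_diff)
  finally have "w_fun n \<mu> z = exp (1 / (4 * pi) * (of_nat n * (4 * pi * Ln (1 - z ^ \<mu>) - 4 * pi * Ln (1 - z ^ 1) + 4 * pi * power_ser x z)))"
    unfolding w_fun_def schwarz_def[symmetric] by simp
  also have "1 / (4 * pi) * (of_nat n * (4 * pi * Ln (1 - z ^ \<mu>) - 4 * pi * Ln (1 - z ^ 1) + 4 * pi * power_ser x z))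
      = of_nat n * ((Ln (1 - z ^ \<mu>) - Ln (1 - z)) + power_ser x z)"
    by (simp add: field_simps)
  also have "exp \<dots> = (exp (Ln (1 - z ^ \<mu>)) / exp (Ln (1 - z)) * exp (power_ser x z)) ^ n"
    by (simp only: exp_of_nat_mult exp_add exp_diff)
  also have "exp (Ln (1 - z ^ \<mu>)) / exp (Ln (1 - z)) = (\<Sum>j<\<mu>. z ^ j)"
  proof -
    have "cmod (z ^ \<mu>) < 1"
      using \<mu> z by (simp add: norm_power power_less_one_iff)
    then have "1 - z ^ \<mu> \<noteq> 0" "1 - z \<noteq> 0" using z by auto
    then show ?thesis
      using one_diff_power_eq[of z \<mu>] by simp
  qed
  finally show ?thesis
    by (simp only: power_mult_distrib)
qed

text \<open>The zeros of \<open>w\<close> on the unit circle are those of the polynomial \<open>(1 +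
  z + ... + z ^ (\<mu> - 1)) ^ n\<close>. The other factor \<open>E\<close> is an exponential, so it
  is invertible in the Wiener algebra.\<close>

lemma w_coeff_factorization:
  assumes \<mu>: "\<mu> \<ge> 1"
  obtains E where "wiener E" "wiener (\<lambda>z. inverse (E z))" "\<And>z. E z \<noteq> 0"
    "summable (\<lambda>k. cmod (w_coeff n \<mu> k))"
    "\<And>z. cmod z \<le> 1 \<Longrightarrow> power_ser (w_coeff n \<mu>) z = (\<Sum>j<\<mu>. z ^ j) ^ n * E z"
    "\<And>t. -pi < t \<Longrightarrow> t < pi \<Longrightarrow> cmod (E (cis (- t))) = sinc_real t ^ n"
proof -
  obtain x where x: "summable (\<lambda>k. cmod (x k))" "Im (x 0) = 0"
    "\<And>t. -pi < t \<Longrightarrow> t < pi \<Longrightarrow> 2 * Re (power_ser x (cis t)) = 2 * ln (sinc_real t)"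
    using sinc_log_series by metis
  define E where "E z = exp (power_ser x z) ^ n" for z
  have wE: "wiener E"
    unfolding E_def by (intro wiener_power wiener_exp wiener_power_ser x)
  have "wiener (\<lambda>z. exp ((-1) * power_ser x z) ^ n)"
    by (intro wiener_power wiener_exp wiener_mult wiener_const wiener_power_ser x)
  then have wE': "wiener (\<lambda>z. inverse (E z))"
    by (simp add: E_def exp_minus power_inverse)
  have wP: "wiener (\<lambda>z. \<Sum>j<\<mu>. z ^ j)" for \<mu> :: nat
    by (induction \<mu>) (auto intro!: wiener_const wiener_add wiener_power[OF wiener_id])
  define W where "W z = (\<Sum>j<\<mu>. z ^ j) ^ n * E z" for z
  have "wiener W"
    unfolding W_def by (intro wiener_mult wiener_power wP wE)
  then obtain y where y: "summable (\<lambda>k. cmod (y k))" "\<And>z. cmod z \<le> 1 \<Longrightarrow> W z = power_ser y z"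
    unfolding wiener_def by blast
  have "conv_radius y \<ge> norm (1 :: complex)"
    by (rule conv_radius_geI, rule summable_norm_cancel) (use y(1) in simp)
  moreover have "(0 :: ereal) < ereal (norm (1 :: complex))"
    by simp
  ultimately have "conv_radius y > 0"
    by (rule order_less_le_trans[rotated])
  then have rad: "fps_conv_radius (Abs_fps y) > 0"
    by (simp add: fps_conv_radius_def)
  have "w_fun n \<mu> has_fps_expansion Abs_fps y"
    unfolding has_fps_expansion_def
  proof
    have "\<forall>\<^sub>F z in nhds 0. z \<in> ball (0 :: complex) 1"
      by (intro eventually_nhds_in_open) auto
    then show "\<forall>\<^sub>F z in nhds 0. eval_fps (Abs_fps y) z = w_fun n \<mu> z"
    proof eventually_elim
      case (elim z)
      then show ?case
        using w_fun_product[OF \<mu> _ x, of z n] y(2)[of z] by (simp add: E_def W_def eval_fps_def power_ser_def)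
    qed
  qed (rule rad)
  then have wy: "w_coeff n \<mu> = y"
    unfolding w_coeff_def by (simp add: fps_expansion_eqI fun_eq_iff)
  show ?thesis
  proof (rule that[OF wE wE'])
    show "E z \<noteq> 0" for z by (simp add: E_def)
    show "summable (\<lambda>k. cmod (w_coeff n \<mu> k))" unfolding wy by (rule y)
    show "power_ser (w_coeff n \<mu>) z = (\<Sum>j<\<mu>. z ^ j) ^ n * E z" if "cmod z \<le> 1" for z
      using y(2)[OF that] unfolding wy W_def by (rule sym)
    show "cmod (E (cis (- t))) = sinc_real t ^ n" if "-pi < t" "t < pi" for t
    proof -
      have "Re (power_ser x (cis (- t))) = ln (sinc_real t)"
        using x(3)[of "- t"] that by (simp add: sinc_real_minus)
      moreover have "sinc_real t > 0"
        using that pi_gt_zero by (intro sinc_real_pos) linarith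
      ultimately show ?thesis
        by (simp add: E_def norm_power)
    qed
  qed
qed

section \<open>Division by the zeros of the kernel on the circle\<close>

lemma L2_norm_bounded:
  assumes "finite_measure M" "g \<in> borel_measurable M" "AE x in M. cmod (g x) \<le> B" "B \<ge> 0"
  shows "square_integrable M g" "L2_norm M g \<le> B * sqrt (measure M (space M))"
proof -
  interpret finite_measure M by fact
  have AE: "AE x in M. (cmod (g x))\<^sup>2 \<le> B\<^sup>2"
    using assms(3) by eventually_elim (intro power_mono, auto)
  have int: "integrable M (\<lambda>x. (cmod (g x))\<^sup>2)"
    using AE assms(2) by (intro integrable_const_bound[where B = "B\<^sup>2"]) auto
  then show "square_integrable M g"
    using assms(2) by (simp add: square_integrable_def)
  have "(\<integral>x. (cmod (g x))\<^sup>2 \<partial>M) \<le> (\<integral>x. B\<^sup>2 \<partial>M)"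
    by (intro integral_mono_AE int AE) simp
  then have "L2_norm M g \<le> sqrt (B\<^sup>2 * measure M (space M))"
    by (simp add: L2_norm_def mult.commute)
  then show "L2_norm M g \<le> B * sqrt (measure M (space M))"
    using assms(4) by (simp add: real_sqrt_mult)
qed

text \<open>On a finite measure space a constant serves as the dominating function.\<close>

lemma L2_norm_dominated_convergence:
  assumes "finite_measure M" "\<And>i. g i \<in> borel_measurable M"
    and bound: "\<And>i. AE x in M. cmod (g i x) \<le> B" and lim: "AE x in M. (\<lambda>i. g i x) \<longlonglongrightarrow> 0"
  shows "(\<lambda>i. L2_norm M (g i)) \<longlonglongrightarrow> 0"
proof -
  interpret finite_measure M by fact
  have "(\<lambda>i. \<integral>x. (cmod (g i x))\<^sup>2 \<partial>M) \<longlonglongrightarrow> (\<integral>x. 0 \<partial>M)"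
  proof (rule integral_dominated_convergence)
    show "AE x in M. (\<lambda>i. (cmod (g i x))\<^sup>2) \<longlonglongrightarrow> 0"
      using lim
    proof eventually_elim
      case (elim x)
      have "(\<lambda>i. (cmod (g i x))\<^sup>2) \<longlonglongrightarrow> (cmod 0)\<^sup>2"
        by (intro tendsto_intros elim)
      then show ?case by simp
    qed
    show "AE x in M. norm ((cmod (g i x))\<^sup>2) \<le> B\<^sup>2" for i
      using bound[of i] by eventually_elim (simp add: power_mono)
    show "integrable M (\<lambda>x. B\<^sup>2)" by simp
  qed (use assms(2) in measurable)
  then have "(\<lambda>i. sqrt (\<integral>x. (cmod (g i x))\<^sup>2 \<partial>M)) \<longlonglongrightarrow> sqrt 0"
    by (intro tendsto_real_sqrt) simp
  then show ?thesis by (simp add: L2_norm_def)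
qed

lemma incr_kernel_measurable [measurable]: "incr_kernel n \<mu> \<in> borel_measurable freq"
  unfolding incr_kernel_def[abs_def] by (intro borel_measurable_freq) measurable

lemma norm_one_minus_cis_le: "cmod (1 - cis t) \<le> \<bar>t\<bar>"
proof -
  have "\<bar>sinc_real t\<bar> \<le> 1"
    using abs_sin_x_le_abs_x[of "t / 2"] by (auto simp: sinc_real_def abs_mult divide_le_eq)
  then show ?thesis
    unfolding norm_one_minus_cis using mult_left_mono[of "\<bar>sinc_real t\<bar>" 1 "\<bar>t\<bar>"] by simp
qed

lemma incr_kernel_bound: "cmod (incr_kernel n \<mu> t) \<le> real \<mu> ^ n"
proof (cases "t = 0")
  case True
  then show ?thesis by (cases n) (auto simp: incr_kernel_def)
next
  case False
  have "cmod (incr_kernel n \<mu> t) = (cmod (1 - cis (- (real \<mu> * t))) / \<bar>t\<bar>) ^ n"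
    by (simp add: incr_kernel_def norm_divide norm_power norm_mult power_divide)
  also have "\<dots> \<le> real \<mu> ^ n"
  proof (intro power_mono)
    show "cmod (1 - cis (- (real \<mu> * t))) / \<bar>t\<bar> \<le> real \<mu>"
      using norm_one_minus_cis_le[of "- (real \<mu> * t)"] False by (simp add: abs_mult divide_le_eq)
  qed simp
  finally show ?thesis .
qed

text \<open>By the formula for geometric sums, \<open>1 - cis (- \<mu> t)\<close> is the product of
  \<open>1 - cis (- t)\<close> and this sum at \<open>cis (- t)\<close>, so the sum carries the zeros
  of the increment kernel.\<close>

definition geom :: "nat \<Rightarrow> complex \<Rightarrow> complex" where
  "geom \<mu> z = (\<Sum>j<\<mu>. z ^ j)"

lemma geom_mult: "(1 - z) * geom \<mu> z = 1 - z ^ \<mu>"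
  unfolding geom_def by (rule one_diff_power_eq[symmetric])

lemma geom_measurable [measurable]: "u \<in> borel_measurable M \<Longrightarrow> (\<lambda>t. geom \<mu> (u t)) \<in> borel_measurable M"
  unfolding geom_def by measurable

lemma norm_incr_kernel:
  assumes "t \<noteq> 0" "-pi < t" "t < pi"
  shows "cmod (incr_kernel n \<mu> t) = cmod (geom \<mu> (cis (- t))) ^ n * sinc_real t ^ n"
proof -
  have pos: "sinc_real t > 0"
    using assms pi_gt_zero by (intro sinc_real_pos) linarith
  have "cis (- (real \<mu> * t)) = cis (- t) ^ \<mu>"
    by (simp add: Complex.DeMoivre)
  then have "cmod (1 - cis (- (real \<mu> * t))) = cmod (1 - cis (- t)) * cmod (geom \<mu> (cis (- t)))"
    by (simp only: geom_mult[of "cis (- t)" \<mu>, symmetric] norm_mult)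
  also have "cmod (1 - cis (- t)) = \<bar>t\<bar> * sinc_real t"
    using pos norm_one_minus_cis[of "- t"] by (simp add: sinc_real_minus)
  finally have "cmod (1 - cis (- (real \<mu> * t))) / \<bar>t\<bar> = cmod (geom \<mu> (cis (- t))) * sinc_real t"
    using assms by simp
  moreover have "cmod (incr_kernel n \<mu> t) = (cmod (1 - cis (- (real \<mu> * t))) / \<bar>t\<bar>) ^ n"
    by (simp add: incr_kernel_def norm_divide norm_power norm_mult power_divide)
  ultimately show ?thesis by (simp add: power_mult_distrib)
qed

lemma AE_cis_minus_power_neq_1:
  assumes "m \<ge> 1"
  shows "AE t in freq. cis (- t) ^ m \<noteq> 1"
  using AE_cis_power_neq_1[OF assms]
proof eventually_elim
  case (elim t)
  have "cis (- t) ^ m = cnj (cis t ^ m)"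
    by (simp add: cis_cnj)
  then show ?case
    using elim complex_cnj_one_iff[of "cis t ^ m"] by simp
qed

lemma AE_generic:
  assumes "\<mu> \<ge> 1"
  shows "AE t in freq. -pi < t \<and> t < pi \<and> t \<noteq> 0 \<and> cis (- t) ^ \<mu> \<noteq> 1 \<and> geom \<mu> (cis (- t)) \<noteq> 0
    \<and> cis (- t) \<noteq> 1 \<and> incr_kernel n \<mu> t \<noteq> 0"
  using AE_freq_interior AE_cis_minus_power_neq_1[OF assms] AE_cis_minus_power_neq_1[of 1, OF order_refl]
proof eventually_elim
  case (elim t)
  have "geom \<mu> (cis (- t)) \<noteq> 0"
    using elim geom_mult[of "cis (- t)" \<mu>] by auto
  moreover have "sinc_real t > 0"
    using elim pi_gt_zero by (intro sinc_real_pos) linarith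
  ultimately have "cmod (incr_kernel n \<mu> t) > 0"
    using elim by (simp add: norm_incr_kernel)
  then show ?case
    using elim \<open>geom \<mu> (cis (- t)) \<noteq> 0\<close> by auto
qed

lemma wiener_bounded:
  assumes "wiener T"
  obtains C where "C \<ge> 0" "\<And>z. cmod z \<le> 1 \<Longrightarrow> cmod (T z) \<le> C"
proof -
  obtain x where x: "summable (\<lambda>k. cmod (x k))" "\<And>z. cmod z \<le> 1 \<Longrightarrow> T z = power_ser x z"
    using assms unfolding wiener_def by blast
  show ?thesis
    using that[of "\<Sum>k. cmod (x k)"] power_ser_bound[OF x(1)] x(2) suminf_nonneg[OF x(1)] by simp
qed

lemma wiener_measurable:
  assumes "wiener T" and u: "u \<in> borel_measurable M" "\<And>t. cmod (u t) \<le> 1"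
  shows "(\<lambda>t. T (u t)) \<in> borel_measurable M"
proof -
  obtain x where x: "\<And>z. cmod z \<le> 1 \<Longrightarrow> T z = power_ser x z"
    using assms unfolding wiener_def by blast
  have "(\<lambda>t. T (u t)) = (\<lambda>t. power_ser x (u t))"
    using x u(2) by auto
  then show ?thesis using u(1) by simp
qed

text \<open>The reciprocal of \<open>w\<close> may be unbounded near the zeros of the kernel, but
  multiplied by the kernel it is of this form with \<open>T\<close> in the Wiener algebra, and
  bounded.\<close>

definition kernel_quotient :: "nat \<Rightarrow> nat \<Rightarrow> (complex \<Rightarrow> complex) \<Rightarrow> real \<Rightarrow> complex" where
  "kernel_quotient n \<mu> T t = T (cis (- t)) * inverse (geom \<mu> (cis (- t))) ^ n * incr_kernel n \<mu> t"

lemma kernel_quotient_measurable: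
  assumes "wiener T"
  shows "kernel_quotient n \<mu> T \<in> borel_measurable freq"
proof -
  have [measurable]: "(\<lambda>t. T (cis (- t))) \<in> borel_measurable freq"
    by (rule wiener_measurable[OF assms]) auto
  show ?thesis
    unfolding kernel_quotient_def[abs_def] by measurable
qed

lemma norm_kernel_quotient:
  assumes "t \<noteq> 0" "-pi < t" "t < pi" "geom \<mu> (cis (- t)) \<noteq> 0"
  shows "cmod (kernel_quotient n \<mu> T t) = cmod (T (cis (- t))) * sinc_real t ^ n"
proof -
  let ?g = "cmod (geom \<mu> (cis (- t)))"
  have "cmod (kernel_quotient n \<mu> T t) = cmod (T (cis (- t))) * (inverse ?g ^ n * (?g ^ n * sinc_real t ^ n))"
    unfolding kernel_quotient_def
    by (simp only: norm_mult norm_power norm_inverse norm_incr_kernel[OF assms(1-3)] mult.assoc)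
  also have "inverse ?g ^ n * (?g ^ n * sinc_real t ^ n) = sinc_real t ^ n"
    using assms(4) by (simp add: power_inverse flip: mult.assoc)
  finally show ?thesis .
qed

lemma kernel_quotient_bound:
  assumes mu: "\<mu> \<ge> 1" and T: "wiener T"
  obtains C where "C \<ge> 0" "AE t in freq. cmod (kernel_quotient n \<mu> T t) \<le> C"
proof -
  obtain C where C: "C \<ge> 0" "\<And>z. cmod z \<le> 1 \<Longrightarrow> cmod (T z) \<le> C"
    using wiener_bounded[OF T] by metis
  have "AE t in freq. cmod (kernel_quotient n \<mu> T t) \<le> C"
    using AE_generic[OF mu, of n]
  proof eventually_elim
    case (elim t)
    have "\<bar>sinc_real t\<bar> \<le> 1"
      using abs_sin_x_le_abs_x[of "t / 2"] by (auto simp: sinc_real_def abs_mult divide_le_eq)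
    moreover have "sinc_real t > 0"
      using elim pi_gt_zero by (intro sinc_real_pos) linarith
    ultimately have s: "0 \<le> sinc_real t ^ n" "sinc_real t ^ n \<le> 1"
      by (auto intro: power_le_one)
    have "cmod (T (cis (- t))) * sinc_real t ^ n \<le> C * 1"
      using C s by (intro mult_mono) auto
    then show ?case
      using elim by (simp add: norm_kernel_quotient)
  qed
  then show ?thesis by (rule that[OF C(1)])
qed

text \<open>The reciprocal \<open>(1 - z) / (1 - z ^ \<mu>)\<close> of the geometric sum is replaced
  by \<open>(1 - z) / (1 - \<rho> z ^ \<mu>)\<close>, which lies in the Wiener algebra for
  \<open>\<rho> < 1\<close>, so that its product with \<open>T\<close> is a uniform limit of
  polynomials. The factor \<open>(1 - z ^ \<mu>) / (1 - \<rho> z ^ \<mu>)\<close> introduced in this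
  way is at most \<open>2\<close> in modulus and tends to \<open>1\<close> almost everywhere. The
  error is thus dominated by a constant, whatever the integrable density \<open>f\<close> is.\<close>

lemma kernel_quotient_approx:
  assumes mu: "\<mu> \<ge> 1" and T: "wiener T" and f: "spectral_density f" and \<delta>: "\<delta> > 0"
  shows "\<exists>N c. L2_norm (spectral_measure f)
    (\<lambda>t. kernel_quotient n \<mu> T t - (\<Sum>k<N. c k * cis (- t) ^ k * incr_kernel n \<mu> t)) < \<delta>"
proof -
  let ?F = "spectral_measure f" and ?K = "incr_kernel n \<mu>"
  interpret F: finite_measure ?F by (rule finite_spectral_measure[OF f])
  \<comment> \<open>The zeros of \<open>1 - z ^ \<mu>\<close> on the circle are moved outside the
    disc.\<close>
  define R where "R i z = T z * ((1 - z) * inverse (1 - of_real (radii i) * z ^ \<mu>)) ^ n" for i z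
  have R: "wiener (R i)" for i
  proof -
    obtain r where r: "r > 1" "\<And>\<zeta>. cmod \<zeta> < r \<Longrightarrow> Re (1 - of_real (radii i) * \<zeta> ^ \<mu>) > 0"
      using radius_beyond_unit_disc[OF mu radii(1,2)] by metis
    have "(\<lambda>z. inverse (1 - of_real (radii i) * z ^ \<mu>)) holomorphic_on ball 0 r"
    proof (intro holomorphic_intros)
      fix z :: complex assume "z \<in> ball 0 r"
      then show "1 - complex_of_real (radii i) * z ^ \<mu> \<noteq> 0"
        using r(2)[of z] zero_complex.sel(1) by (metis dist_0_norm less_irrefl mem_ball)
    qed
    then have "wiener (\<lambda>z. inverse (1 - of_real (radii i) * z ^ \<mu>))"
      using r(1) by (rule wiener_of_holomorphic)
    then show ?thesis
      unfolding R_def by (intro wiener_mult wiener_power wiener_diff T wiener_const wiener_id)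
  qed
  have Rm: "(\<lambda>t. R i (cis (- t))) \<in> borel_measurable freq" for i
    by (rule wiener_measurable[OF R]) auto
  obtain C where C: "C \<ge> 0" "AE t in freq. cmod (kernel_quotient n \<mu> T t) \<le> C"
    using kernel_quotient_bound[OF mu T] by metis
  let ?q = "\<lambda>i t. (1 - cis (- t) ^ \<mu>) / (1 - of_real (radii i) * cis (- t) ^ \<mu>)"
  have eq: "AE t in freq. kernel_quotient n \<mu> T t - R i (cis (- t)) * ?K t = kernel_quotient n \<mu> T t * (1 - ?q i t ^ n)" for i
    using AE_generic[OF mu, of n]
  proof eventually_elim
    case (elim t)
    let ?z = "cis (- t)"
    have q_eq: "(1 - ?z) * inverse (1 - of_real (radii i) * ?z ^ \<mu>) = inverse (geom \<mu> ?z) * ?q i t"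
      using elim geom_mult[of ?z \<mu>, symmetric] by (simp add: divide_inverse)
    have "R i ?z * ?K t = kernel_quotient n \<mu> T t * ?q i t ^ n"
      unfolding R_def q_eq kernel_quotient_def power_mult_distrib by (simp only: mult_ac)
    then show ?case by (simp add: algebra_simps)
  qed
  have q_bound: "cmod (?q i t) \<le> 2" for i t
    using norm_one_minus_unit_le[of "cis (- t) ^ \<mu>" "radii i"] radii(1,2)[of i]
    by (simp add: norm_power norm_divide divide_le_eq)
  have "(\<lambda>i. L2_norm ?F (\<lambda>t. kernel_quotient n \<mu> T t - R i (cis (- t)) * ?K t)) \<longlonglongrightarrow> 0"
  proof (rule L2_norm_dominated_convergence[OF F.finite_measure_axioms])
    show "(\<lambda>t. kernel_quotient n \<mu> T t - R i (cis (- t)) * ?K t) \<in> borel_measurable ?F" for i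
      using Rm kernel_quotient_measurable[OF T] by simp
    show "AE t in ?F. cmod (kernel_quotient n \<mu> T t - R i (cis (- t)) * ?K t) \<le> C * (1 + 2 ^ n)" for i
    proof (rule AE_spectral_measure[OF f])
      show "AE t in freq. cmod (kernel_quotient n \<mu> T t - R i (cis (- t)) * ?K t) \<le> C * (1 + 2 ^ n)"
        using eq[of i] C(2)
      proof eventually_elim
        case (elim t)
        have "cmod (1 - ?q i t ^ n) \<le> 1 + cmod (?q i t) ^ n"
          using norm_triangle_ineq4[of 1 "?q i t ^ n"] by (simp add: norm_power)
        also have "\<dots> \<le> 1 + 2 ^ n"
          using q_bound by (intro add_left_mono power_mono) auto
        finally show ?case
          unfolding elim(1) norm_mult using elim(2) C(1) by (intro mult_mono) auto
      qed
    qed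
    show "AE t in ?F. (\<lambda>i. kernel_quotient n \<mu> T t - R i (cis (- t)) * ?K t) \<longlonglongrightarrow> 0"
    proof (rule AE_spectral_measure[OF f])
      have "AE t in freq. \<forall>i. kernel_quotient n \<mu> T t - R i (cis (- t)) * ?K t = kernel_quotient n \<mu> T t * (1 - ?q i t ^ n)"
        using eq by (simp add: AE_all_countable)
      then show "AE t in freq. (\<lambda>i. kernel_quotient n \<mu> T t - R i (cis (- t)) * ?K t) \<longlonglongrightarrow> 0"
        using AE_generic[OF mu, of n]
      proof eventually_elim
        case (elim t)
        have nz: "1 - cis (- t) ^ \<mu> \<noteq> 0" using elim by auto
        have "(\<lambda>i. complex_of_real (radii i)) \<longlonglongrightarrow> complex_of_real 1"
          by (intro tendsto_of_real radii)
        then have "(\<lambda>i. kernel_quotient n \<mu> T t * (1 - ?q i t ^ n))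
          \<longlonglongrightarrow> kernel_quotient n \<mu> T t * (1 - ((1 - cis (- t) ^ \<mu>) / (1 - complex_of_real 1 * cis (- t) ^ \<mu>)) ^ n)"
          by (intro tendsto_intros) (use nz radii(3) in auto)
        then show ?case
          using elim nz by simp
      qed
    qed
  qed
  then have "\<forall>\<^sub>F i in sequentially. L2_norm ?F (\<lambda>t. kernel_quotient n \<mu> T t - R i (cis (- t)) * ?K t) < \<delta> / 2"
    using \<delta> by (intro order_tendstoD(2)) auto
  then obtain i where i: "L2_norm ?F (\<lambda>t. kernel_quotient n \<mu> T t - R i (cis (- t)) * ?K t) < \<delta> / 2"
    by (auto simp: eventually_sequentially)
  obtain x where x: "summable (\<lambda>k. cmod (x k))" "\<And>z. cmod z \<le> 1 \<Longrightarrow> R i z = power_ser x z"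
    using R[of i] unfolding wiener_def by blast
  let ?B = "\<lambda>N. (\<Sum>k. cmod (x (k + N))) * real \<mu> ^ n * sqrt (measure ?F (space ?F))"
  have "?B \<longlonglongrightarrow> 0 * real \<mu> ^ n * sqrt (measure ?F (space ?F))"
    by (intro tendsto_intros summable_tail_tendsto_0 x(1))
  then have "\<forall>\<^sub>F N in sequentially. ?B N < \<delta> / 2"
    using \<delta> by (intro order_tendstoD(2)) auto
  then obtain N where N: "?B N < \<delta> / 2"
    by (auto simp: eventually_sequentially)
  let ?S = "\<lambda>t. \<Sum>k<N. x k * cis (- t) ^ k * ?K t"
  have tail: "cmod (R i (cis (- t)) * ?K t - ?S t) \<le> (\<Sum>k. cmod (x (k + N))) * real \<mu> ^ n" for t
  proof -
    have "R i (cis (- t)) * ?K t - ?S t = (power_ser x (cis (- t)) - (\<Sum>k<N. x k * cis (- t) ^ k)) * ?K t"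
      using x(2)[of "cis (- t)"] by (simp add: left_diff_distrib sum_distrib_right)
    also have "cmod \<dots> \<le> (\<Sum>k. cmod (x (k + N))) * real \<mu> ^ n"
      unfolding norm_mult using x(1) by (intro mult_mono power_ser_tail incr_kernel_bound)
        (auto intro!: suminf_nonneg simp: summable_iff_shift[of "\<lambda>k. cmod (x k)"])
    finally show ?thesis .
  qed
  have tail_nonneg: "0 \<le> (\<Sum>k. cmod (x (k + N))) * real \<mu> ^ n"
    using tail[of 0] norm_ge_zero order_trans by blast
  have m1: "(\<lambda>t. R i (cis (- t)) * ?K t - ?S t) \<in> borel_measurable ?F"
    using Rm by simp
  note b = L2_norm_bounded[OF F.finite_measure_axioms m1 AE_I2[OF tail] tail_nonneg]
  have sq: "square_integrable ?F (kernel_quotient n \<mu> T)"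
    using kernel_quotient_measurable[OF T] C
    by (intro L2_norm_bounded(1)[OF F.finite_measure_axioms, where B = C]) (auto intro: AE_spectral_measure[OF f])
  have S: "square_integrable ?F ?S"
  proof (intro square_integrable_sum L2_norm_bounded(1)[OF F.finite_measure_axioms])
    fix k
    show "AE t in ?F. cmod (x k * cis (- t) ^ k * ?K t) \<le> cmod (x k) * real \<mu> ^ n"
      by (rule AE_I2) (auto simp: norm_mult norm_power intro!: mult_left_mono incr_kernel_bound)
  qed auto
  have RK: "square_integrable ?F (\<lambda>t. R i (cis (- t)) * ?K t)"
    using square_integrable_add[OF b(1) S] by simp
  have "L2_norm ?F (\<lambda>t. kernel_quotient n \<mu> T t - ?S t) < \<delta>"
    using L2_norm_triangle_diff[OF sq RK S] i N b(2) by linarith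
  then show ?thesis by blast
qed

section \<open>Best approximation by the past\<close>

lemma kernel_term_square_integrable:
  assumes f: "spectral_density f" and u: "u \<in> borel_measurable freq" "\<And>t. cmod (u t) \<le> 1"
  shows "square_integrable (spectral_measure f) (\<lambda>t. c * (u t * incr_kernel n \<mu> t))"
proof (rule L2_norm_bounded(1)[OF finite_spectral_measure[OF f]])
  show "AE t in spectral_measure f. cmod (c * (u t * incr_kernel n \<mu> t)) \<le> cmod c * (1 * real \<mu> ^ n)"
    unfolding norm_mult by (intro AE_I2 mult_left_mono mult_mono incr_kernel_bound u) auto
qed (use u in auto)

definition past_sum :: "nat \<Rightarrow> nat \<Rightarrow> nat \<Rightarrow> (nat \<Rightarrow> complex) \<Rightarrow> real \<Rightarrow> complex" where
  "past_sum n \<mu> N c t = (\<Sum>k=1..N. c k * (cis (- real k * t) * incr_kernel n \<mu> t))"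

lemma past_sum_square_integrable:
  assumes "spectral_density f"
  shows "square_integrable (spectral_measure f) (past_sum n \<mu> N c)"
  unfolding past_sum_def[abs_def]
  by (intro square_integrable_sum kernel_term_square_integrable[OF assms]) auto

lemma L2_past_iff:
  assumes f: "spectral_density f"
  shows "g \<in> L2_past n \<mu> f \<longleftrightarrow> square_integrable (spectral_measure f) g \<and>
    (\<forall>\<delta>>0. \<exists>N c. L2_norm (spectral_measure f) (\<lambda>t. g t - past_sum n \<mu> N c t) < \<delta>)"
    (is "_ \<longleftrightarrow> ?R")
proof
  let ?F = "spectral_measure f"
  assume g: "g \<in> L2_past n \<mu> f"
  then have gm: "g \<in> borel_measurable freq"
    and approx: "\<And>\<delta>. \<delta> > 0 \<Longrightarrow> \<exists>N c. (\<integral>\<^sup>+t. ennreal ((cmod (g t - past_sum n \<mu> N c t))\<^sup>2) \<partial>?F) < \<delta>"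
    unfolding L2_past_def past_sum_def by auto
  have key: "square_integrable ?F (\<lambda>t. g t - past_sum n \<mu> N c t) \<and>
      L2_norm ?F (\<lambda>t. g t - past_sum n \<mu> N c t) < \<delta>"
    if "(\<integral>\<^sup>+t. ennreal ((cmod (g t - past_sum n \<mu> N c t))\<^sup>2) \<partial>?F) < ennreal (\<delta>\<^sup>2)" "\<delta> > 0" for N c \<delta>
  proof -
    have sq: "square_integrable ?F (\<lambda>t. g t - past_sum n \<mu> N c t)"
      using that(1) gm past_sum_square_integrable[OF f, of n \<mu> N c]
      by (intro square_integrableI_nn) (auto simp: square_integrable_def intro: less_trans)
    then have "(L2_norm ?F (\<lambda>t. g t - past_sum n \<mu> N c t))\<^sup>2 < \<delta>\<^sup>2"
      using that(1) by (simp add: nn_integral_square ennreal_less_iff)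
    then show ?thesis
      using sq that(2) power2_less_imp_less by (metis less_imp_le)
  qed
  obtain N c where "(\<integral>\<^sup>+t. ennreal ((cmod (g t - past_sum n \<mu> N c t))\<^sup>2) \<partial>?F) < ennreal (1\<^sup>2)"
    using approx[of 1] by auto
  from square_integrable_add[OF conjunct1[OF key[OF this]] past_sum_square_integrable[OF f, of n \<mu> N c]]
  have "square_integrable ?F g" by simp
  moreover have "\<exists>N c. L2_norm ?F (\<lambda>t. g t - past_sum n \<mu> N c t) < \<delta>" if "\<delta> > 0" for \<delta>
  proof -
    have "ennreal (\<delta>\<^sup>2) > 0" using that by simp
    then obtain N c where "(\<integral>\<^sup>+t. ennreal ((cmod (g t - past_sum n \<mu> N c t))\<^sup>2) \<partial>?F) < ennreal (\<delta>\<^sup>2)"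
      using approx by blast
    from key[OF this that] show ?thesis by blast
  qed
  ultimately show ?R by blast
next
  let ?F = "spectral_measure f"
  assume R: ?R
  then have sq: "square_integrable ?F (\<lambda>t. g t - past_sum n \<mu> N c t)" for N c
    by (auto intro: past_sum_square_integrable[OF f])
  have "\<exists>N c. (\<integral>\<^sup>+t. ennreal ((cmod (g t - past_sum n \<mu> N c t))\<^sup>2) \<partial>?F) < \<delta>" if "\<delta> > 0" for \<delta> :: ennreal
  proof -
    obtain e where e: "e > 0" "ennreal (e\<^sup>2) < \<delta>"
    proof (cases "\<delta> = \<top>")
      case True
      then show ?thesis using that[of 1] by simp
    next
      case False
      then obtain d where d: "\<delta> = ennreal d" "d > 0"
        using \<open>\<delta> > 0\<close> by (cases \<delta>) auto
      have "ennreal ((sqrt (d / 2))\<^sup>2) < \<delta>"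
        using d by (simp add: ennreal_less_iff)
      then show ?thesis using that[of "sqrt (d / 2)"] d by simp
    qed
    obtain N c where "L2_norm ?F (\<lambda>t. g t - past_sum n \<mu> N c t) < e"
      using R e(1) by blast
    then have "(L2_norm ?F (\<lambda>t. g t - past_sum n \<mu> N c t))\<^sup>2 \<le> e\<^sup>2"
      by (intro power_mono) auto
    then have "(\<integral>\<^sup>+t. ennreal ((cmod (g t - past_sum n \<mu> N c t))\<^sup>2) \<partial>?F) < \<delta>"
      unfolding nn_integral_square[OF sq] using e(2) by (meson ennreal_leI le_less_trans)
    then show ?thesis by blast
  qed
  moreover have "g \<in> borel_measurable freq"
    using R by (auto simp: square_integrable_def)
  ultimately show "g \<in> L2_past n \<mu> f"
    unfolding L2_past_def past_sum_def by simp
qed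

lemma L2_past_cong_AE:
  assumes f: "spectral_density f" and g: "g \<in> L2_past n \<mu> f" and h: "h \<in> borel_measurable freq"
    and eq: "AE t in freq. g t = h t"
  shows "h \<in> L2_past n \<mu> f"
proof -
  let ?F = "spectral_measure f"
  have eq': "AE t in ?F. g t = h t" by (rule AE_spectral_measure[OF f eq])
  have gs: "square_integrable ?F g" using g L2_past_iff[OF f] by blast
  have hs: "square_integrable ?F h"
    using eq' h by (intro square_integrable_cong_AE[OF gs]) auto
  have pm: "past_sum n \<mu> N c \<in> borel_measurable ?F" for N c
    using past_sum_square_integrable[OF f] by (auto simp: square_integrable_def)
  have "L2_norm ?F (\<lambda>t. h t - past_sum n \<mu> N c t) = L2_norm ?F (\<lambda>t. g t - past_sum n \<mu> N c t)" for N c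
  proof (rule L2_norm_cong_AE)
    show "(\<lambda>t. h t - past_sum n \<mu> N c t) \<in> borel_measurable ?F"
      by (intro borel_measurable_diff square_integrable_measurable[OF hs] pm)
    show "(\<lambda>t. g t - past_sum n \<mu> N c t) \<in> borel_measurable ?F"
      by (intro borel_measurable_diff square_integrable_measurable[OF gs] pm)
    show "AE t in ?F. h t - past_sum n \<mu> N c t = g t - past_sum n \<mu> N c t"
      using eq' by eventually_elim simp
  qed
  then show ?thesis
    using g hs unfolding L2_past_iff[OF f] by simp
qed

lemma past_sum_scale_diff:
  "\<exists>c''. \<forall>t. past_sum n \<mu> N c t - past_sum n \<mu> N' c' t = past_sum n \<mu> (max N N') c'' t"
proof -
  let ?d = "\<lambda>k. (if k \<le> N then c k else 0) - (if k \<le> N' then c' k else 0)"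
  have ext: "past_sum n \<mu> N c t = (\<Sum>k=1..max N N'. (if k \<le> N then c k else 0) * (cis (- real k * t) * incr_kernel n \<mu> t))"
    for N N' :: nat and c t
    unfolding past_sum_def by (intro sum.mono_neutral_cong_left) auto
  have "past_sum n \<mu> N c t - past_sum n \<mu> N' c' t = past_sum n \<mu> (max N N') ?d t" for t
    unfolding ext[of N c t N'] ext[of N' c' t N] max.commute[of N' N]
    by (simp add: past_sum_def sum_subtractf[symmetric] left_diff_distrib)
  then show ?thesis by blast
qed

lemma L2_past_diff:
  assumes f: "spectral_density f" and g: "g \<in> L2_past n \<mu> f" and h: "h \<in> L2_past n \<mu> f"
  shows "(\<lambda>t. g t - h t) \<in> L2_past n \<mu> f"
proof -
  let ?F = "spectral_measure f"
  have gs: "square_integrable ?F g" "square_integrable ?F h"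
    using g h L2_past_iff[OF f] by blast+
  have "\<exists>N c. L2_norm ?F (\<lambda>t. (g t - h t) - past_sum n \<mu> N c t) < \<delta>" if \<delta>: "\<delta> > 0" for \<delta>
  proof -
    obtain N c N' c' where 1: "L2_norm ?F (\<lambda>t. g t - past_sum n \<mu> N c t) < \<delta> / 2"
      and 2: "L2_norm ?F (\<lambda>t. h t - past_sum n \<mu> N' c' t) < \<delta> / 2"
    proof -
      have "\<delta> / 2 > 0" using \<delta> by simp
      then show thesis
        using g h that unfolding L2_past_iff[OF f] by blast
    qed
    obtain c'' where c'': "\<And>t. past_sum n \<mu> N c t - past_sum n \<mu> N' c' t = past_sum n \<mu> (max N N') c'' t"
      using past_sum_scale_diff by metis
    have sq: "square_integrable ?F (\<lambda>t. g t - past_sum n \<mu> N c t)" "square_integrable ?F (\<lambda>t. - (h t - past_sum n \<mu> N' c' t))"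
      by (intro square_integrable_diff square_integrable_uminus gs past_sum_square_integrable[OF f])+
    have "L2_norm ?F (\<lambda>t. (g t - h t) - past_sum n \<mu> (max N N') c'' t) < \<delta>"
      using L2_norm_triangle[OF sq] 1 2 L2_norm_uminus[of ?F "\<lambda>t. h t - past_sum n \<mu> N' c' t"]
      by (simp add: c''[symmetric] algebra_simps)
    then show ?thesis by blast
  qed
  then show ?thesis
    unfolding L2_past_iff[OF f] using gs by blast
qed

text \<open>Multiplication by \<open>cis (- t)\<close> moves the approximating polynomials one step
  into the past.\<close>

lemma kernel_quotient_past:
  assumes mu: "\<mu> \<ge> 1" and T: "wiener T" and f: "spectral_density f"
  shows "(\<lambda>t. cis (- t) * kernel_quotient n \<mu> T t) \<in> L2_past n \<mu> f"
proof -
  let ?F = "spectral_measure f" and ?K = "incr_kernel n \<mu>"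
  obtain C where C: "C \<ge> 0" "AE t in freq. cmod (kernel_quotient n \<mu> T t) \<le> C"
    using kernel_quotient_bound[OF mu T] by metis
  have sq: "square_integrable ?F (\<lambda>t. cis (- t) * kernel_quotient n \<mu> T t)"
    using kernel_quotient_measurable[OF T] C
    by (intro L2_norm_bounded(1)[OF finite_spectral_measure[OF f], where B = C])
      (auto simp: norm_mult intro: AE_spectral_measure[OF f])
  moreover have "\<exists>N c. L2_norm ?F (\<lambda>t. cis (- t) * kernel_quotient n \<mu> T t - past_sum n \<mu> N c t) < \<delta>" if \<delta>: "\<delta> > 0" for \<delta>
  proof -
    obtain N c where c: "L2_norm ?F (\<lambda>t. kernel_quotient n \<mu> T t - (\<Sum>k<N. c k * cis (- t) ^ k * ?K t)) < \<delta>"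
      using kernel_quotient_approx[OF mu T f \<delta>] by blast
    have "past_sum n \<mu> N (\<lambda>k. c (k - 1)) t = cis (- t) * (\<Sum>k<N. c k * cis (- t) ^ k * ?K t)" for t
    proof -
      have "past_sum n \<mu> N (\<lambda>k. c (k - 1)) t = (\<Sum>k=1..N. c (k - 1) * (cis (- t) ^ k * ?K t))"
        by (simp add: past_sum_def Complex.DeMoivre)
      also have "\<dots> = (\<Sum>k<N. c k * (cis (- t) ^ Suc k * ?K t))"
        by (rule sum.reindex_bij_witness[of _ Suc "\<lambda>k. k - 1"]) auto
      also have "\<dots> = cis (- t) * (\<Sum>k<N. c k * cis (- t) ^ k * ?K t)"
        by (simp add: sum_distrib_left algebra_simps)
      finally show ?thesis .
    qed
    then have "L2_norm ?F (\<lambda>t. cis (- t) * kernel_quotient n \<mu> T t - past_sum n \<mu> N (\<lambda>k. c (k - 1)) t)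
      = L2_norm ?F (\<lambda>t. kernel_quotient n \<mu> T t - (\<Sum>k<N. c k * cis (- t) ^ k * ?K t))"
      by (simp add: L2_norm_def norm_mult flip: right_diff_distrib)
    then show ?thesis using c by metis
  qed
  ultimately show ?thesis
    unfolding L2_past_iff[OF f] by blast
qed

text \<open>The orthogonal projection onto the closed span: by the parallelogram law a minimizing
  sequence of finite combinations is Cauchy.\<close>

lemma best_past_approximation_exists:
  assumes f: "spectral_density f" and g: "square_integrable (spectral_measure f) g"
  obtains p where "p \<in> L2_past n \<mu> f"
    "\<And>q. q \<in> L2_past n \<mu> f \<Longrightarrow> L2_norm (spectral_measure f) (\<lambda>t. g t - p t) \<le> L2_norm (spectral_measure f) (\<lambda>t. g t - q t)"
proof -
  let ?F = "spectral_measure f"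
  \<comment> \<open>Finite combinations suffice for the infimum, since they are dense in the
    past.\<close>
  define S where "S = {L2_norm ?F (\<lambda>t. g t - past_sum n \<mu> N c t) | N c. True}"
  define d where "d = Inf S"
  have bdd: "bdd_below S" by (auto simp: S_def intro!: bdd_belowI[of _ 0])
  have ne: "S \<noteq> {}" by (auto simp: S_def)
  have d0: "d \<ge> 0" unfolding d_def by (rule cInf_greatest[OF ne]) (auto simp: S_def)
  have d_le: "d \<le> L2_norm ?F (\<lambda>t. g t - past_sum n \<mu> N c t)" for N c
    unfolding d_def by (rule cInf_lower[OF _ bdd]) (auto simp: S_def)
  have "\<exists>N c. L2_norm ?F (\<lambda>t. g t - past_sum n \<mu> N c t) < d + 1 / real (Suc i)" for i
  proof -
    have "\<exists>x\<in>S. x < d + 1 / real (Suc i)"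
      by (subst cInf_less_iff[OF ne bdd, symmetric]) (simp add: d_def)
    then show ?thesis by (auto simp: S_def)
  qed
  then obtain N c where Nc: "\<And>i. L2_norm ?F (\<lambda>t. g t - past_sum n \<mu> (N i) (c i) t) < d + 1 / real (Suc i)"
    by metis
  define p where "p i = past_sum n \<mu> (N i) (c i)" for i :: nat
  have p_sq: "square_integrable ?F (p i)" for i
    unfolding p_def by (rule past_sum_square_integrable[OF f])
  have e_sq: "square_integrable ?F (\<lambda>t. g t - p i t)" for i
    by (intro square_integrable_diff g p_sq)
  have pd: "L2_norm ?F (\<lambda>t. g t - p i t) < d + 1 / real (Suc i)" for i
    using Nc by (simp add: p_def)
  have mid: "d \<le> L2_norm ?F (\<lambda>t. g t - (1/2) * (p i t + p j t))" for i j
  proof -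
    obtain c' where c': "\<And>t. past_sum n \<mu> (N i) (\<lambda>k. (1/2) * c i k) t - past_sum n \<mu> (N j) (\<lambda>k. - (1/2) * c j k) t
        = past_sum n \<mu> (max (N i) (N j)) c' t"
      using past_sum_scale_diff by metis
    have sc: "past_sum n \<mu> N' (\<lambda>k. r * c'' k) t = r * past_sum n \<mu> N' c'' t" for N' r c'' t
      by (simp add: past_sum_def sum_distrib_left mult.assoc)
    have "(1/2) * (p i t + p j t) = past_sum n \<mu> (max (N i) (N j)) c' t" for t
      unfolding c'[symmetric] sc p_def by (simp add: algebra_simps)
    then show ?thesis using d_le by simp
  qed
  \<comment> \<open>Parallelogram law: near-optimal approximants are close to each other.\<close>
  have par: "(L2_norm ?F (\<lambda>t. p i t - p j t))\<^sup>2 + 4 * (L2_norm ?F (\<lambda>t. g t - (1/2) * (p i t + p j t)))\<^sup>2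
      = 2 * (L2_norm ?F (\<lambda>t. g t - p i t))\<^sup>2 + 2 * (L2_norm ?F (\<lambda>t. g t - p j t))\<^sup>2" for i j
  proof -
    have pw: "(cmod (x - y))\<^sup>2 + 4 * (cmod (w - (1/2) * (x + y)))\<^sup>2 = 2 * (cmod (w - x))\<^sup>2 + 2 * (cmod (w - y))\<^sup>2"
      for x y w :: complex
      unfolding cmod_power2 by (simp add: power2_eq_square field_simps)
    have m: "square_integrable ?F (\<lambda>t. g t - (1/2) * (p i t + p j t))" "square_integrable ?F (\<lambda>t. p i t - p j t)"
      by (intro square_integrable_diff square_integrable_cmult square_integrable_add g p_sq)+
    have "(\<integral>t. (cmod (p i t - p j t))\<^sup>2 + 4 * (cmod (g t - (1/2) * (p i t + p j t)))\<^sup>2 \<partial>?F)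
      = (\<integral>t. 2 * (cmod (g t - p i t))\<^sup>2 + 2 * (cmod (g t - p j t))\<^sup>2 \<partial>?F)"
      by (simp only: pw)
    then show ?thesis
      unfolding L2_norm_square using m[THEN square_integrableD] e_sq[THEN square_integrableD] by simp
  qed
  obtain P where P: "square_integrable ?F P" and lim: "(\<lambda>i. L2_norm ?F (\<lambda>t. p i t - P t)) \<longlonglongrightarrow> 0"
  proof (rule L2_complete[OF p_sq])
    fix e :: real assume e: "e > 0"
    have "(\<lambda>i. 4 * ((d + 1 / real (Suc i))\<^sup>2 - d\<^sup>2)) \<longlonglongrightarrow> 4 * ((d + 0)\<^sup>2 - d\<^sup>2)"
      by (intro tendsto_intros LIMSEQ_Suc[OF lim_1_over_n])
    then have "\<forall>\<^sub>F i in sequentially. 4 * ((d + 1 / real (Suc i))\<^sup>2 - d\<^sup>2) < e\<^sup>2"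
      using e by (intro order_tendstoD(2)) auto
    then obtain M where M: "4 * ((d + 1 / real (Suc M))\<^sup>2 - d\<^sup>2) < e\<^sup>2"
      by (auto simp: eventually_sequentially)
    have "L2_norm ?F (\<lambda>t. p i t - p j t) < e" if "i \<ge> M" "j \<ge> M" for i j
    proof -
      have b: "(L2_norm ?F (\<lambda>t. g t - p k t))\<^sup>2 \<le> (d + 1 / real (Suc M))\<^sup>2" if "k \<ge> M" for k
      proof (rule power_mono)
        have "1 / real (Suc k) \<le> 1 / real (Suc M)"
          using that by (intro divide_left_mono) auto
        then show "L2_norm ?F (\<lambda>t. g t - p k t) \<le> d + 1 / real (Suc M)"
          using pd[of k] by linarith
      qed simp
      have dm: "d\<^sup>2 \<le> (L2_norm ?F (\<lambda>t. g t - (1/2) * (p i t + p j t)))\<^sup>2"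
        using d0 mid by (intro power_mono) auto
      have "(L2_norm ?F (\<lambda>t. p i t - p j t))\<^sup>2 < e\<^sup>2"
      proof -
        have "(L2_norm ?F (\<lambda>t. p i t - p j t))\<^sup>2 \<le> 4 * (d + 1 / real (Suc M))\<^sup>2 - 4 * d\<^sup>2"
          using dm par[of i j] b[OF that(1)] b[OF that(2)] by argo
        also have "\<dots> < e\<^sup>2"
          using M by argo
        finally show ?thesis .
      qed
      then show ?thesis
        using e power2_less_imp_less by (metis less_imp_le)
    qed
    then show "\<exists>N. \<forall>i\<ge>N. \<forall>j\<ge>N. L2_norm ?F (\<lambda>x. p i x - p j x) < e" by blast
  qed
  have Pd: "L2_norm ?F (\<lambda>t. g t - P t) \<le> d"
  proof (rule LIMSEQ_le_const)
    have "(\<lambda>i. (d + 1 / real (Suc i)) + L2_norm ?F (\<lambda>t. p i t - P t)) \<longlonglongrightarrow> (d + 0) + 0"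
      by (intro tendsto_intros LIMSEQ_Suc[OF lim_1_over_n] lim)
    then show "(\<lambda>i. (d + 1 / real (Suc i)) + L2_norm ?F (\<lambda>t. p i t - P t)) \<longlonglongrightarrow> d" by simp
    have "L2_norm ?F (\<lambda>t. g t - P t) \<le> (d + 1 / real (Suc i)) + L2_norm ?F (\<lambda>t. p i t - P t)" for i
      using L2_norm_triangle_diff[OF g p_sq[of i] P] pd[of i] by linarith
    then show "\<exists>N. \<forall>i\<ge>N. L2_norm ?F (\<lambda>t. g t - P t) \<le> (d + 1 / real (Suc i)) + L2_norm ?F (\<lambda>t. p i t - P t)"
      by blast
  qed
  have "\<exists>N c. L2_norm ?F (\<lambda>t. P t - past_sum n \<mu> N c t) < \<delta>" if "\<delta> > 0" for \<delta>
  proof -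
    have "\<forall>\<^sub>F i in sequentially. L2_norm ?F (\<lambda>t. p i t - P t) < \<delta>"
      using lim that by (rule order_tendstoD(2))
    then obtain i where "L2_norm ?F (\<lambda>t. p i t - P t) < \<delta>" by (auto simp: eventually_sequentially)
    then have "L2_norm ?F (\<lambda>t. P t - past_sum n \<mu> (N i) (c i) t) < \<delta>"
      using L2_norm_commute[of ?F P "p i"] by (simp add: p_def)
    then show ?thesis by blast
  qed
  then have Past: "P \<in> L2_past n \<mu> f"
    unfolding L2_past_iff[OF f] using P by blast
  moreover have "L2_norm ?F (\<lambda>t. g t - P t) \<le> L2_norm ?F (\<lambda>t. g t - q t)" if q: "q \<in> L2_past n \<mu> f" for q
  proof (rule order_trans[OF Pd], rule field_le_epsilon)
    fix e :: real assume "e > 0"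
    then obtain N c where "L2_norm ?F (\<lambda>t. q t - past_sum n \<mu> N c t) < e"
      using q unfolding L2_past_iff[OF f] by blast
    moreover have "square_integrable ?F q" using q unfolding L2_past_iff[OF f] by blast
    ultimately show "d \<le> L2_norm ?F (\<lambda>t. g t - q t) + e"
      using L2_norm_triangle_diff[OF g _ past_sum_square_integrable[OF f, of n \<mu> N c], of q] d_le[of N c]
      by linarith
  qed
  ultimately show ?thesis by (rule that)
qed

section \<open>The error of the optimal spectral characteristic\<close>

text \<open>On the unit circle \<open>z\<close> is the inverse of \<open>\<zeta>\<close>, so the
  product of the two series is a series in both positive and negative powers of
  \<open>\<zeta>\<close>. The coefficients of nonnegative powers form the Hankel transform
  \<open>r\<close>; the negative powers make up a power series in \<open>z\<close> without constant
  term.\<close>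

lemma hankel_toeplitz_split:
  fixes b p :: "nat \<Rightarrow> complex"
  assumes b: "summable (\<lambda>k. cmod (b k))" and p: "summable (\<lambda>k. cmod (p k))"
  defines "r \<equiv> \<lambda>k. \<Sum>j. b (k + j) * p j"
  shows "summable (\<lambda>k. cmod (r k))"
    "\<exists>s. summable (\<lambda>k. cmod (s k)) \<and> (\<forall>\<zeta> z. cmod \<zeta> = 1 \<longrightarrow> \<zeta> * z = 1 \<longrightarrow>
      power_ser b \<zeta> * power_ser p z = power_ser r \<zeta> + z * power_ser s z)"
proof -
  let ?B = "\<Sum>k. cmod (b k)"
  define x where "x j m = p j * b (m + j)" for j m
  \<comment> \<open>The product of \<open>z ^ j\<close> with the terms of \<open>b\<close> of
    index below \<open>j\<close>, divided by \<open>z\<close>.\<close>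
  define y where "y j i = (if i < j then p j * b (j - 1 - i) else 0)" for j i
  have bj: "summable (\<lambda>m. cmod (b (m + j)))" for j
    using b by (simp add: summable_iff_shift[of "\<lambda>k. cmod (b k)"])
  have bj_le: "(\<Sum>m. cmod (b (m + j))) \<le> ?B" for j
    using suminf_split_initial_segment[OF b, of j] sum_nonneg[of "{..<j}" "\<lambda>k. cmod (b k)"] by simp
  have x1: "summable (\<lambda>m. cmod (x j m))" for j
    unfolding x_def norm_mult by (intro summable_mult bj)
  have x_le: "(\<Sum>m. cmod (x j m)) \<le> cmod (p j) * ?B" for j
    unfolding x_def norm_mult suminf_mult[OF bj] by (intro mult_left_mono bj_le) simp
  have x2: "summable (\<lambda>j. \<Sum>m. cmod (x j m))"
    by (rule summable_comparison_test'[OF summable_mult2[OF p, of ?B]])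
      (use x_le suminf_nonneg[OF x1] in simp)
  have y_fin: "y j i = 0" if "j \<le> i" for j i
    using that by (simp add: y_def)
  note y1 = power_ser_finite(1)[of j "y j" for j, OF y_fin]
  have y_le: "(\<Sum>i. cmod (y j i)) \<le> cmod (p j) * ?B" for j
  proof -
    have "(\<Sum>i. cmod (y j i)) = (\<Sum>i<j. cmod (y j i))"
      by (rule power_ser_finite(3)[OF y_fin])
    also have "\<dots> = (\<Sum>i<j. cmod (p j) * cmod (b (j - Suc i)))"
      by (intro sum.cong) (auto simp: y_def norm_mult)
    also have "\<dots> = cmod (p j) * (\<Sum>i<j. cmod (b i))"
      unfolding sum_distrib_left[symmetric] sum.nat_diff_reindex[of "\<lambda>i. cmod (b i)" j] ..
    also have "\<dots> \<le> cmod (p j) * ?B"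
      by (intro mult_left_mono sum_le_suminf b) auto
    finally show ?thesis .
  qed
  have y2: "summable (\<lambda>j. \<Sum>i. cmod (y j i))"
    by (rule summable_comparison_test'[OF summable_mult2[OF p, of ?B]])
      (use y_le suminf_nonneg[OF y1] in simp)
  have r: "r = (\<lambda>m. \<Sum>j. x j m)"
    by (simp add: r_def x_def mult.commute)
  show "summable (\<lambda>k. cmod (r k))"
    unfolding r by (rule wiener_suminf(1)[OF x1 x2])
  define s where "s i = (\<Sum>j. y j i)" for i
  have "power_ser b \<zeta> * power_ser p z = power_ser r \<zeta> + z * power_ser s z"
    if \<zeta>: "cmod \<zeta> = 1" and \<zeta>z: "\<zeta> * z = 1" for \<zeta> z
  proof -
    have z: "cmod z = 1"
      using \<zeta> \<zeta>z by (metis mult_1 norm_mult norm_one)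
    then have z_le: "cmod z \<le> 1" by linarith
    have term_eq: "power_ser b \<zeta> * (p j * z ^ j) = power_ser (x j) \<zeta> + z * power_ser (y j) z" for j
    proof -
      have pw: "\<zeta> ^ (m + j) * z ^ j = \<zeta> ^ m" for m
        using \<zeta>z by (simp add: power_add mult.assoc flip: power_mult_distrib)
      have "power_ser b \<zeta> = (\<Sum>m. b (m + j) * \<zeta> ^ (m + j)) + (\<Sum>k<j. b k * \<zeta> ^ k)"
        unfolding power_ser_def
        using \<zeta> by (intro suminf_split_initial_segment sums_summable[OF power_ser_sums[OF b]]) simp
      moreover have "(\<Sum>m. b (m + j) * \<zeta> ^ (m + j)) * (p j * z ^ j) = power_ser (x j) \<zeta>"
      proof -
        have "summable (\<lambda>m. b (m + j) * \<zeta> ^ (m + j))"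
          using \<zeta> sums_summable[OF power_ser_sums[OF b, of \<zeta>]]
          by (subst summable_iff_shift) auto
        then have "(\<Sum>m. b (m + j) * \<zeta> ^ (m + j)) * (p j * z ^ j) = (\<Sum>m. b (m + j) * \<zeta> ^ (m + j) * (p j * z ^ j))"
          by (rule suminf_mult2)
        also have "\<dots> = (\<Sum>m. x j m * \<zeta> ^ m)"
        proof (rule suminf_cong)
          fix m
          have "b (m + j) * \<zeta> ^ (m + j) * (p j * z ^ j) = p j * b (m + j) * (\<zeta> ^ (m + j) * z ^ j)"
            by (simp only: mult_ac)
          then show "b (m + j) * \<zeta> ^ (m + j) * (p j * z ^ j) = x j m * \<zeta> ^ m"
            unfolding pw x_def .
        qed
        finally show ?thesis by (simp add: power_ser_def)
      qed
      moreover have "(\<Sum>k<j. b k * \<zeta> ^ k) * (p j * z ^ j) = z * power_ser (y j) z"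
      proof -
        have "z * power_ser (y j) z = z * (\<Sum>i<j. y j i * z ^ i)"
          by (simp add: power_ser_finite(2)[OF y_fin])
        also have "\<dots> = (\<Sum>i<j. p j * b (j - Suc i) * z ^ Suc i)"
          by (auto simp: y_def sum_distrib_left intro!: sum.cong)
        also have "\<dots> = (\<Sum>i<j. (\<lambda>k. p j * b k * z ^ (j - k)) (j - Suc i))"
          by (intro sum.cong) auto
        also have "\<dots> = (\<Sum>k<j. p j * b k * z ^ (j - k))"
          by (rule sum.nat_diff_reindex)
        also have "\<dots> = (\<Sum>k<j. b k * \<zeta> ^ k * (p j * z ^ j))"
        proof (rule sum.cong[OF refl])
          fix k assume "k \<in> {..<j}"
          then have "z ^ j = z ^ k * z ^ (j - k)" by (simp flip: power_add)
          then have "\<zeta> ^ k * z ^ j = z ^ (j - k)"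
            using \<zeta>z by (simp flip: power_mult_distrib mult.assoc)
          then show "p j * b k * z ^ (j - k) = b k * \<zeta> ^ k * (p j * z ^ j)"
            by (simp add: mult_ac)
        qed
        finally show ?thesis by (simp add: sum_distrib_right)
      qed
      ultimately show ?thesis by (simp add: distrib_right)
    qed
    have sx: "summable (\<lambda>j. power_ser (x j) \<zeta>)"
      by (rule summable_comparison_test'[OF x2]) (use power_ser_bound[OF x1] \<zeta> in simp)
    have sy: "summable (\<lambda>j. power_ser (y j) z)"
      by (rule summable_comparison_test'[OF y2]) (use power_ser_bound[OF y1] z in simp)
    have "power_ser b \<zeta> * power_ser p z = (\<Sum>j. power_ser b \<zeta> * (p j * z ^ j))"
      unfolding power_ser_def[of p]
      using z by (intro suminf_mult[symmetric] sums_summable[OF power_ser_sums[OF p]]) simp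
    also have "\<dots> = (\<Sum>j. power_ser (x j) \<zeta>) + (\<Sum>j. z * power_ser (y j) z)"
      unfolding term_eq by (intro suminf_add[symmetric] sx summable_mult sy)
    also have "(\<Sum>j. z * power_ser (y j) z) = z * (\<Sum>j. power_ser (y j) z)"
      by (rule suminf_mult[OF sy])
    also have "(\<Sum>j. power_ser (x j) \<zeta>) = power_ser r \<zeta>"
      unfolding r using \<zeta> by (intro wiener_suminf(2)[OF x1 x2, symmetric]) simp
    also have "(\<Sum>j. power_ser (y j) z) = power_ser s z"
      unfolding s_def[abs_def] by (rule wiener_suminf(2)[OF y1 y2 z_le, symmetric])
    finally show ?thesis .
  qed
  moreover have "summable (\<lambda>k. cmod (s k))"
    unfolding s_def by (rule wiener_suminf(1)[OF y1 y2])
  ultimately show "\<exists>s. summable (\<lambda>k. cmod (s k)) \<and> (\<forall>\<zeta> z. cmod \<zeta> = 1 \<longrightarrow> \<zeta> * z = 1 \<longrightarrow>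
      power_ser b \<zeta> * power_ser p z = power_ser r \<zeta> + z * power_ser s z)"
    by blast
qed

lemma phi_mu_eq_conv: "phi_mu n \<mu> \<phi> = conv \<phi> (w_coeff n \<mu>)"
proof
  fix i
  have "phi_mu n \<mu> \<phi> i = (\<Sum>j\<le>i. W_mat n \<mu> i j * \<phi> j)"
    unfolding phi_mu_def mat_vec_def by (intro suminf_finite) (auto simp: W_mat_def)
  also have "\<dots> = conv \<phi> (w_coeff n \<mu>) i"
    unfolding conv_def by (intro sum.cong) (auto simp: W_mat_def)
  finally show "phi_mu n \<mu> \<phi> i = conv \<phi> (w_coeff n \<mu>) i" .
qed

locale extrapolation =
  fixes n \<mu> :: nat and a :: "nat \<Rightarrow> complex"
  assumes mu: "\<mu> \<ge> 1"
    and Da_conv: "\<forall>k. summable (\<lambda>j. D_mat n \<mu> k j * a j)"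
    and Da_l1: "summable (\<lambda>k. cmod (b_coeff n \<mu> a k))"
begin

abbreviation b :: "nat \<Rightarrow> complex" where "b \<equiv> b_coeff n \<mu> a"

abbreviation K :: "real \<Rightarrow> complex" where "K \<equiv> incr_kernel n \<mu>"

text \<open>The rows of \<open>D\<close> are shifts of one another, so \<open>D A\<close> inherits
  the Hankel form of \<open>A\<close>.\<close>

lemma DA_hankel: "mat_mul (D_mat n \<mu>) (A_mat a) k j = b (k + j)"
proof -
  have shift: "D_mat n \<mu> (k + j) (l + j) = D_mat n \<mu> k l" for l
    by (auto simp: D_mat_def intro!: arg_cong[where f = "d_coeff n \<mu>"])
  have "b (k + j) = (\<Sum>l. D_mat n \<mu> (k + j) (l + j) * a (l + j)) + (\<Sum>l<j. D_mat n \<mu> (k + j) l * a l)"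
    unfolding b_coeff_def mat_vec_def using Da_conv by (intro suminf_split_initial_segment) auto
  also have "(\<Sum>l<j. D_mat n \<mu> (k + j) l * a l) = 0"
    by (intro sum.neutral) (auto simp: D_mat_def)
  finally show ?thesis
    by (simp add: mat_mul_def A_mat_def shift)
qed

lemma DAW_hankel: "DAW n \<mu> a \<phi> = (\<lambda>k. \<Sum>j. b (k + j) * phi_mu n \<mu> \<phi> j)"
  by (simp add: fun_eq_iff DAW_def mat_vec_def DA_hankel)

text \<open>The integrand, with respect to the spectral stochastic measure, of the estimation error
  for the characteristic \<open>h\<close>.\<close>

definition err :: "(real \<Rightarrow> complex) \<Rightarrow> real \<Rightarrow> complex" where
  "err h t = (power_ser b (cis t) - h t) * K t"

lemma AK_square_integrable:
  assumes "spectral_density f"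
  shows "square_integrable (spectral_measure f) (\<lambda>t. power_ser b (cis t) * K t)"
proof (rule L2_norm_bounded(1)[OF finite_spectral_measure[OF assms]])
  show "AE t in spectral_measure f. cmod (power_ser b (cis t) * K t) \<le> (\<Sum>k. cmod (b k)) * real \<mu> ^ n"
    unfolding norm_mult using suminf_nonneg[OF Da_l1]
    by (intro AE_I2 mult_mono power_ser_bound Da_l1 incr_kernel_bound) auto
qed (auto intro!: mult_nonneg_nonneg suminf_nonneg Da_l1)

lemma admissible_square_integrable:
  assumes "spectral_density f" "h \<in> admissible n \<mu> f"
  shows "square_integrable (spectral_measure f) (\<lambda>t. h t * K t)"
  using assms by (simp add: admissible_def L2_past_iff)

lemma err_square_integrable:
  assumes "spectral_density f" "h \<in> admissible n \<mu> f"
  shows "square_integrable (spectral_measure f) (err h)"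
  unfolding err_def[abs_def] left_diff_distrib
  by (intro square_integrable_diff AK_square_integrable admissible_square_integrable assms)

definition mse_freq :: "(real \<Rightarrow> complex) \<Rightarrow> (real \<Rightarrow> real) \<Rightarrow> real" where
  "mse_freq h f = (L2_norm (spectral_measure f) (err h))\<^sup>2"

text \<open>The kernel vanishes on a null set only, so the projection can be divided by it.\<close>

lemma optimal_exists:
  assumes f: "spectral_density f"
  obtains h where "h \<in> admissible n \<mu> f" "\<And>h'. h' \<in> admissible n \<mu> f \<Longrightarrow> mse_freq h f \<le> mse_freq h' f"
proof -
  let ?F = "spectral_measure f"
  obtain p where p: "p \<in> L2_past n \<mu> f"
    and best: "\<And>q. q \<in> L2_past n \<mu> f \<Longrightarrow> L2_norm ?F (\<lambda>t. power_ser b (cis t) * K t - p t)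
      \<le> L2_norm ?F (\<lambda>t. power_ser b (cis t) * K t - q t)"
    using best_past_approximation_exists[OF f AK_square_integrable[OF f]] by metis
  define h where "h t = p t / K t" for t
  have pm: "p \<in> borel_measurable freq" using p by (simp add: L2_past_def)
  have hm: "(\<lambda>t. h t * K t) \<in> borel_measurable freq"
    unfolding h_def using pm by measurable
  have eq: "AE t in freq. p t = h t * K t"
    using AE_generic[OF mu, of n] by eventually_elim (simp add: h_def)
  have adm: "h \<in> admissible n \<mu> f"
    unfolding admissible_def using L2_past_cong_AE[OF f p hm eq] by simp
  have "L2_norm ?F (err h) = L2_norm ?F (\<lambda>t. power_ser b (cis t) * K t - p t)"
  proof (rule L2_norm_cong_AE)
    show "err h \<in> borel_measurable ?F"
      using err_square_integrable[OF f adm] by (simp add: square_integrable_def)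
    show "(\<lambda>t. power_ser b (cis t) * K t - p t) \<in> borel_measurable ?F"
      using pm by simp
    show "AE t in ?F. err h t = power_ser b (cis t) * K t - p t"
      using AE_spectral_measure[OF f eq] by eventually_elim (simp add: err_def left_diff_distrib)
  qed
  moreover have "L2_norm ?F (\<lambda>t. power_ser b (cis t) * K t - p t) \<le> L2_norm ?F (err h')" if "h' \<in> admissible n \<mu> f" for h'
    using best[of "\<lambda>t. h' t * K t"] that by (simp add: admissible_def err_def[abs_def] left_diff_distrib)
  ultimately have "mse_freq h f \<le> mse_freq h' f" if "h' \<in> admissible n \<mu> f" for h'
    using that by (simp add: mse_freq_def power_mono)
  with adm show ?thesis by (rule that)
qed

end

locale canonical_extrapolation = extrapolation +
  fixes \<phi> :: "nat \<Rightarrow> complex"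
  assumes radius: "conv_radius \<phi> > 1" and nonzero: "\<And>z. cmod z \<le> 1 \<Longrightarrow> power_ser \<phi> z \<noteq> 0"
begin

abbreviation r :: "nat \<Rightarrow> complex" where "r \<equiv> DAW n \<mu> a \<phi>"

lemma phi_summable: "summable (\<lambda>k. cmod (\<phi> k))"
  by (rule abs_summable_of_conv_radius[OF radius])

lemma w_summable: "summable (\<lambda>k. cmod (w_coeff n \<mu> k))"
  using w_coeff_factorization[OF mu, of n] by metis

lemma phi_mu_summable: "summable (\<lambda>k. cmod (phi_mu n \<mu> \<phi> k))"
  unfolding phi_mu_eq_conv by (intro conv_abs_summable(1) phi_summable w_summable)

lemma power_ser_phi_mu:
  "cmod z \<le> 1 \<Longrightarrow> power_ser (phi_mu n \<mu> \<phi>) z = power_ser \<phi> z * power_ser (w_coeff n \<mu>) z"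
  unfolding phi_mu_eq_conv by (intro power_ser_conv phi_summable w_summable)

lemma r_summable: "summable (\<lambda>k. cmod (r k))"
  unfolding DAW_hankel by (rule hankel_toeplitz_split(1)[OF Da_l1 phi_mu_summable])

text \<open>On the circle \<open>w\<close> has the modulus of the kernel, so the kernel divided by
  \<open>\<Phi>\<^sub>\<mu>\<close> has modulus \<open>1 / |\<Phi>|\<close>. It is a quotient of the
  admissible form because \<open>\<Phi>\<close> and the zero-free factor of \<open>w\<close> are
  invertible in the Wiener algebra.\<close>

lemma phi_mu_boundary:
  obtains T where "wiener T"
    "AE t in freq. inverse (power_ser (phi_mu n \<mu> \<phi>) (cis (- t))) * K t = kernel_quotient n \<mu> T t"
    "AE t in freq. cmod (K t) = cmod (power_ser (w_coeff n \<mu>) (cis (- t)))"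
    "AE t in freq. power_ser (phi_mu n \<mu> \<phi>) (cis (- t)) \<noteq> 0"
proof -
  obtain E where E: "wiener E" "wiener (\<lambda>z. inverse (E z))" "\<And>z. E z \<noteq> 0"
    and w: "\<And>z. cmod z \<le> 1 \<Longrightarrow> power_ser (w_coeff n \<mu>) z = geom \<mu> z ^ n * E z"
    and E_norm: "\<And>t. -pi < t \<Longrightarrow> t < pi \<Longrightarrow> cmod (E (cis (- t))) = sinc_real t ^ n"
    using w_coeff_factorization[OF mu, of n] unfolding geom_def by metis
  have p: "power_ser (phi_mu n \<mu> \<phi>) (cis (- t)) = power_ser \<phi> (cis (- t)) * (geom \<mu> (cis (- t)) ^ n * E (cis (- t)))" for t
    by (simp add: power_ser_phi_mu w)
  show ?thesis
  proof (rule that)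
    show "wiener (\<lambda>z. inverse (E z) * inverse (power_ser \<phi> z))"
      by (intro wiener_mult E wiener_inverse_of_analytic radius nonzero)
    show "AE t in freq. inverse (power_ser (phi_mu n \<mu> \<phi>) (cis (- t))) * K t
        = kernel_quotient n \<mu> (\<lambda>z. inverse (E z) * inverse (power_ser \<phi> z)) t"
      by (rule AE_I2) (simp add: p kernel_quotient_def power_inverse)
    show "AE t in freq. cmod (K t) = cmod (power_ser (w_coeff n \<mu>) (cis (- t)))"
      using AE_generic[OF mu, of n]
      by eventually_elim (simp add: w E_norm norm_incr_kernel norm_mult norm_power)
    show "AE t in freq. power_ser (phi_mu n \<mu> \<phi>) (cis (- t)) \<noteq> 0"
      using AE_generic[OF mu, of n] by eventually_elim (simp add: p E(3) nonzero)
  qed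
qed

abbreviation h0 :: "real \<Rightarrow> complex" where "h0 \<equiv> h_char n \<mu> a \<phi>"

lemma err_h0: "err h0 t = r_fun n \<mu> a \<phi> t * inverse (power_ser (phi_mu n \<mu> \<phi>) (cis (- t))) * K t"
  by (simp add: err_def h_char_def)

lemma r_fun_measurable [measurable]: "r_fun n \<mu> a \<phi> \<in> borel_measurable freq"
  unfolding r_fun_def[abs_def] by measurable

lemma h0_measurable [measurable]: "h0 \<in> borel_measurable freq"
  unfolding h_char_def[abs_def] by measurable

text \<open>Multiplied by \<open>\<Phi>\<^sub>\<mu>\<close>, the characteristic becomes the part of
  \<open>A \<Phi>\<^sub>\<mu>\<close> with negative frequencies. This holds for every density
  \<open>f\<close>, also for those that are not factorized by \<open>\<phi>\<close>.\<close>

lemma h0_admissible: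
  assumes f: "spectral_density f"
  shows "h0 \<in> admissible n \<mu> f"
proof -
  obtain T where T: "wiener T"
    and T_eq: "AE t in freq. inverse (power_ser (phi_mu n \<mu> \<phi>) (cis (- t))) * K t = kernel_quotient n \<mu> T t"
    and nz: "AE t in freq. power_ser (phi_mu n \<mu> \<phi>) (cis (- t)) \<noteq> 0"
    by (rule phi_mu_boundary)
  obtain s where s: "summable (\<lambda>k. cmod (s k))"
    and split: "\<And>\<zeta> z. cmod \<zeta> = 1 \<Longrightarrow> \<zeta> * z = 1 \<Longrightarrow>
      power_ser b \<zeta> * power_ser (phi_mu n \<mu> \<phi>) z = power_ser r \<zeta> + z * power_ser s z"
    using hankel_toeplitz_split(2)[OF Da_l1 phi_mu_summable] unfolding DAW_hankel by blast
  have W: "wiener (\<lambda>z. power_ser s z * T z)"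
    by (intro wiener_mult wiener_power_ser s T)
  have "AE t in freq. cis (- t) * kernel_quotient n \<mu> (\<lambda>z. power_ser s z * T z) t = h0 t * K t"
    using T_eq nz
  proof eventually_elim
    case (elim t)
    let ?p = "power_ser (phi_mu n \<mu> \<phi>) (cis (- t))"
    have sp: "power_ser b (cis t) * ?p = power_ser r (cis t) + cis (- t) * power_ser s (cis (- t))"
      by (rule split) (auto simp: cis_mult)
    have "h0 t * K t = (power_ser b (cis t) * ?p - power_ser r (cis t)) * (inverse ?p * K t)"
      using elim(2) by (simp add: h_char_def r_fun_def field_simps)
    also have "\<dots> = cis (- t) * power_ser s (cis (- t)) * kernel_quotient n \<mu> T t"
      unfolding sp elim(1) by simp
    also have "\<dots> = cis (- t) * kernel_quotient n \<mu> (\<lambda>z. power_ser s z * T z) t"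
      by (simp add: kernel_quotient_def)
    finally show ?case ..
  qed
  then show ?thesis
    unfolding admissible_def
    using L2_past_cong_AE[OF f kernel_quotient_past[OF mu W f], of "\<lambda>t. h0 t * K t"] by simp
qed

lemma norm_err_h0: "AE t in freq. (cmod (err h0 t))\<^sup>2 = (cmod (r_fun n \<mu> a \<phi> t))\<^sup>2 / seq_density \<phi> t"
proof -
  obtain T where K: "AE t in freq. cmod (K t) = cmod (power_ser (w_coeff n \<mu>) (cis (- t)))"
    and nz: "AE t in freq. power_ser (phi_mu n \<mu> \<phi>) (cis (- t)) \<noteq> 0"
    by (rule phi_mu_boundary)
  show ?thesis
    using K nz
  proof eventually_elim
    case (elim t)
    let ?x = "cmod (power_ser \<phi> (cis (- t)))" and ?y = "cmod (power_ser (w_coeff n \<mu>) (cis (- t)))"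
    have p: "cmod (power_ser (phi_mu n \<mu> \<phi>) (cis (- t))) = ?x * ?y"
      by (simp add: power_ser_phi_mu norm_mult)
    have nz: "?x \<noteq> 0" "?y \<noteq> 0"
      using elim(2) p by auto
    have "cmod (err h0 t) = cmod (r_fun n \<mu> a \<phi> t) * inverse (?x * ?y) * ?y"
      unfolding err_h0 norm_mult norm_inverse p elim(1) ..
    also have "\<dots> = cmod (r_fun n \<mu> a \<phi> t) / ?x"
      using nz by (simp only: inverse_mult_distrib) (simp add: divide_inverse)
    finally show ?case
      by (simp add: seq_density_def power_divide)
  qed
qed

lemma seq_density_pos: "seq_density \<phi> t > 0"
  using nonzero[of "cis (- t)"] by (simp add: seq_density_def)

text \<open>Since \<open>f |K|\<^sup>2 = |\<Phi>\<^sub>\<mu>|\<^sup>2\<close>, the integrand reduces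
  to \<open>r\<close> times the conjugate of \<open>\<Phi>\<^sub>\<mu>\<close> times \<open>cis (k
  t)\<close>, which has positive frequencies only.\<close>

lemma err_h0_orthogonal:
  assumes f: "spectral_density f" and factor: "AE t in freq. f t = seq_density \<phi> t" and k: "k \<ge> 1"
  shows "(\<integral>t. err h0 t * cnj (cis (- real k * t) * K t) \<partial>spectral_measure f) = 0"
proof -
  let ?p = "phi_mu n \<mu> \<phi>"
  obtain T where K: "AE t in freq. cmod (K t) = cmod (power_ser (w_coeff n \<mu>) (cis (- t)))"
    and nz: "AE t in freq. power_ser ?p (cis (- t)) \<noteq> 0"
    by (rule phi_mu_boundary)
  let ?c = "conv r (\<lambda>j. cnj (?p j))"
  have cs: "summable (\<lambda>j. cmod (cnj (?p j)))" using phi_mu_summable by simp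
  have csum: "summable (\<lambda>j. cmod (?c j))"
    by (intro conv_abs_summable(1) r_summable cs)
  have cnj_p: "cnj (power_ser ?p (cis (- t))) = power_ser (\<lambda>j. cnj (?p j)) (cis t)" for t
  proof -
    have "(\<lambda>j. cnj (?p j * cis (- t) ^ j)) sums cnj (power_ser ?p (cis (- t)))"
      unfolding sums_cnj by (rule power_ser_sums[OF phi_mu_summable]) simp
    then show ?thesis by (simp add: power_ser_def sums_iff cis_cnj)
  qed
  have m: "(\<lambda>t. err h0 t * cnj (cis (- real k * t) * K t)) \<in> borel_measurable freq"
    unfolding err_h0[abs_def] by (intro borel_measurable_times borel_measurable_cnj) measurable
  have "(\<integral>t. err h0 t * cnj (cis (- real k * t) * K t) \<partial>spectral_measure f)
      = (\<integral>t. (f t / (2 * pi)) *\<^sub>R (err h0 t * cnj (cis (- real k * t) * K t)) \<partial>freq)"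
    by (rule integral_spectral_measure[OF f m])
  also have "\<dots> = (\<integral>t. (1 / (2 * pi)) *\<^sub>R (power_ser ?c (cis t) * cis (of_int (int k) * t)) \<partial>freq)"
  proof (rule integral_cong_AE)
    have fm: "f \<in> borel_measurable freq" by (rule spectral_densityD(2)[OF f])
    show "(\<lambda>t. (f t / (2 * pi)) *\<^sub>R (err h0 t * cnj (cis (- real k * t) * K t))) \<in> borel_measurable freq"
      using fm m by measurable
    show "AE t in freq. (f t / (2 * pi)) *\<^sub>R (err h0 t * cnj (cis (- real k * t) * K t))
        = (1 / (2 * pi)) *\<^sub>R (power_ser ?c (cis t) * cis (of_int (int k) * t))"
      using K nz factor
    proof eventually_elim
      case (elim t)
      let ?P = "power_ser ?p (cis (- t))"
      have "complex_of_real (f t) * (K t * cnj (K t)) = ?P * cnj ?P"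
      proof -
        have "complex_of_real (f t) * (K t * cnj (K t)) = complex_of_real (f t * (cmod (K t))\<^sup>2)"
          by (simp add: complex_norm_square[symmetric])
        also have "f t * (cmod (K t))\<^sup>2 = (cmod ?P)\<^sup>2"
          using elim(1,3) by (simp add: seq_density_def power_ser_phi_mu norm_mult power_mult_distrib)
        finally show ?thesis by (simp add: complex_norm_square del: of_real_power)
      qed
      then have "complex_of_real (f t) * (r_fun n \<mu> a \<phi> t * inverse ?P * K t * (cis (real k * t) * cnj (K t)))
        = r_fun n \<mu> a \<phi> t * inverse ?P * cis (real k * t) * (?P * cnj ?P)"
        by (simp add: mult_ac)
      also have "\<dots> = power_ser ?c (cis t) * cis (real k * t)"
        using elim(2) by (simp add: cnj_p r_fun_def power_ser_conv[OF r_summable cs])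
      finally show ?case
        by (simp add: err_h0 cis_cnj scaleR_conv_of_real)
    qed
  qed measurable
  also have "\<dots> = 0"
    using k integral_power_ser_cis[OF csum, of "int k"] by simp
  finally show ?thesis .
qed

end

section \<open>Mixtures of densities and saddle points\<close>

lemma AE_spectral_measureD:
  assumes f: "spectral_density f" and P: "AE t in spectral_measure f. P t" and pos: "AE t in freq. 0 < f t"
  shows "AE t in freq. P t"
proof -
  have m: "(\<lambda>t. ennreal (f t / (2 * pi))) \<in> borel_measurable freq"
    using spectral_densityD(2)[OF f] by simp
  have "AE t in freq. 0 < ennreal (f t / (2 * pi)) \<longrightarrow> P t"
    using P unfolding spectral_measure_def AE_density[OF m] .
  then show ?thesis
    using pos by eventually_elim simp
qed

lemma L2_pythagoras:
  assumes e: "square_integrable M e" and p: "square_integrable M p"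
    and orth: "(\<integral>x. e x * cnj (p x) \<partial>M) = 0"
  shows "(L2_norm M (\<lambda>x. e x + p x))\<^sup>2 = (L2_norm M e)\<^sup>2 + (L2_norm M p)\<^sup>2"
proof -
  have int: "integrable M (\<lambda>x. e x * cnj (p x))"
    by (intro square_integrable_prod square_integrable_cnj e p)
  have pw: "(cmod (x + y))\<^sup>2 = (cmod x)\<^sup>2 + (cmod y)\<^sup>2 + 2 * Re (x * cnj y)" for x y :: complex
    unfolding cmod_power2 by (simp add: power2_eq_square algebra_simps)
  have zero: "(\<integral>x. Re (e x * cnj (p x)) \<partial>M) = 0"
    unfolding integral_Re[OF int] orth by simp
  note ints = square_integrableD[OF e] square_integrableD[OF p] integrable_Re[OF int]
  have "(L2_norm M (\<lambda>x. e x + p x))\<^sup>2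
      = (\<integral>x. (cmod (e x))\<^sup>2 + (cmod (p x))\<^sup>2 \<partial>M) + (\<integral>x. 2 * Re (e x * cnj (p x)) \<partial>M)"
    unfolding L2_norm_square pw
    by (rule Bochner_Integration.integral_add[OF Bochner_Integration.integrable_add[OF ints(1,2)]
          integrable_mult_right[OF ints(3)]])
  also have "(\<integral>x. 2 * Re (e x * cnj (p x)) \<partial>M) = 0"
    unfolding integral_mult_right_zero zero by simp
  also have "(\<integral>x. (cmod (e x))\<^sup>2 + (cmod (p x))\<^sup>2 \<partial>M) = (L2_norm M e)\<^sup>2 + (L2_norm M p)\<^sup>2"
    unfolding L2_norm_square by (rule Bochner_Integration.integral_add[OF ints(1,2)])
  finally show ?thesis by simp
qed

lemma mixture_spectral_density:
  assumes "spectral_density f" "spectral_density g" "0 \<le> s" "s \<le> 1"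
  shows "spectral_density (\<lambda>t. (1 - s) * f t + s * g t)"
  using assms by (auto simp: spectral_density_def)

lemma mixture_L2:
  assumes f: "spectral_density f" and g: "spectral_density g" and s: "0 < s" "s < 1"
    and u: "square_integrable (spectral_measure (\<lambda>t. (1 - s) * f t + s * g t)) u"
  shows "square_integrable (spectral_measure f) u" "square_integrable (spectral_measure g) u"
    "(L2_norm (spectral_measure (\<lambda>t. (1 - s) * f t + s * g t)) u)\<^sup>2
      = (1 - s) * (L2_norm (spectral_measure f) u)\<^sup>2 + s * (L2_norm (spectral_measure g) u)\<^sup>2"
proof -
  let ?h = "\<lambda>t. (1 - s) * f t + s * g t"
  have h: "spectral_density ?h" using mixture_spectral_density[OF f g, of s] s by simp
  have um: "u \<in> borel_measurable freq" using u by (simp add: square_integrable_def)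
  then have m: "(\<lambda>t. (cmod (u t))\<^sup>2) \<in> borel_measurable freq" by measurable
  have fm: "f \<in> borel_measurable freq" "g \<in> borel_measurable freq"
    using spectral_densityD(2) f g by auto
  have int: "integrable freq (\<lambda>t. (?h t / (2 * pi)) *\<^sub>R (cmod (u t))\<^sup>2)"
    using square_integrableD[OF u] integrable_spectral_measure[OF h m] by simp
  have i1: "integrable freq (\<lambda>t. (f t / (2 * pi)) *\<^sub>R (cmod (u t))\<^sup>2)"
  proof (rule Bochner_Integration.integrable_bound[OF integrable_mult_right[OF int, of "1 / (1 - s)"]])
    show "(\<lambda>t. (f t / (2 * pi)) *\<^sub>R (cmod (u t))\<^sup>2) \<in> borel_measurable freq"
      using fm m by measurable
    show "AE t in freq. norm ((f t / (2 * pi)) *\<^sub>R (cmod (u t))\<^sup>2) \<le> norm (1 / (1 - s) * ((?h t / (2 * pi)) *\<^sub>R (cmod (u t))\<^sup>2))"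
    proof (rule AE_I2)
      fix t assume "t \<in> space freq"
      then have nn: "0 \<le> f t" "0 \<le> g t" using spectral_densityD(3) f g by auto
      have "f t \<le> 1 / (1 - s) * ?h t"
      proof -
        have "s * f t \<le> f t" using nn s by (intro mult_left_le_one_le) auto
        then have "0 \<le> s * g t" "s * f t \<le> f t" using nn s by auto
        then show ?thesis using s by (simp add: field_simps)
      qed
      then have "f t / (2 * pi) * (cmod (u t))\<^sup>2 \<le> (1 / (1 - s) * ?h t) / (2 * pi) * (cmod (u t))\<^sup>2"
        by (intro mult_right_mono divide_right_mono) auto
      then show "norm ((f t / (2 * pi)) *\<^sub>R (cmod (u t))\<^sup>2) \<le> norm (1 / (1 - s) * ((?h t / (2 * pi)) *\<^sub>R (cmod (u t))\<^sup>2))"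
        using nn s by (simp add: abs_mult)
    qed
  qed
  have i2: "integrable freq (\<lambda>t. (g t / (2 * pi)) *\<^sub>R (cmod (u t))\<^sup>2)"
  proof (rule Bochner_Integration.integrable_bound[OF integrable_mult_right[OF int, of "1 / s"]])
    show "(\<lambda>t. (g t / (2 * pi)) *\<^sub>R (cmod (u t))\<^sup>2) \<in> borel_measurable freq"
      using fm m by measurable
    show "AE t in freq. norm ((g t / (2 * pi)) *\<^sub>R (cmod (u t))\<^sup>2) \<le> norm (1 / s * ((?h t / (2 * pi)) *\<^sub>R (cmod (u t))\<^sup>2))"
    proof (rule AE_I2)
      fix t assume "t \<in> space freq"
      then have nn: "0 \<le> f t" "0 \<le> g t" using spectral_densityD(3) f g by auto
      have "g t \<le> 1 / s * ?h t"
      proof -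
        have "s * f t \<le> f t" using nn s by (intro mult_left_le_one_le) auto
        then show ?thesis using s by (simp add: field_simps)
      qed
      then have "g t / (2 * pi) * (cmod (u t))\<^sup>2 \<le> (1 / s * ?h t) / (2 * pi) * (cmod (u t))\<^sup>2"
        by (intro mult_right_mono divide_right_mono) auto
      then show "norm ((g t / (2 * pi)) *\<^sub>R (cmod (u t))\<^sup>2) \<le> norm (1 / s * ((?h t / (2 * pi)) *\<^sub>R (cmod (u t))\<^sup>2))"
        using nn s by (simp add: abs_mult)
    qed
  qed
  show "square_integrable (spectral_measure f) u"
    unfolding square_integrable_def using um i1 integrable_spectral_measure[OF f m] by simp
  show "square_integrable (spectral_measure g) u"
    unfolding square_integrable_def using um i2 integrable_spectral_measure[OF g m] by simp
  have "(\<integral>t. (?h t / (2 * pi)) *\<^sub>R (cmod (u t))\<^sup>2 \<partial>freq)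
      = (\<integral>t. (1 - s) * ((f t / (2 * pi)) *\<^sub>R (cmod (u t))\<^sup>2) + s * ((g t / (2 * pi)) *\<^sub>R (cmod (u t))\<^sup>2) \<partial>freq)"
    by (intro Bochner_Integration.integral_cong) (auto simp: field_simps)
  also have "\<dots> = (1 - s) * (\<integral>t. (f t / (2 * pi)) *\<^sub>R (cmod (u t))\<^sup>2 \<partial>freq) + s * (\<integral>t. (g t / (2 * pi)) *\<^sub>R (cmod (u t))\<^sup>2 \<partial>freq)"
    by (subst Bochner_Integration.integral_add[OF integrable_mult_right[OF i1] integrable_mult_right[OF i2]])
      (simp only: integral_mult_right_zero)
  finally show "(L2_norm (spectral_measure ?h) u)\<^sup>2
      = (1 - s) * (L2_norm (spectral_measure f) u)\<^sup>2 + s * (L2_norm (spectral_measure g) u)\<^sup>2"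
    unfolding L2_norm_square integral_spectral_measure[OF f m] integral_spectral_measure[OF g m]
      integral_spectral_measure[OF h m] .
qed

text \<open>The measure of the mixture dominates a multiple of the measure of
  \<open>f\<close>.\<close>

lemma mixture_admissible:
  assumes f: "spectral_density f" and g: "spectral_density g" and s: "0 < s" "s < 1"
    and h: "h \<in> admissible n \<mu> (\<lambda>t. (1 - s) * f t + s * g t)"
  shows "h \<in> admissible n \<mu> f"
proof -
  let ?m = "\<lambda>t. (1 - s) * f t + s * g t"
  let ?g = "\<lambda>t. h t * incr_kernel n \<mu> t"
  have m: "spectral_density ?m" using mixture_spectral_density[OF f g, of s] s by simp
  have past: "?g \<in> L2_past n \<mu> ?m" using h by (simp add: admissible_def)
  note past_iff = iffD1[OF L2_past_iff[OF m] past]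
  note sq = conjunct1[OF past_iff]
  have "\<exists>N c. L2_norm (spectral_measure f) (\<lambda>t. ?g t - past_sum n \<mu> N c t) < \<delta>" if \<delta>: "\<delta> > 0" for \<delta>
  proof -
    have "sqrt (1 - s) * \<delta> > 0" using \<delta> s by simp
    with conjunct2[OF past_iff] obtain N c where less: "L2_norm (spectral_measure ?m) (\<lambda>t. ?g t - past_sum n \<mu> N c t) < sqrt (1 - s) * \<delta>"
      by (elim allE[of _ "sqrt (1 - s) * \<delta>"] impE) (assumption, elim exE, rule that)
    let ?u = "\<lambda>t. ?g t - past_sum n \<mu> N c t"
    have u: "square_integrable (spectral_measure ?m) ?u"
      by (intro square_integrable_diff sq past_sum_square_integrable[OF m])
    have "(1 - s) * (L2_norm (spectral_measure f) ?u)\<^sup>2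
        \<le> (1 - s) * (L2_norm (spectral_measure f) ?u)\<^sup>2 + s * (L2_norm (spectral_measure g) ?u)\<^sup>2"
      using mult_nonneg_nonneg[OF less_imp_le[OF s(1)] zero_le_power2[of "L2_norm (spectral_measure g) ?u"]]
      by linarith
    also have "\<dots> = (L2_norm (spectral_measure ?m) ?u)\<^sup>2"
      by (rule mixture_L2(3)[OF f g s u, symmetric])
    also have "\<dots> < (sqrt (1 - s) * \<delta>)\<^sup>2"
      by (rule power_strict_mono[OF less L2_norm_nonneg]) simp
    also have "\<dots> = (1 - s) * \<delta>\<^sup>2"
      using s by (simp add: power_mult_distrib)
    finally have "(L2_norm (spectral_measure f) ?u)\<^sup>2 < \<delta>\<^sup>2"
      using s(2) by (simp only: mult_less_cancel_left_pos diff_gt_0_iff_gt)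
    then have "L2_norm (spectral_measure f) ?u < \<delta>"
      by (rule power2_less_imp_less) (rule less_imp_le[OF \<delta>])
    then show ?thesis by blast
  qed
  then have "?g \<in> L2_past n \<mu> f"
    unfolding L2_past_iff[OF f] using mixture_L2(1)[OF f g s sq] by (intro conjI allI impI)
  then show ?thesis
    by (simp add: admissible_def)
qed

lemma mixture_D_eps:
  assumes v: "spectral_density v" and f: "f \<in> D_eps v \<epsilon>" and g: "g \<in> D_eps v \<epsilon>" and s: "0 < s" "s < 1"
  shows "(\<lambda>t. (1 - s) * f t + s * g t) \<in> D_eps v \<epsilon>"
proof -
  let ?m = "\<lambda>t. (1 - s) * f t + s * g t"
  have fd: "spectral_density f" and gd: "spectral_density g"
    and fe: "1 / (2 * pi) * (\<integral>t. \<bar>f t - v t\<bar> \<partial>freq) \<le> \<epsilon>" and ge: "1 / (2 * pi) * (\<integral>t. \<bar>g t - v t\<bar> \<partial>freq) \<le> \<epsilon>"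
    using f g by (auto simp: D_eps_def)
  have int: "integrable freq (\<lambda>t. \<bar>f t - v t\<bar>)" "integrable freq (\<lambda>t. \<bar>g t - v t\<bar>)" "integrable freq (\<lambda>t. \<bar>?m t - v t\<bar>)"
    using spectral_densityD(1)[OF v] spectral_densityD(1)[OF fd] spectral_densityD(1)[OF gd] by auto
  have "(\<integral>t. \<bar>?m t - v t\<bar> \<partial>freq) \<le> (\<integral>t. (1 - s) * \<bar>f t - v t\<bar> + s * \<bar>g t - v t\<bar> \<partial>freq)"
  proof (rule integral_mono[OF int(3)])
    show "integrable freq (\<lambda>t. (1 - s) * \<bar>f t - v t\<bar> + s * \<bar>g t - v t\<bar>)" using int by simp
    fix t
    have "?m t - v t = (1 - s) * (f t - v t) + s * (g t - v t)" by (simp add: algebra_simps)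
    also have "\<bar>\<dots>\<bar> \<le> \<bar>(1 - s) * (f t - v t)\<bar> + \<bar>s * (g t - v t)\<bar>" by (rule abs_triangle_ineq)
    finally show "\<bar>?m t - v t\<bar> \<le> (1 - s) * \<bar>f t - v t\<bar> + s * \<bar>g t - v t\<bar>"
      using s by (simp add: abs_mult)
  qed
  also have "\<dots> = (1 - s) * (\<integral>t. \<bar>f t - v t\<bar> \<partial>freq) + s * (\<integral>t. \<bar>g t - v t\<bar> \<partial>freq)"
    using int by simp
  finally have "1 / (2 * pi) * (\<integral>t. \<bar>?m t - v t\<bar> \<partial>freq)
      \<le> 1 / (2 * pi) * ((1 - s) * (\<integral>t. \<bar>f t - v t\<bar> \<partial>freq) + s * (\<integral>t. \<bar>g t - v t\<bar> \<partial>freq))"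
    by (intro mult_left_mono) auto
  also have "\<dots> = (1 - s) * (1 / (2 * pi) * (\<integral>t. \<bar>f t - v t\<bar> \<partial>freq)) + s * (1 / (2 * pi) * (\<integral>t. \<bar>g t - v t\<bar> \<partial>freq))"
    by (simp only: distrib_left mult.left_commute)
  also have "\<dots> \<le> (1 - s) * \<epsilon> + s * \<epsilon>"
    using s fe ge by (intro add_mono mult_left_mono) auto
  also have "\<dots> = \<epsilon>"
    by (simp add: algebra_simps)
  finally show ?thesis
    unfolding D_eps_def using mixture_spectral_density[OF fd gd less_imp_le[OF s(1)] less_imp_le[OF s(2)]]
    by (intro CollectI conjI)
qed

context canonical_extrapolation
begin

lemma seq_density_conj: "seq_density \<phi> t = (cmod (power_ser (\<lambda>k. cnj (\<phi> k)) (cis t)))\<^sup>2"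
proof -
  have "(\<lambda>k. cnj (\<phi> k * cis (- t) ^ k)) sums cnj (power_ser \<phi> (cis (- t)))"
    unfolding sums_cnj by (rule power_ser_sums[OF phi_summable]) simp
  then have "power_ser (\<lambda>k. cnj (\<phi> k)) (cis t) = cnj (power_ser \<phi> (cis (- t)))"
    by (simp add: power_ser_def sums_iff cis_cnj)
  then show ?thesis by (simp add: seq_density_def)
qed

lemma integral_seq_density: "(\<integral>t. seq_density \<phi> t \<partial>freq) = 2 * pi * l2_sq \<phi>"
  using Parseval_power_ser[of "\<lambda>k. cnj (\<phi> k)"] phi_summable
  by (simp add: seq_density_conj l2_sq_def)

lemma seq_density_spectral: "spectral_density (seq_density \<phi>)"
proof -
  have "integrable freq (seq_density \<phi>)"
  proof (rule integrable_freq_bounded)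
    show "seq_density \<phi> \<in> borel_measurable freq"
      unfolding seq_density_def[abs_def] by measurable
    show "norm (seq_density \<phi> t) \<le> (\<Sum>k. cmod (\<phi> k))\<^sup>2" for t
      unfolding seq_density_def using power_ser_bound[OF phi_summable, of "cis (- t)"]
      by (simp add: power_mono)
  qed
  then show ?thesis
    by (simp add: spectral_density_def seq_density_def)
qed

text \<open>As a function of the density, the error of a fixed characteristic is linear, here with
  weight \<open>|r|\<^sup>2 / |\<Phi>|\<^sup>2\<close>.\<close>

lemma mse_freq_h0:
  assumes f: "spectral_density f"
  shows "integrable freq (\<lambda>t. (cmod (r_fun n \<mu> a \<phi> t))\<^sup>2 / seq_density \<phi> t * f t)"
    "2 * pi * mse_freq h0 f = (\<integral>t. (cmod (r_fun n \<mu> a \<phi> t))\<^sup>2 / seq_density \<phi> t * f t \<partial>freq)"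
proof -
  have sq: "square_integrable (spectral_measure f) (err h0)"
    by (rule err_square_integrable[OF f h0_admissible[OF f]])
  have [measurable]: "err h0 \<in> borel_measurable freq"
    using sq by (simp add: square_integrable_def)
  have m: "(\<lambda>t. (cmod (err h0 t))\<^sup>2) \<in> borel_measurable freq"
    by measurable
  have fm: "f \<in> borel_measurable freq" using spectral_densityD(2)[OF f] .
  have sm: "seq_density \<phi> \<in> borel_measurable freq" by (rule spectral_densityD(2)[OF seq_density_spectral])
  have eq: "AE t in freq. 2 * pi * ((f t / (2 * pi)) *\<^sub>R (cmod (err h0 t))\<^sup>2)
      = (cmod (r_fun n \<mu> a \<phi> t))\<^sup>2 / seq_density \<phi> t * f t"
    using norm_err_h0 by eventually_elim simp
  have int: "integrable freq (\<lambda>t. 2 * pi * ((f t / (2 * pi)) *\<^sub>R (cmod (err h0 t))\<^sup>2))"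
    using square_integrableD[OF sq] integrable_spectral_measure[OF f m] by (intro integrable_mult_right) simp
  have m2: "(\<lambda>t. (cmod (r_fun n \<mu> a \<phi> t))\<^sup>2 / seq_density \<phi> t * f t) \<in> borel_measurable freq"
    using fm sm by measurable
  show "integrable freq (\<lambda>t. (cmod (r_fun n \<mu> a \<phi> t))\<^sup>2 / seq_density \<phi> t * f t)"
    using int integrable_cong_AE[OF borel_measurable_integrable[OF int] m2 eq] by simp
  have "2 * pi * mse_freq h0 f = (\<integral>t. 2 * pi * ((f t / (2 * pi)) *\<^sub>R (cmod (err h0 t))\<^sup>2) \<partial>freq)"
    unfolding mse_freq_def L2_norm_square integral_spectral_measure[OF f m] by (simp only: integral_mult_right_zero)
  also have "\<dots> = (\<integral>t. (cmod (r_fun n \<mu> a \<phi> t))\<^sup>2 / seq_density \<phi> t * f t \<partial>freq)"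
    by (rule integral_cong_AE[OF borel_measurable_integrable[OF int] m2 eq])
  finally show "2 * pi * mse_freq h0 f = (\<integral>t. (cmod (r_fun n \<mu> a \<phi> t))\<^sup>2 / seq_density \<phi> t * f t \<partial>freq)" .
qed

lemma mse_freq_own:
  assumes f: "spectral_density f" and factor: "AE t in freq. f t = seq_density \<phi> t"
  shows "mse_freq h0 f = l2_sq r"
proof -
  have "2 * pi * mse_freq h0 f = (\<integral>t. (cmod (power_ser r (cis t)))\<^sup>2 \<partial>freq)"
    unfolding mse_freq_h0(2)[OF f]
  proof (rule integral_cong_AE)
    show "(\<lambda>t. (cmod (r_fun n \<mu> a \<phi> t))\<^sup>2 / seq_density \<phi> t * f t) \<in> borel_measurable freq"
      using mse_freq_h0(1)[OF f] by simp
    show "AE t in freq. (cmod (r_fun n \<mu> a \<phi> t))\<^sup>2 / seq_density \<phi> t * f t = (cmod (power_ser r (cis t)))\<^sup>2"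
      using factor by eventually_elim (use seq_density_pos in \<open>simp add: r_fun_def less_imp_neq[symmetric]\<close>)
  qed measurable
  then show ?thesis
    using Parseval_power_ser[OF r_summable] by simp
qed

text \<open>The error of \<open>h0\<close> is orthogonal to the finite combinations of the past, and
  \<open>(h0 - h) K\<close> is a limit of such combinations.\<close>

lemma mse_freq_pythagoras:
  assumes f: "spectral_density f" and factor: "AE t in freq. f t = seq_density \<phi> t"
    and h: "h \<in> admissible n \<mu> f"
  shows "mse_freq h f = mse_freq h0 f + (L2_norm (spectral_measure f) (\<lambda>t. (h0 t - h t) * K t))\<^sup>2"
proof -
  let ?F = "spectral_measure f" and ?g = "\<lambda>t. (h0 t - h t) * K t"
  have e: "square_integrable ?F (err h0)"
    by (rule err_square_integrable[OF f h0_admissible[OF f]])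
  have past: "?g \<in> L2_past n \<mu> f"
    unfolding left_diff_distrib
    by (rule L2_past_diff[OF f]) (use h0_admissible[OF f] h in \<open>simp_all add: admissible_def\<close>)
  then have g: "square_integrable ?F ?g" using L2_past_iff[OF f] by blast
  have orth: "(\<integral>t. err h0 t * cnj (past_sum n \<mu> N c t) \<partial>?F) = 0" for N c
  proof -
    have t: "square_integrable ?F (\<lambda>t. cis (- real k * t) * K t)" for k
      using kernel_term_square_integrable[OF f, of "\<lambda>t. cis (- real k * t)" 1] by simp
    have i: "integrable ?F (\<lambda>t. err h0 t * cnj (cis (- real k * t) * K t))" for k
      by (intro square_integrable_prod square_integrable_cnj e t)
    have "(\<integral>t. err h0 t * cnj (past_sum n \<mu> N c t) \<partial>?F)
        = (\<integral>t. (\<Sum>k=1..N. cnj (c k) * (err h0 t * cnj (cis (- real k * t) * K t))) \<partial>?F)"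
      by (intro Bochner_Integration.integral_cong) (auto simp: past_sum_def sum_distrib_left mult_ac)
    also have "\<dots> = (\<Sum>k=1..N. \<integral>t. cnj (c k) * (err h0 t * cnj (cis (- real k * t) * K t)) \<partial>?F)"
      by (intro Bochner_Integration.integral_sum integrable_mult_right i)
    also have "\<dots> = 0"
    proof (intro sum.neutral ballI)
      fix k assume "k \<in> {1..N}"
      then have k: "k \<ge> 1" by simp
      show "(\<integral>t. cnj (c k) * (err h0 t * cnj (cis (- real k * t) * K t)) \<partial>?F) = 0"
        unfolding integral_mult_right_zero err_h0_orthogonal[OF f factor k] by simp
    qed
    finally show ?thesis .
  qed
  have "\<exists>N c. L2_norm ?F (\<lambda>t. ?g t - past_sum n \<mu> N c t) < 1 / real (Suc i)" for i
  proof -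
    have "1 / real (Suc i) > 0" by simp
    then show ?thesis
      using past unfolding L2_past_iff[OF f] by blast
  qed
  then obtain N c where Nc: "\<And>i. L2_norm ?F (\<lambda>t. ?g t - past_sum n \<mu> (N i) (c i) t) < 1 / real (Suc i)"
    by metis
  let ?p = "\<lambda>i. past_sum n \<mu> (N i) (c i)"
  have p: "square_integrable ?F (?p i)" for i by (rule past_sum_square_integrable[OF f])
  have lim: "(\<lambda>i. L2_norm ?F (\<lambda>t. ?p i t - ?g t)) \<longlonglongrightarrow> 0"
  proof (rule Lim_null_comparison[OF _ LIMSEQ_Suc[OF lim_1_over_n]])
    show "\<forall>\<^sub>F i in sequentially. norm (L2_norm ?F (\<lambda>t. ?p i t - ?g t)) \<le> 1 / real (Suc i)"
      using Nc by (intro always_eventually allI) (simp add: L2_norm_commute[of ?F _ ?g] less_imp_le)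
  qed
  have lim': "(\<lambda>i. L2_norm ?F (\<lambda>t. (err h0 t + ?p i t) - (err h0 t + ?g t))) \<longlonglongrightarrow> 0"
    using lim by simp
  have "(\<lambda>i. (L2_norm ?F (\<lambda>t. err h0 t + ?p i t))\<^sup>2) \<longlonglongrightarrow> (L2_norm ?F (\<lambda>t. err h0 t + ?g t))\<^sup>2"
    by (intro tendsto_power L2_norm_tendsto[OF _ _ lim'] square_integrable_add e p g)
  moreover have "(\<lambda>i. (L2_norm ?F (err h0))\<^sup>2 + (L2_norm ?F (?p i))\<^sup>2) \<longlonglongrightarrow> (L2_norm ?F (err h0))\<^sup>2 + (L2_norm ?F ?g)\<^sup>2"
    by (intro tendsto_intros L2_norm_tendsto[OF _ _ lim] p g)
  ultimately have "(L2_norm ?F (\<lambda>t. err h0 t + ?g t))\<^sup>2 = (L2_norm ?F (err h0))\<^sup>2 + (L2_norm ?F ?g)\<^sup>2"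
    unfolding L2_pythagoras[OF e p orth] by (rule LIMSEQ_unique)
  moreover have "err h = (\<lambda>t. err h0 t + ?g t)"
    by (auto simp: err_def algebra_simps)
  ultimately show ?thesis
    by (simp add: mse_freq_def)
qed

text \<open>The error of \<open>h0\<close> is proportional to the integral of \<open>f\<close> with
  the weight \<open>g = |r|\<^sup>2 / |\<Phi>|\<^sup>2 \<le> C\<close>. In the ball around
  \<open>v\<close> such an integral is largest if the whole surplus over \<open>v\<close> sits where
  \<open>g\<close> equals \<open>C\<close>, and this is the case for \<open>f0\<close>.\<close>

lemma Lagrange_saddle:
  assumes v: "spectral_density v" and f0: "spectral_density f0" and f: "f \<in> D_eps v \<epsilon>"
    and factor: "AE t in freq. f0 t = seq_density \<phi> t"
    and mass: "(\<integral>t. f0 t \<partial>freq) = 2 * pi * \<epsilon> + (\<integral>t. v t \<partial>freq)"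
    and above: "AE t in freq. v t \<le> f0 t"
    and C: "AE t in freq. (cmod (r_fun n \<mu> a \<phi> t))\<^sup>2 \<le> C * seq_density \<phi> t"
    and tight: "AE t in freq. v t < f0 t \<longrightarrow> (cmod (r_fun n \<mu> a \<phi> t))\<^sup>2 = C * seq_density \<phi> t"
    and C0: "C \<ge> 0"
  shows "mse_freq h0 f \<le> mse_freq h0 f0"
proof -
  have fd: "spectral_density f" and dist: "1 / (2 * pi) * (\<integral>t. \<bar>f t - v t\<bar> \<partial>freq) \<le> \<epsilon>"
    using f by (auto simp: D_eps_def)
  let ?g = "\<lambda>t. (cmod (r_fun n \<mu> a \<phi> t))\<^sup>2 / seq_density \<phi> t"
  have int: "integrable freq (\<lambda>t. ?g t * f t)" "integrable freq (\<lambda>t. ?g t * f0 t)"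
    by (rule mse_freq_h0(1)[OF fd], rule mse_freq_h0(1)[OF f0])
  note ints = spectral_densityD(1)[OF v] spectral_densityD(1)[OF fd] spectral_densityD(1)[OF f0]
  have "(\<integral>t. ?g t * f t \<partial>freq) - (\<integral>t. ?g t * f0 t \<partial>freq) = (\<integral>t. ?g t * f t - ?g t * f0 t \<partial>freq)"
    using int by simp
  also have "\<dots> \<le> (\<integral>t. C * \<bar>f t - v t\<bar> - C * (f0 t - v t) \<partial>freq)"
  proof (rule integral_mono_AE)
    show "AE t in freq. ?g t * f t - ?g t * f0 t \<le> C * \<bar>f t - v t\<bar> - C * (f0 t - v t)"
      using above C tight
    proof eventually_elim
      case (elim t)
      have g: "0 \<le> ?g t" "?g t \<le> C"
        using elim(2) seq_density_pos[of t] by (auto simp: divide_le_eq)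
      have "?g t * (f0 t - v t) = C * (f0 t - v t)"
        using elim(1,3) seq_density_pos[of t] by (cases "v t < f0 t") auto
      moreover have "?g t * (f t - v t) \<le> C * \<bar>f t - v t\<bar>"
      proof -
        have "?g t * (f t - v t) \<le> ?g t * \<bar>f t - v t\<bar>"
          by (rule mult_left_mono[OF abs_ge_self g(1)])
        also have "\<dots> \<le> C * \<bar>f t - v t\<bar>"
          by (rule mult_right_mono[OF g(2) abs_ge_zero])
        finally show ?thesis .
      qed
      moreover have "?g t * f t - ?g t * f0 t = ?g t * (f t - v t) - ?g t * (f0 t - v t)"
        by (simp only: right_diff_distrib)
      ultimately show ?case
        by linarith
    qed
  qed (use int ints in auto)
  also have "\<dots> = C * (\<integral>t. \<bar>f t - v t\<bar> \<partial>freq) - C * ((\<integral>t. f0 t \<partial>freq) - (\<integral>t. v t \<partial>freq))"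
    using ints by simp
  also have "\<dots> = C * ((\<integral>t. \<bar>f t - v t\<bar> \<partial>freq) - 2 * pi * \<epsilon>)"
    unfolding mass by (simp add: algebra_simps)
  also have "\<dots> \<le> 0"
    using dist C0 by (intro mult_nonneg_nonpos) (auto simp: field_simps)
  finally have "2 * pi * mse_freq h0 f \<le> 2 * pi * mse_freq h0 f0"
    unfolding mse_freq_h0(2)[OF fd] mse_freq_h0(2)[OF f0] by simp
  then show ?thesis by simp
qed

text \<open>The minimal error is a concave function of the density. Along the segment from
  \<open>f0\<close> to \<open>f\<close> maximality of \<open>f0\<close> gives two things for the
  optimal characteristic \<open>h i\<close> of the mixture with weight \<open>s i\<close>: its error
  under \<open>f\<close> is at most the maximum, and its distance from \<open>h0\<close> under
  \<open>f0\<close> is of order \<open>sqrt (s i)\<close>. As the weights are summable, \<open>h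
  i\<close> tends to \<open>h0\<close> almost everywhere, because \<open>f0\<close> is positive, and
  Fatou's lemma yields the bound for \<open>h0\<close>.\<close>

lemma saddle_of_least_favorable:
  assumes v: "spectral_density v" and f0: "f0 \<in> D_eps v \<epsilon>" and f: "f \<in> D_eps v \<epsilon>"
    and factor: "AE t in freq. f0 t = seq_density \<phi> t"
    and least: "\<And>g. g \<in> D_eps v \<epsilon> \<Longrightarrow> \<exists>h\<in>admissible n \<mu> g. mse_freq h g \<le> mse_freq h0 f0"
  shows "mse_freq h0 f \<le> mse_freq h0 f0"
proof -
  let ?V = "mse_freq h0 f0"
  have f0d: "spectral_density f0" and fd: "spectral_density f"
    using f0 f by (auto simp: D_eps_def)
  \<comment> \<open>Summable weights in \<open>(0, 1/2]\<close>.\<close>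
  define s :: "nat \<Rightarrow> real" where "s i = (1/2) ^ Suc i" for i
  have s: "0 < s i" "s i < 1" "s i \<le> 1/2" for i
  proof -
    show "0 < s i" by (simp add: s_def)
    show "s i \<le> 1/2" using power_le_one[of "1/2 :: real" i] by (simp add: s_def)
    then show "s i < 1" by simp
  qed
  let ?m = "\<lambda>i t. (1 - s i) * f0 t + s i * f t"
  have "\<exists>h\<in>admissible n \<mu> (?m i). mse_freq h (?m i) \<le> ?V" for i
    by (rule least[OF mixture_D_eps[OF v f0 f s(1,2)]])
  then obtain h where h: "\<And>i. h i \<in> admissible n \<mu> (?m i)" "\<And>i. mse_freq (h i) (?m i) \<le> ?V"
    by metis
  have md: "spectral_density (?m i)" for i
    using mixture_spectral_density[OF f0d fd, of "s i"] s[of i] by simp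
  have sq: "square_integrable (spectral_measure (?m i)) (err (h i))" for i
    by (rule err_square_integrable[OF md h(1)])
  have adm0: "h i \<in> admissible n \<mu> f0" for i
    by (rule mixture_admissible[OF f0d fd s(1,2) h(1)])
  let ?d = "\<lambda>i t. (h0 t - h i t) * K t"
  \<comment> \<open>The error under the mixture, with the Pythagorean identity applied to the part
    under \<open>f0\<close>.\<close>
  have split: "(1 - s i) * (?V + (L2_norm (spectral_measure f0) (?d i))\<^sup>2) + s i * mse_freq (h i) f \<le> ?V" for i
    using h(2)[of i] unfolding mse_freq_pythagoras[OF f0d factor adm0, symmetric]
    unfolding mse_freq_def mixture_L2(3)[OF f0d fd s(1,2) sq] .
  have V0: "0 \<le> ?V" by (simp add: mse_freq_def)
  have bound: "mse_freq (h i) f \<le> ?V" "(L2_norm (spectral_measure f0) (?d i))\<^sup>2 \<le> 2 * s i * ?V" for i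
  proof -
    let ?D = "(L2_norm (spectral_measure f0) (?d i))\<^sup>2" and ?J = "mse_freq (h i) f"
    have D0: "0 \<le> ?D" "0 \<le> ?J" by (auto simp: mse_freq_def)
    have "(1 - s i) * ?D + s i * ?J \<le> s i * ?V"
      using split[of i] by (simp add: algebra_simps)
    moreover have "0 \<le> (1 - s i) * ?D" using s(2)[of i] D0 by simp
    moreover have "0 \<le> s i * ?J" using s(1)[of i] D0 by simp
    moreover have "(1/2) * ?D \<le> (1 - s i) * ?D" using s(3)[of i] D0 by (intro mult_right_mono) auto
    ultimately have 1: "s i * ?J \<le> s i * ?V" and 2: "(1/2) * ?D \<le> s i * ?V" by linarith+
    show "?J \<le> ?V" using 1 s(1)[of i] by simp
    show "?D \<le> 2 * s i * ?V" using 2 by simp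
  qed
  have "AE t in spectral_measure f0. (\<lambda>i. ?d i t) \<longlonglongrightarrow> 0"
  proof (rule AE_tendsto_0_of_summable_L2)
    show "square_integrable (spectral_measure f0) (?d i)" for i
      unfolding left_diff_distrib
      by (intro square_integrable_diff admissible_square_integrable[OF f0d] h0_admissible[OF f0d] adm0)
    show "summable (\<lambda>i. (L2_norm (spectral_measure f0) (?d i))\<^sup>2)"
    proof (rule summable_comparison_test')
      show "summable (\<lambda>i. 2 * s i * ?V)"
        unfolding s_def power_Suc by (intro summable_mult summable_mult2 summable_geometric) simp
      show "norm ((L2_norm (spectral_measure f0) (?d i))\<^sup>2) \<le> 2 * s i * ?V" for i
        using bound(2)[of i] by simp
    qed
  qed
  moreover have "AE t in freq. 0 < f0 t"
    using factor by eventually_elim (simp add: seq_density_pos)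
  ultimately have "AE t in freq. (\<lambda>i. ?d i t) \<longlonglongrightarrow> 0"
    by (rule AE_spectral_measureD[OF f0d])
  then have lim: "AE t in freq. (\<lambda>i. err (h i) t) \<longlonglongrightarrow> err h0 t"
  proof eventually_elim
    case (elim t)
    then have "(\<lambda>i. err h0 t + ?d i t) \<longlonglongrightarrow> err h0 t + 0"
      by (intro tendsto_intros)
    moreover have "err h0 t + ?d i t = err (h i) t" for i
      by (simp add: err_def algebra_simps)
    ultimately show ?case by simp
  qed
  have "square_integrable (spectral_measure f) (err h0) \<and> L2_norm (spectral_measure f) (err h0) \<le> sqrt ?V"
  proof (rule L2_Fatou)
    show "square_integrable (spectral_measure f) (err (h i))" for i
      by (rule mixture_L2(2)[OF f0d fd s(1,2) sq])
    show "err h0 \<in> borel_measurable (spectral_measure f)"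
      using err_square_integrable[OF fd h0_admissible[OF fd]] by (simp add: square_integrable_def)
    show "AE t in spectral_measure f. (\<lambda>i. err (h i) t) \<longlonglongrightarrow> err h0 t"
      by (rule AE_spectral_measure[OF fd lim])
    show "\<forall>\<^sub>F i in sequentially. L2_norm (spectral_measure f) (err (h i)) \<le> sqrt ?V"
      using bound(1) by (intro always_eventually allI real_le_rsqrt) (simp add: mse_freq_def)
  qed
  then have "(L2_norm (spectral_measure f) (err h0))\<^sup>2 \<le> (sqrt ?V)\<^sup>2"
    by (intro power_mono) auto
  then show ?thesis
    using V0 by (simp add: mse_freq_def)
qed

end

section \<open>Increments with a spectral density\<close>

locale increment_spectral = extrapolation +
  fixes M :: "'w measure" and \<xi> :: "int \<Rightarrow> 'w \<Rightarrow> complex" and Z :: "real set \<Rightarrow> 'w \<Rightarrow> complex" and f :: "real \<Rightarrow> real"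
  assumes density: "spectral_density f"
    and stationary: "stationary_increments M n \<xi>"
    and zero_mean: "zero_mean_increments M n \<xi>"
    and spectral: "has_spectral_density M n \<xi> Z f"
begin

sublocale stochastic_measure M Z f
  using density spectral by unfold_locales (auto simp: has_spectral_density_def)

sublocale prob_space M
  using stationary by (simp add: stationary_increments_def)

abbreviation X :: "int \<Rightarrow> 'w \<Rightarrow> complex" where "X \<equiv> incr n \<xi> (int \<mu>)"

lemma X_integral: "has_stoch_integral M Z f (\<lambda>t. cis (t * real_of_int m) * K t) (X m)"
  using spectral mu by (simp add: has_spectral_density_def)

lemma X_square_integrable: "square_integrable M (X m)"
  by (rule has_stoch_integralD(2)[OF X_integral])

lemma X_norm: "(L2_norm M (X m))\<^sup>2 \<le> (real \<mu> ^ n * sqrt (measure F (space F)))\<^sup>2"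
proof -
  have "L2_norm F (\<lambda>t. cis (t * real_of_int m) * K t) \<le> real \<mu> ^ n * sqrt (measure F (space F))"
  proof (rule L2_norm_bounded(2)[OF F.finite_measure_axioms])
    show "AE t in F. cmod (cis (t * real_of_int m) * K t) \<le> real \<mu> ^ n"
      by (rule AE_I2) (simp add: norm_mult incr_kernel_bound)
  qed auto
  then show ?thesis
    unfolding stoch_integral_isometry[OF X_integral] by (intro power_mono) auto
qed

lemma X_integrable: "integrable M (X m)"
  using square_integrable_prod[OF X_square_integrable[of m], of "\<lambda>_. 1"]
  by (simp add: square_integrable_def)

lemma X_mean: "(\<integral>\<omega>. X m \<omega> \<partial>M) = 0"
  using zero_mean by (simp add: zero_mean_increments_def)

text \<open>The second moments of the increments are bounded and the coefficients are summable, so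
  the series converges absolutely almost surely.\<close>

lemma B_converges: "AE \<omega> in M. summable (\<lambda>k. b k * X (int k) \<omega>)"
proof -
  let ?C = "(real \<mu> ^ n * sqrt (measure F (space F)))\<^sup>2"
  let ?h = "\<lambda>k \<omega>. cmod (b k) * (1 + (cmod (X (int k) \<omega>))\<^sup>2)"
  have int: "integrable M (?h k)" for k
    using square_integrableD[OF X_square_integrable[of "int k"]] by auto
  have "AE \<omega> in M. summable (\<lambda>k. ?h k \<omega>)"
  proof (rule AE_summable_of_summable_integral[OF int])
    show "summable (\<lambda>k. \<integral>\<omega>. ?h k \<omega> \<partial>M)"
    proof (rule summable_comparison_test'[OF summable_mult2[OF Da_l1, of "1 + ?C"]])
      fix k
      have val: "(\<integral>\<omega>. ?h k \<omega> \<partial>M) = cmod (b k) * (1 + (L2_norm M (X (int k)))\<^sup>2)"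
        using square_integrableD[OF X_square_integrable[of "int k"]] by (simp add: L2_norm_square prob_space)
      show "norm (\<integral>\<omega>. ?h k \<omega> \<partial>M) \<le> cmod (b k) * (1 + ?C)"
        unfolding val real_norm_def
        by (subst abs_of_nonneg) (simp, intro mult_left_mono add_left_mono X_norm norm_ge_zero)
    qed
  qed simp
  then show ?thesis
  proof eventually_elim
    case (elim \<omega>)
    show ?case
    proof (rule summable_comparison_test'[OF elim])
      fix k
      have "0 \<le> (cmod (X (int k) \<omega>) - 1)\<^sup>2" by simp
      then have "2 * cmod (X (int k) \<omega>) \<le> 1 + (cmod (X (int k) \<omega>))\<^sup>2"
        by (simp add: power2_diff)
      then have "cmod (X (int k) \<omega>) \<le> 1 + (cmod (X (int k) \<omega>))\<^sup>2"
        using norm_ge_zero[of "X (int k) \<omega>"] by linarith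
      then show "norm (b k * X (int k) \<omega>) \<le> ?h k \<omega>"
        unfolding norm_mult by (intro mult_left_mono) auto
    qed
  qed
qed

text \<open>The partial sums converge in mean by the isometry, and almost surely to the functional,
  so Fatou's lemma identifies the two limits.\<close>

lemma B_integral: "has_stoch_integral M Z f (\<lambda>t. power_ser b (cis t) * K t) (B_functional n \<mu> a \<xi>)"
proof -
  let ?B = "B_functional n \<mu> a \<xi>" and ?A = "\<lambda>t. power_ser b (cis t) * K t"
  let ?BN = "\<lambda>N \<omega>. \<Sum>k<N. b k * X (int k) \<omega>"
  let ?AN = "\<lambda>N t. \<Sum>k<N. b k * (cis (t * real_of_int (int k)) * K t)"
  let ?c = "real \<mu> ^ n * sqrt (measure F (space F))"
  let ?tail = "\<lambda>N. (\<Sum>k. cmod (b (k + N))) * ?c"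
  have BN: "has_stoch_integral M Z f (?AN N) (?BN N)" for N
    by (intro has_stoch_integral_sum has_stoch_integral_cmult X_integral)
  note BN_sq = has_stoch_integralD(2)[OF BN] and AN_sq = has_stoch_integralD(1)[OF BN]
  have A_sq: "square_integrable F ?A" by (rule AK_square_integrable[OF density])
  have tail0: "0 \<le> (\<Sum>k. cmod (b (k + N)))" for N
    using Da_l1 by (intro suminf_nonneg) (auto simp: summable_iff_shift[of "\<lambda>k. cmod (b k)"])
  have A_tail: "L2_norm F (\<lambda>t. ?A t - ?AN N t) \<le> ?tail N" for N
  proof -
    have "L2_norm F (\<lambda>t. ?A t - ?AN N t) \<le> ((\<Sum>k. cmod (b (k + N))) * real \<mu> ^ n) * sqrt (measure F (space F))"
    proof (rule L2_norm_bounded(2)[OF F.finite_measure_axioms])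
      show "(\<lambda>t. ?A t - ?AN N t) \<in> borel_measurable F"
        using square_integrable_diff[OF A_sq AN_sq[of N]] by (simp add: square_integrable_def)
      show "AE t in F. cmod (?A t - ?AN N t) \<le> (\<Sum>k. cmod (b (k + N))) * real \<mu> ^ n"
      proof (rule AE_I2)
        fix t
        have "cis (t * real_of_int (int k)) = cis t ^ k" for k
          by (simp add: Complex.DeMoivre mult.commute)
        then have "?A t - ?AN N t = (power_ser b (cis t) - (\<Sum>k<N. b k * cis t ^ k)) * K t"
          by (simp add: left_diff_distrib sum_distrib_right mult.assoc)
        then show "cmod (?A t - ?AN N t) \<le> (\<Sum>k. cmod (b (k + N))) * real \<mu> ^ n"
          using tail0[of N] unfolding norm_mult[of "power_ser b (cis t) - _" "K t"]
          by (simp only: norm_mult) (intro mult_mono power_ser_tail Da_l1 incr_kernel_bound; simp)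
      qed
    qed (use tail0 in simp)
    then show ?thesis by (simp add: mult.assoc)
  qed
  have "(\<lambda>N. ?tail N) \<longlonglongrightarrow> 0 * ?c"
    by (intro tendsto_mult tendsto_const summable_tail_tendsto_0 Da_l1)
  then have tail: "\<exists>N0. \<forall>N\<ge>N0. ?tail N < e" if "e > 0" for e
    using order_tendstoD(2)[of ?tail 0 sequentially e] that by (simp add: eventually_sequentially)
  have B_meas: "?B \<in> borel_measurable M"
    unfolding B_functional_def[abs_def]
    using square_integrable_measurable[OF X_square_integrable] by measurable
  have B_lim: "AE \<omega> in M. (\<lambda>N. ?BN N \<omega>) \<longlonglongrightarrow> ?B \<omega>"
    using B_converges by eventually_elim (simp add: B_functional_def summable_LIMSEQ)
  have B_tail: "square_integrable M (\<lambda>\<omega>. ?B \<omega> - ?BN N \<omega>) \<and> L2_norm M (\<lambda>\<omega>. ?B \<omega> - ?BN N \<omega>) \<le> e + ?tail N"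
    if e: "e > 0" for e N
  proof (rule L2_Fatou)
    show "square_integrable M (\<lambda>\<omega>. ?BN m \<omega> - ?BN N \<omega>)" for m
      by (intro square_integrable_diff BN_sq)
    show "(\<lambda>\<omega>. ?B \<omega> - ?BN N \<omega>) \<in> borel_measurable M"
      by (intro borel_measurable_diff B_meas square_integrable_measurable[OF BN_sq])
    show "AE \<omega> in M. (\<lambda>m. ?BN m \<omega> - ?BN N \<omega>) \<longlonglongrightarrow> ?B \<omega> - ?BN N \<omega>"
      using B_lim by eventually_elim (intro tendsto_intros)
    obtain N0 where N0: "\<And>m. m \<ge> N0 \<Longrightarrow> ?tail m < e"
      using tail[OF e] by blast
    show "\<forall>\<^sub>F m in sequentially. L2_norm M (\<lambda>\<omega>. ?BN m \<omega> - ?BN N \<omega>) \<le> e + ?tail N"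
      using eventually_ge_at_top[of N0]
    proof eventually_elim
      case (elim m)
      have "L2_norm M (\<lambda>\<omega>. ?BN m \<omega> - ?BN N \<omega>) = L2_norm F (\<lambda>t. ?AN m t - ?AN N t)"
        by (intro stoch_integral_isometry has_stoch_integral_diff BN)
      also have "\<dots> \<le> L2_norm F (\<lambda>t. ?AN m t - ?A t) + L2_norm F (\<lambda>t. ?A t - ?AN N t)"
        by (rule L2_norm_triangle_diff[OF AN_sq A_sq AN_sq])
      also have "\<dots> \<le> ?tail m + ?tail N"
        unfolding L2_norm_commute[of F "?AN m"] by (intro add_mono A_tail)
      also have "\<dots> \<le> e + ?tail N"
        using N0[OF elim] by simp
      finally show ?case .
    qed
  qed
  have "square_integrable M (\<lambda>\<omega>. (?B \<omega> - ?BN 0 \<omega>) + ?BN 0 \<omega>)"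
    using B_tail[of 1 0] BN_sq[of 0] by (intro square_integrable_add) auto
  then have B_sq: "square_integrable M ?B" by simp
  show ?thesis
  proof (rule has_stoch_integral_limit[OF A_sq B_sq])
    fix e :: real assume e: "e > 0"
    obtain N where N: "?tail N < e / 2"
      using tail[of "e / 2"] e by auto
    have "L2_norm F (\<lambda>t. ?A t - ?AN N t) < e"
      using A_tail[of N] N e by linarith
    moreover have "L2_norm M (\<lambda>\<omega>. ?B \<omega> - ?BN N \<omega>) < e"
      using B_tail[of "e / 4" N] N e by auto
    ultimately show "\<exists>g' Y'. has_stoch_integral M Z f g' Y' \<and>
        L2_norm F (\<lambda>t. ?A t - g' t) < e \<and> L2_norm M (\<lambda>\<omega>. ?B \<omega> - Y' \<omega>) < e"
      using BN by blast
  qed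
qed

text \<open>The functional \<open>V\<close> of the observed values occurs in the functional and in
  its estimate and cancels, so the error is the stochastic integral of \<open>err h\<close>.\<close>

lemma estimation_error:
  assumes h: "h \<in> admissible n \<mu> f"
  shows "(\<integral>\<^sup>+\<omega>. ennreal ((cmod (A_functional n \<mu> a \<xi> \<omega> - A_estimate n \<mu> a M \<xi> Z f h \<omega>))\<^sup>2) \<partial>M) = ennreal (mse_freq h f)"
proof -
  let ?Y = "stoch_integral M Z f (\<lambda>t. h t * K t)"
  have "has_stoch_integral M Z f (\<lambda>t. h t * K t) ?Y"
    by (rule has_stoch_integral_stoch_integral[OF admissible_square_integrable[OF density h]])
  from has_stoch_integral_diff[OF B_integral this]
  have d: "has_stoch_integral M Z f (err h) (\<lambda>\<omega>. B_functional n \<mu> a \<xi> \<omega> - ?Y \<omega>)"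
    by (simp add: err_def[abs_def] left_diff_distrib)
  have "(\<integral>\<^sup>+\<omega>. ennreal ((cmod (B_functional n \<mu> a \<xi> \<omega> - ?Y \<omega>))\<^sup>2) \<partial>M) = ennreal (mse_freq h f)"
    unfolding nn_integral_square[OF has_stoch_integralD(2)[OF d]] stoch_integral_isometry[OF d] mse_freq_def ..
  then show ?thesis
    by (simp add: A_functional_def A_estimate_def)
qed

end

section \<open>One-sided moving averages\<close>

locale canonical_increments = increment_spectral n \<mu> a M \<xi> Z f + canonical_extrapolation n \<mu> a \<phi>
  for n \<mu> a and M :: "'w measure" and \<xi> Z f \<phi> +
  assumes factor: "AE t in freq. f t = seq_density \<phi> t"
begin

text \<open>The innovations are the integrals of \<open>cis (m t) K / \<Phi>\<^sub>\<mu>\<close>.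
  They are orthonormal because \<open>f |K|\<^sup>2 = |\<Phi>\<^sub>\<mu>|\<^sup>2\<close>, and
  centred because they are limits in mean of combinations of increments. Expanding
  \<open>\<Phi>\<^sub>\<mu>\<close> in \<open>cis (m t) K = \<Phi>\<^sub>\<mu> (cis (m t) K /
  \<Phi>\<^sub>\<mu>)\<close> gives the moving average.\<close>

lemma moving_average: "one_sided_moving_average M X"
proof -
  let ?p = "phi_mu n \<mu> \<phi>"
  let ?P = "\<lambda>t. power_ser ?p (cis (- t))"
  obtain T where T: "wiener T"
    and T_eq: "AE t in freq. inverse (?P t) * K t = kernel_quotient n \<mu> T t"
    and K: "AE t in freq. cmod (K t) = cmod (power_ser (w_coeff n \<mu>) (cis (- t)))"
    and nz: "AE t in freq. ?P t \<noteq> 0"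
    by (rule phi_mu_boundary)
  define G where "G m t = cis (t * real_of_int m) * (inverse (?P t) * K t)" for m t
  have G_meas: "G m \<in> borel_measurable freq" for m
    unfolding G_def by measurable
  have G_norm: "AE t in freq. f t * (cmod (G m t))\<^sup>2 = 1" for m
    using K nz factor
  proof eventually_elim
    case (elim t)
    let ?x = "cmod (power_ser \<phi> (cis (- t)))" and ?y = "cmod (power_ser (w_coeff n \<mu>) (cis (- t)))"
    have p: "cmod (?P t) = ?x * ?y"
      by (simp add: power_ser_phi_mu norm_mult)
    have xy: "?x \<noteq> 0" "?y \<noteq> 0" using elim(2) p by auto
    have "cmod (G m t) = inverse (?x * ?y) * ?y"
      unfolding G_def norm_mult norm_inverse p elim(1) by simp
    also have "\<dots> = inverse ?x"
      using xy by simp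
    finally show ?case
      using xy elim(3) by (simp add: seq_density_def power_inverse)
  qed
  have int_norm: "AE t in freq. (f t / (2 * pi)) *\<^sub>R (G m t * cnj (G k t)) = (1 / (2 * pi)) *\<^sub>R cis (of_int (m - k) * t)" for m k
    using G_norm[of 0]
  proof eventually_elim
    case (elim t)
    have "complex_of_real (f t) * (G 0 t * cnj (G 0 t)) = complex_of_real (f t * (cmod (G 0 t))\<^sup>2)"
      by (simp only: of_real_mult complex_norm_square)
    then have unit: "complex_of_real (f t) * (G 0 t * cnj (G 0 t)) = 1"
      unfolding elim by simp
    have shift: "G m t * cnj (G k t) = cis (of_int (m - k) * t) * (G 0 t * cnj (G 0 t))"
    proof -
      have "cis (of_int (m - k) * t) = cis (t * of_int m) * cis (- (t * of_int k))"
        by (simp add: cis_mult algebra_simps)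
      then show ?thesis
        by (simp add: G_def cis_cnj mult_ac)
    qed
    have "complex_of_real (f t) * (G m t * cnj (G k t)) = cis (of_int (m - k) * t)"
      unfolding shift
      by (subst mult.left_commute) (simp only: unit mult_1_right)
    moreover have "(f t / (2 * pi)) *\<^sub>R (G m t * cnj (G k t)) = (1 / (2 * pi)) *\<^sub>R (complex_of_real (f t) * (G m t * cnj (G k t)))"
      by (simp add: scaleR_conv_of_real)
    ultimately show ?case
      by (simp only:)
  qed
  have G_sq: "square_integrable F (G m)" for m
  proof -
    have m2: "(\<lambda>t. (cmod (G m t))\<^sup>2) \<in> borel_measurable freq" using G_meas[of m] by measurable
    have fm: "f \<in> borel_measurable freq" by (rule spectral_densityD(2)[OF density])
    have "integrable freq (\<lambda>t. (f t / (2 * pi)) *\<^sub>R (cmod (G m t))\<^sup>2)"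
    proof (subst integrable_cong_AE)
      show "AE t in freq. (f t / (2 * pi)) *\<^sub>R (cmod (G m t))\<^sup>2 = 1 / (2 * pi)"
        using G_norm[of m] by eventually_elim (simp add: field_simps)
    qed (use fm m2 in measurable)
    then show ?thesis
      unfolding square_integrable_def using G_meas integrable_spectral_measure[OF density m2] by simp
  qed
  \<comment> \<open>The innovations.\<close>
  define e where "e m = stoch_integral M Z f (G m)" for m
  have e: "has_stoch_integral M Z f (G m) (e m)" for m
    unfolding e_def by (rule has_stoch_integral_stoch_integral[OF G_sq])
  have ortho: "(\<integral>\<omega>. e m \<omega> * cnj (e k \<omega>) \<partial>M) = (if m = k then 1 else 0)" for m k
  proof -
    have mm: "(\<lambda>t. G m t * cnj (G k t)) \<in> borel_measurable freq"
      by (intro borel_measurable_times borel_measurable_cnj G_meas)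
    have fm: "f \<in> borel_measurable freq" by (rule spectral_densityD(2)[OF density])
    have "(\<integral>\<omega>. e m \<omega> * cnj (e k \<omega>) \<partial>M) = (\<integral>t. (f t / (2 * pi)) *\<^sub>R (G m t * cnj (G k t)) \<partial>freq)"
      unfolding stoch_integral_inner[OF e e] by (rule integral_spectral_measure[OF density mm])
    also have "\<dots> = (\<integral>t. (1 / (2 * pi)) *\<^sub>R cis (of_int (m - k) * t) \<partial>freq)"
      by (rule integral_cong_AE[OF _ _ int_norm]) (use fm mm in measurable)
    also have "\<dots> = (if m = k then 1 else 0)"
      unfolding integral_scaleR_right integral_cis by (auto simp: scaleR_conv_of_real)
    finally show ?thesis .
  qed
  have mean: "(\<integral>\<omega>. e m \<omega> \<partial>M) = 0" for m
  proof -
    have "cmod (\<integral>\<omega>. e m \<omega> \<partial>M) \<le> 0 + \<delta>" if \<delta>: "\<delta> > 0" for \<delta>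
    proof -
      obtain N c where c: "L2_norm F (\<lambda>t. kernel_quotient n \<mu> T t - (\<Sum>k<N. c k * cis (- t) ^ k * K t)) < \<delta>"
        using kernel_quotient_approx[OF mu T density \<delta>] by blast
      let ?s = "\<lambda>t. \<Sum>k<N. c k * (cis (t * real_of_int (m - int k)) * K t)"
      let ?S = "\<lambda>\<omega>. \<Sum>k<N. c k * X (m - int k) \<omega>"
      have S: "has_stoch_integral M Z f ?s ?S"
        by (intro has_stoch_integral_sum has_stoch_integral_cmult X_integral)
      have s_eq: "?s t = cis (t * real_of_int m) * (\<Sum>k<N. c k * cis (- t) ^ k * K t)" for t
      proof -
        have "cis (t * real_of_int (m - int k)) = cis (t * real_of_int m) * cis (- t) ^ k" for k
          by (simp add: Complex.DeMoivre cis_mult algebra_simps)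
        then show ?thesis by (simp add: sum_distrib_left mult_ac)
      qed
      have "L2_norm M (\<lambda>\<omega>. e m \<omega> - ?S \<omega>) = L2_norm F (\<lambda>t. G m t - ?s t)"
        by (intro stoch_integral_isometry has_stoch_integral_diff e S)
      also have "\<dots> = L2_norm F (\<lambda>t. cis (t * real_of_int m) * (kernel_quotient n \<mu> T t - (\<Sum>k<N. c k * cis (- t) ^ k * K t)))"
      proof (rule L2_norm_cong_AE)
        show "(\<lambda>t. G m t - ?s t) \<in> borel_measurable F"
          using square_integrable_measurable[OF square_integrable_diff[OF G_sq has_stoch_integralD(1)[OF S]]] .
        show "(\<lambda>t. cis (t * real_of_int m) * (kernel_quotient n \<mu> T t - (\<Sum>k<N. c k * cis (- t) ^ k * K t))) \<in> borel_measurable F"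
          using kernel_quotient_measurable[OF T] by simp
        show "AE t in F. G m t - ?s t = cis (t * real_of_int m) * (kernel_quotient n \<mu> T t - (\<Sum>k<N. c k * cis (- t) ^ k * K t))"
          using AE_spectral_measure[OF density T_eq]
          by eventually_elim (simp only: s_eq G_def right_diff_distrib)
      qed
      also have "\<dots> = L2_norm F (\<lambda>t. kernel_quotient n \<mu> T t - (\<Sum>k<N. c k * cis (- t) ^ k * K t))"
        by (simp add: L2_norm_def norm_mult)
      finally have small: "L2_norm M (\<lambda>\<omega>. e m \<omega> - ?S \<omega>) < \<delta>" using c by simp
      have d_sq: "square_integrable M (\<lambda>\<omega>. e m \<omega> - ?S \<omega>)"
        by (intro square_integrable_diff has_stoch_integralD(2)[OF e] has_stoch_integralD(2)[OF S])
      have one: "square_integrable M (\<lambda>_. 1)" "L2_norm M (\<lambda>_. 1) = 1"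
        by (simp_all add: square_integrable_def L2_norm_def prob_space)
      have e_int: "integrable M (e m)"
        using square_integrable_prod[OF has_stoch_integralD(2)[OF e] one(1)] by simp
      have S_int: "integrable M ?S"
        by (intro Bochner_Integration.integrable_sum integrable_mult_right X_integrable)
      have "(\<integral>\<omega>. ?S \<omega> \<partial>M) = 0"
        using X_integrable by (simp add: X_mean)
      then have "(\<integral>\<omega>. e m \<omega> \<partial>M) = (\<integral>\<omega>. e m \<omega> - ?S \<omega> \<partial>M)"
        using e_int S_int by simp
      also have "cmod \<dots> \<le> (\<integral>\<omega>. cmod (e m \<omega> - ?S \<omega>) * cmod 1 \<partial>M)"
        using integral_norm_bound[of M "\<lambda>\<omega>. e m \<omega> - ?S \<omega>"] by simp
      also have "\<dots> \<le> L2_norm M (\<lambda>\<omega>. e m \<omega> - ?S \<omega>) * L2_norm M (\<lambda>_. 1)"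
        by (rule Cauchy_Schwarz_integral[OF d_sq one(1)])
      finally show ?thesis using small one(2) by simp
    qed
    then have "cmod (\<integral>\<omega>. e m \<omega> \<partial>M) \<le> 0" by (rule field_le_epsilon)
    then show ?thesis by simp
  qed
  have conv: "(\<lambda>N. \<integral>\<^sup>+\<omega>. ennreal ((cmod (X m \<omega> - (\<Sum>k<N. ?p k * e (m - int k) \<omega>)))\<^sup>2) \<partial>M) \<longlonglongrightarrow> 0" for m
  proof -
    let ?g = "\<lambda>N t. cis (t * real_of_int m) * K t - (\<Sum>k<N. ?p k * G (m - int k) t)"
    have has: "has_stoch_integral M Z f (?g N) (\<lambda>\<omega>. X m \<omega> - (\<Sum>k<N. ?p k * e (m - int k) \<omega>))" for N
      by (intro has_stoch_integral_diff X_integral has_stoch_integral_sum has_stoch_integral_cmult e)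
    let ?tail = "\<lambda>N. \<Sum>k. cmod (?p (k + N))"
    have tail0: "0 \<le> ?tail N" for N
      using phi_mu_summable by (intro suminf_nonneg) (auto simp: summable_iff_shift[of "\<lambda>k. cmod (?p k)"])
    have "(L2_norm F (?g N))\<^sup>2 \<le> (?tail N)\<^sup>2" for N
    proof -
      have sq: "square_integrable F (?g N)" by (rule has_stoch_integralD(1)[OF has])
      have m2: "(\<lambda>t. (cmod (?g N t))\<^sup>2) \<in> borel_measurable freq"
        using borel_measurable_integrable[OF square_integrableD[OF sq]]
        by (simp only: measurable_spectral_measure)
      have int: "integrable freq (\<lambda>t. (f t / (2 * pi)) *\<^sub>R (cmod (?g N t))\<^sup>2)"
        using square_integrableD[OF sq] integrable_spectral_measure[OF density m2] by simp
      have "(L2_norm F (?g N))\<^sup>2 = (\<integral>t. (f t / (2 * pi)) *\<^sub>R (cmod (?g N t))\<^sup>2 \<partial>freq)"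
        unfolding L2_norm_square by (rule integral_spectral_measure[OF density m2])
      also have "\<dots> \<le> (\<integral>t. (?tail N)\<^sup>2 / (2 * pi) \<partial>freq)"
      proof (rule integral_mono_AE[OF int])
        show "AE t in freq. (f t / (2 * pi)) *\<^sub>R (cmod (?g N t))\<^sup>2 \<le> (?tail N)\<^sup>2 / (2 * pi)"
          using nz G_norm[of m]
        proof eventually_elim
          case (elim t)
          have G_shift: "G (m - int k) t = cis (- t) ^ k * G m t" for k
          proof -
            have "cis (t * real_of_int (m - int k)) = cis (- t) ^ k * cis (t * real_of_int m)"
              by (simp add: Complex.DeMoivre cis_mult algebra_simps)
            then show ?thesis by (simp add: G_def)
          qed
          have "cis (t * real_of_int m) * K t = ?P t * G m t"
            using elim(1) by (simp add: G_def)
          then have g: "?g N t = (?P t - (\<Sum>k<N. ?p k * cis (- t) ^ k)) * G m t"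
            by (simp add: G_shift left_diff_distrib sum_distrib_right mult.assoc)
          have "(cmod (?P t - (\<Sum>k<N. ?p k * cis (- t) ^ k)))\<^sup>2 \<le> (?tail N)\<^sup>2"
            by (intro power_mono power_ser_tail phi_mu_summable) auto
          moreover have "f t * (cmod (?g N t))\<^sup>2 = (cmod (?P t - (\<Sum>k<N. ?p k * cis (- t) ^ k)))\<^sup>2"
            unfolding g norm_mult power_mult_distrib using elim(2) by (simp add: mult.left_commute)
          ultimately show ?case
            by (simp add: divide_right_mono)
        qed
      qed simp
      also have "\<dots> = (?tail N)\<^sup>2"
        by (simp add: measure_def emeasure_freq)
      finally show ?thesis .
    qed
    then have le: "ennreal ((L2_norm F (?g N))\<^sup>2) \<le> ennreal ((?tail N)\<^sup>2)" for N
      by (rule ennreal_leI)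
    have "(\<lambda>N. (?tail N)\<^sup>2) \<longlonglongrightarrow> 0\<^sup>2"
      by (intro tendsto_power summable_tail_tendsto_0 phi_mu_summable)
    then have "(\<lambda>N. ennreal ((?tail N)\<^sup>2)) \<longlonglongrightarrow> ennreal (0\<^sup>2)"
      by (rule tendsto_ennrealI)
    then have lim: "(\<lambda>N. ennreal ((?tail N)\<^sup>2)) \<longlonglongrightarrow> 0" by simp
    have eq: "(\<integral>\<^sup>+\<omega>. ennreal ((cmod (X m \<omega> - (\<Sum>k<N. ?p k * e (m - int k) \<omega>)))\<^sup>2) \<partial>M) = ennreal ((L2_norm F (?g N))\<^sup>2)" for N
      unfolding nn_integral_square[OF has_stoch_integralD(2)[OF has]] stoch_integral_isometry[OF has] ..
    show ?thesis
      unfolding eq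
      by (rule tendsto_sandwich[OF _ _ tendsto_const lim]) (use le in auto)
  qed
  show ?thesis
    unfolding one_sided_moving_average_def
  proof (intro exI[of _ ?p] exI[of _ e] conjI allI)
    show "summable (\<lambda>k. (cmod (?p k))\<^sup>2)"
      by (rule summable_norm_square[OF phi_mu_summable])
    show "e m \<in> borel_measurable M" "integrable M (\<lambda>\<omega>. (cmod (e m \<omega>))\<^sup>2)" for m
      using has_stoch_integralD(2)[OF e[of m]] by (auto simp: square_integrable_def)
  qed (use mean ortho conv in auto)
qed

end

section \<open>The minimax problem\<close>

locale robust_extrapolation = extrapolation n \<mu> a for n \<mu> a +
  fixes v :: "real \<Rightarrow> real" and \<epsilon> :: real
    and M :: "(real \<Rightarrow> real) \<Rightarrow> 'w measure"
    and \<xi> :: "(real \<Rightarrow> real) \<Rightarrow> int \<Rightarrow> 'w \<Rightarrow> complex"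
    and Z :: "(real \<Rightarrow> real) \<Rightarrow> real set \<Rightarrow> 'w \<Rightarrow> complex"
  assumes v: "spectral_density v" and eps: "\<epsilon> > 0"
    and family: "\<And>f. f \<in> D_eps v \<epsilon> \<Longrightarrow> stationary_increments (M f) n (\<xi> f) \<and>
                   zero_mean_increments (M f) n (\<xi> f) \<and> has_spectral_density (M f) n (\<xi> f) (Z f) f"
begin

lemma D_eps_spectral: "f \<in> D_eps v \<epsilon> \<Longrightarrow> spectral_density f"
  by (simp add: D_eps_def)

lemma increments:
  assumes "f \<in> D_eps v \<epsilon>"
  shows "increment_spectral n \<mu> a (M f) (\<xi> f) (Z f) f"
  using family[OF assms] D_eps_spectral[OF assms] by unfold_locales auto

lemma mse_eq:
  assumes "f \<in> D_eps v \<epsilon>" "h \<in> admissible n \<mu> f"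
  shows "mse n \<mu> a M \<xi> Z h f = ennreal (mse_freq h f)"
  unfolding mse_def by (rule increment_spectral.estimation_error[OF increments[OF assms(1)] assms(2)])

lemma mse_freq_nonneg: "0 \<le> mse_freq h f"
  by (simp add: mse_freq_def)

lemma optimal_char_iff:
  assumes "f \<in> D_eps v \<epsilon>"
  shows "optimal_char n \<mu> a M \<xi> Z f h \<longleftrightarrow>
    h \<in> admissible n \<mu> f \<and> (\<forall>h'\<in>admissible n \<mu> f. mse_freq h f \<le> mse_freq h' f)"
  unfolding optimal_char_def by (auto simp: mse_eq[OF assms] mse_freq_nonneg)

lemma canonical_context:
  assumes "canonical_factorization \<phi> f0"
  shows "canonical_extrapolation n \<mu> a \<phi>" "AE t in freq. f0 t = seq_density \<phi> t"
  using assms by (auto simp: canonical_factorization_def intro!: canonical_extrapolation.intro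
      canonical_extrapolation_axioms.intro extrapolation_axioms)

lemma h_char_optimal:
  assumes fac: "canonical_factorization \<phi> f0" and D: "f0 \<in> D_eps v \<epsilon>"
  shows "optimal_char n \<mu> a M \<xi> Z f0 (h_char n \<mu> a \<phi>)"
proof -
  interpret canonical_extrapolation n \<mu> a \<phi> by (rule canonical_context(1)[OF fac])
  note factor = canonical_context(2)[OF fac] and d = D_eps_spectral[OF D]
  show ?thesis
    unfolding optimal_char_iff[OF D]
  proof (intro conjI ballI h0_admissible[OF d])
    fix h' assume "h' \<in> admissible n \<mu> f0"
    from mse_freq_pythagoras[OF d factor this] show "mse_freq h0 f0 \<le> mse_freq h' f0"
      using zero_le_power2[of "L2_norm (spectral_measure f0) (\<lambda>t. (h0 t - h' t) * K t)"] by linarith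
  qed
qed

lemma least_favorable_of_saddle:
  assumes fac: "canonical_factorization \<phi> f0" and D: "f0 \<in> D_eps v \<epsilon>"
    and saddle: "\<And>f. f \<in> D_eps v \<epsilon> \<Longrightarrow> mse_freq (h_char n \<mu> a \<phi>) f \<le> mse_freq (h_char n \<mu> a \<phi>) f0"
  shows "least_favorable n \<mu> a M \<xi> Z (D_eps v \<epsilon>) f0"
proof -
  interpret canonical_extrapolation n \<mu> a \<phi> by (rule canonical_context(1)[OF fac])
  have bound: "\<exists>h. optimal_char n \<mu> a M \<xi> Z f h \<and> mse n \<mu> a M \<xi> Z h f \<le> mse n \<mu> a M \<xi> Z h0 f0"
    if f: "f \<in> D_eps v \<epsilon>" for f
  proof -
    note fd = D_eps_spectral[OF f]
    obtain h where h: "h \<in> admissible n \<mu> f" "\<And>h'. h' \<in> admissible n \<mu> f \<Longrightarrow> mse_freq h f \<le> mse_freq h' f"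
      using optimal_exists[OF fd] by metis
    have "mse_freq h f \<le> mse_freq h0 f0"
      using h(2)[OF h0_admissible[OF fd]] saddle[OF f] by linarith
    then have le: "mse n \<mu> a M \<xi> Z h f \<le> mse n \<mu> a M \<xi> Z h0 f0"
      unfolding mse_eq[OF f h(1)] mse_eq[OF D h0_admissible[OF D_eps_spectral[OF D]]] by (rule ennreal_leI)
    have "optimal_char n \<mu> a M \<xi> Z f h"
      unfolding optimal_char_iff[OF f] by (intro conjI ballI h)
    then show ?thesis
      using le by (intro exI conjI)
  qed
  show ?thesis
    unfolding least_favorable_def
    by (rule conjI[OF D], rule exI[of _ h0], rule conjI[OF h_char_optimal[OF fac D]], rule ballI, rule bound)
qed

text \<open>Above \<open>v\<close> the distance from \<open>v\<close> is the difference of the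
  masses.\<close>

lemma density_above_v_in_D_eps:
  assumes f0: "spectral_density f0" and above: "AE t in freq. v t \<le> f0 t"
    and mass: "(\<integral>t. f0 t \<partial>freq) = 2 * pi * \<epsilon> + (\<integral>t. v t \<partial>freq)"
  shows "f0 \<in> D_eps v \<epsilon>"
proof -
  have "(\<integral>t. \<bar>f0 t - v t\<bar> \<partial>freq) = (\<integral>t. f0 t - v t \<partial>freq)"
  proof (rule integral_cong_AE)
    show "AE t in freq. \<bar>f0 t - v t\<bar> = f0 t - v t"
      using above by eventually_elim simp
  qed (use spectral_densityD(2)[OF f0] spectral_densityD(2)[OF v] in auto)
  also have "\<dots> = 2 * pi * \<epsilon>"
    using spectral_densityD(1)[OF f0] spectral_densityD(1)[OF v] mass by simp
  finally show ?thesis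
    using f0 by (simp add: D_eps_def)
qed

lemma P1_mass: "2 * pi * P1 v \<epsilon> = 2 * pi * \<epsilon> + (\<integral>t. v t \<partial>freq)"
  by (simp add: P1_def field_simps)

lemma max_density_spectral:
  assumes "canonical_extrapolation n \<mu> a \<phi>"
  shows "spectral_density (max_density n \<mu> a v c \<phi>)"
proof -
  interpret canonical_extrapolation n \<mu> a \<phi> by fact
  have "integrable freq (\<lambda>t. (cmod (c * r_fun n \<mu> a \<phi> t))\<^sup>2)"
  proof (rule integrable_freq_bounded)
    show "norm ((cmod (c * r_fun n \<mu> a \<phi> t))\<^sup>2) \<le> (cmod c * (\<Sum>k. cmod (r k)))\<^sup>2" for t
      using power_ser_bound[OF r_summable, of "cis t"]
      by (simp add: r_fun_def norm_mult power_mono mult_left_mono)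
  qed measurable
  then show ?thesis
    using v by (auto simp: spectral_density_def max_density_def[abs_def] le_max_iff_disj)
qed

text \<open>For a solution of the eigenvalue equation the weight \<open>|r|\<^sup>2 /
  |\<Phi>|\<^sup>2\<close> is the constant \<open>|\<alpha>|\<^sup>2\<close>, so a surplus over
  \<open>v\<close> may sit anywhere.\<close>

lemma nu_saddle:
  assumes "\<phi> \<in> nu_set n \<mu> a v \<epsilon>"
  shows "seq_density \<phi> \<in> D_eps v \<epsilon>"
    "f \<in> D_eps v \<epsilon> \<Longrightarrow> mse_freq (h_char n \<mu> a \<phi>) f \<le> mse_freq (h_char n \<mu> a \<phi>) (seq_density \<phi>)"
proof -
  have above: "AE t in freq. v t \<le> seq_density \<phi> t" and l2: "l2_sq \<phi> = P1 v \<epsilon>"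
    and fac: "canonical_factorization \<phi> (seq_density \<phi>)"
    using assms by (auto simp: nu_set_def)
  obtain \<alpha> where \<alpha>: "\<And>k. DAW n \<mu> a \<phi> k = \<alpha> * cnj (\<phi> k)"
    using assms by (auto simp: nu_set_def solves_eq_def)
  interpret canonical_extrapolation n \<mu> a \<phi> by (rule canonical_context(1)[OF fac])
  have mass: "(\<integral>t. seq_density \<phi> t \<partial>freq) = 2 * pi * \<epsilon> + (\<integral>t. v t \<partial>freq)"
    unfolding integral_seq_density l2 P1_mass ..
  show "seq_density \<phi> \<in> D_eps v \<epsilon>"
    by (rule density_above_v_in_D_eps[OF seq_density_spectral above mass])
  have r_eq: "(cmod (r_fun n \<mu> a \<phi> t))\<^sup>2 = (cmod \<alpha>)\<^sup>2 * seq_density \<phi> t" for t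
  proof -
    have "(\<lambda>k. \<alpha> * (cnj (\<phi> k) * cis t ^ k)) sums (\<alpha> * power_ser (\<lambda>k. cnj (\<phi> k)) (cis t))"
      using phi_summable by (intro sums_mult power_ser_sums) auto
    then have "r_fun n \<mu> a \<phi> t = \<alpha> * power_ser (\<lambda>k. cnj (\<phi> k)) (cis t)"
      unfolding r_fun_def by (simp add: power_ser_def[of r] \<alpha> sums_iff mult.assoc)
    then show ?thesis
      by (simp add: seq_density_conj norm_mult power_mult_distrib)
  qed
  assume f: "f \<in> D_eps v \<epsilon>"
  show "mse_freq h0 f \<le> mse_freq h0 (seq_density \<phi>)"
    by (rule Lagrange_saddle[OF v seq_density_spectral f _ mass above, where C = "(cmod \<alpha>)\<^sup>2"]) (auto simp: r_eq)
qed

text \<open>Where the maximum exceeds \<open>v\<close>, it is \<open>|c r|\<^sup>2\<close>, so the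
  weight equals \<open>1 / |c|\<^sup>2\<close> there; elsewhere it is not larger. The constant
  \<open>c\<close> cannot vanish, since the density would then be \<open>v\<close>, whose mass is too
  small.\<close>

lemma max_density_saddle:
  assumes fac: "canonical_factorization \<phi> (max_density n \<mu> a v c \<phi>)"
    and mass: "(\<integral>t. max_density n \<mu> a v c \<phi> t \<partial>freq) = 2 * pi * \<epsilon> + (\<integral>t. v t \<partial>freq)"
  shows "max_density n \<mu> a v c \<phi> \<in> D_eps v \<epsilon>"
    "f \<in> D_eps v \<epsilon> \<Longrightarrow> mse_freq (h_char n \<mu> a \<phi>) f \<le> mse_freq (h_char n \<mu> a \<phi>) (max_density n \<mu> a v c \<phi>)"
proof -
  let ?f0 = "max_density n \<mu> a v c \<phi>"
  interpret canonical_extrapolation n \<mu> a \<phi> by (rule canonical_context(1)[OF fac])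
  note factor = canonical_context(2)[OF fac]
  note spec = max_density_spectral[OF canonical_context(1)[OF fac]]
  have above: "AE t in freq. v t \<le> ?f0 t" by (simp add: max_density_def)
  show "?f0 \<in> D_eps v \<epsilon>"
    by (rule density_above_v_in_D_eps[OF spec above mass])
  have c: "c \<noteq> 0"
  proof
    assume "c = 0"
    then have "(\<integral>t. ?f0 t \<partial>freq) = (\<integral>t. v t \<partial>freq)"
      using spectral_densityD(3)[OF v] by (intro Bochner_Integration.integral_cong) (auto simp: max_density_def)
    then show False using mass eps by simp
  qed
  have scale: "(cmod (r_fun n \<mu> a \<phi> t))\<^sup>2 = (1 / (cmod c)\<^sup>2) * (cmod (c * r_fun n \<mu> a \<phi> t))\<^sup>2" for t
    using c by (simp add: norm_mult power_mult_distrib)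
  assume f: "f \<in> D_eps v \<epsilon>"
  show "mse_freq h0 f \<le> mse_freq h0 ?f0"
  proof (rule Lagrange_saddle[OF v spec f factor mass above, where C = "1 / (cmod c)\<^sup>2"])
    show "AE t in freq. (cmod (r_fun n \<mu> a \<phi> t))\<^sup>2 \<le> 1 / (cmod c)\<^sup>2 * seq_density \<phi> t"
      using factor
    proof eventually_elim
      case (elim t)
      show ?case
        unfolding scale elim[symmetric] by (intro mult_left_mono) (auto simp: max_density_def)
    qed
    show "AE t in freq. v t < ?f0 t \<longrightarrow> (cmod (r_fun n \<mu> a \<phi> t))\<^sup>2 = 1 / (cmod c)\<^sup>2 * seq_density \<phi> t"
      using factor
    proof eventually_elim
      case (elim t)
      show ?case
        unfolding scale elim[symmetric] by (auto simp: max_density_def max_def)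
    qed
  qed simp
qed

text \<open>The saddle point property also bounds the error for the other factorizable densities of
  the class, so every element of the set solves the extremum problem.\<close>

lemma nu_plus_determines:
  assumes "\<phi> \<in> nu_plus_set n \<mu> a v \<epsilon>"
  obtains c where "determines_max_density n \<mu> a v \<epsilon> c \<phi>"
proof -
  obtain c where l2: "l2_sq \<phi> = P1 v \<epsilon>" and fac: "canonical_factorization \<phi> (max_density n \<mu> a v c \<phi>)"
    using assms by (auto simp: nu_plus_set_def)
  let ?f0 = "max_density n \<mu> a v c \<phi>"
  interpret canonical_extrapolation n \<mu> a \<phi> by (rule canonical_context(1)[OF fac])
  note factor = canonical_context(2)[OF fac]
  note spec = max_density_spectral[OF canonical_context(1)[OF fac]]
  have "(\<integral>t. ?f0 t \<partial>freq) = (\<integral>t. seq_density \<phi> t \<partial>freq)"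
    by (rule integral_cong_AE[OF _ _ factor]) (use spectral_densityD(2) spec seq_density_spectral in auto)
  then have mass: "(\<integral>t. ?f0 t \<partial>freq) = 2 * pi * \<epsilon> + (\<integral>t. v t \<partial>freq)"
    unfolding integral_seq_density l2 P1_mass .
  note D = max_density_saddle[OF fac mass]
  have "(\<integral>t. \<bar>seq_density \<phi> t - v t\<bar> \<partial>freq) = (\<integral>t. \<bar>?f0 t - v t\<bar> \<partial>freq)"
  proof (rule integral_cong_AE)
    show "AE t in freq. \<bar>seq_density \<phi> t - v t\<bar> = \<bar>?f0 t - v t\<bar>"
      using factor by eventually_elim simp
  qed (use spectral_densityD(2)[OF spec] spectral_densityD(2)[OF seq_density_spectral] spectral_densityD(2)[OF v] in auto)
  then have sD: "seq_density \<phi> \<in> D_eps v \<epsilon>"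
    using D(1) seq_density_spectral by (simp add: D_eps_def)
  have sfac: "canonical_factorization \<phi> (seq_density \<phi>)"
    using fac by (simp add: canonical_factorization_def)
  have max: "l2_sq (DAW n \<mu> a \<psi>) \<le> l2_sq (DAW n \<mu> a \<phi>)"
    if \<psi>: "seq_density \<psi> \<in> D_eps v \<epsilon>" "canonical_factorization \<psi> (seq_density \<psi>)" for \<psi>
  proof -
    interpret psi: canonical_extrapolation n \<mu> a \<psi> by (rule canonical_context(1)[OF \<psi>(2)])
    note d = D_eps_spectral[OF \<psi>(1)]
    have "l2_sq (DAW n \<mu> a \<psi>) = mse_freq psi.h0 (seq_density \<psi>)"
      by (rule psi.mse_freq_own[OF d, symmetric]) simp
    also have "\<dots> \<le> mse_freq h0 (seq_density \<psi>)"
    proof -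
      have "mse_freq h0 (seq_density \<psi>) = mse_freq psi.h0 (seq_density \<psi>)
          + (L2_norm (spectral_measure (seq_density \<psi>)) (\<lambda>t. (psi.h0 t - h0 t) * K t))\<^sup>2"
        by (rule psi.mse_freq_pythagoras[OF d _ h0_admissible[OF d]]) simp
      then show ?thesis
        using zero_le_power2[of "L2_norm (spectral_measure (seq_density \<psi>)) (\<lambda>t. (psi.h0 t - h0 t) * K t)"]
        by linarith
    qed
    also have "\<dots> \<le> mse_freq h0 ?f0"
      by (rule D(2)[OF \<psi>(1)])
    also have "\<dots> = l2_sq (DAW n \<mu> a \<phi>)"
      by (rule mse_freq_own[OF spec factor])
    finally show ?thesis .
  qed
  have "determines_max_density n \<mu> a v \<epsilon> c \<phi>"
    unfolding determines_max_density_def extremal_seq_def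
    by (intro conjI allI impI fac mass sD sfac max) auto
  then show ?thesis by (rule that)
qed

text \<open>By the saddle point property \<open>f0\<close> is the worst density for
  \<open>h0\<close>, while \<open>h0\<close> is the best characteristic for \<open>f0\<close>. Another
  robust characteristic has no larger error under \<open>f0\<close>, so by the Pythagorean identity it
  agrees with \<open>h0\<close> where \<open>f0\<close> and the kernel do not vanish.\<close>

lemma minimax:
  assumes lf: "least_favorable n \<mu> a M \<xi> Z (D_eps v \<epsilon>) f0" and fac: "canonical_factorization \<phi> f0"
  shows "minimax_robust n \<mu> a M \<xi> Z (D_eps v \<epsilon>) (h_char n \<mu> a \<phi>)"
    "minimax_robust n \<mu> a M \<xi> Z (D_eps v \<epsilon>) h \<Longrightarrow> AE t in freq. h t = h_char n \<mu> a \<phi> t"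
proof -
  let ?D = "D_eps v \<epsilon>" and ?mse = "mse n \<mu> a M \<xi> Z"
  interpret canonical_extrapolation n \<mu> a \<phi> by (rule canonical_context(1)[OF fac])
  note factor = canonical_context(2)[OF fac]
  have D: "f0 \<in> ?D" using lf by (simp add: least_favorable_def)
  note d = D_eps_spectral[OF D]
  have opt: "mse_freq h0 f0 \<le> mse_freq h' f0" if "h' \<in> admissible n \<mu> f0" for h'
    using h_char_optimal[OF fac D] that by (simp add: optimal_char_iff[OF D])
  obtain h1 where h1: "optimal_char n \<mu> a M \<xi> Z f0 h1"
    and h1_max: "\<And>f. f \<in> ?D \<Longrightarrow> \<exists>h. optimal_char n \<mu> a M \<xi> Z f h \<and> ?mse h f \<le> ?mse h1 f0"
    using lf unfolding least_favorable_def by blast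
  have h1_eq: "mse_freq h1 f0 = mse_freq h0 f0"
    using h1 opt h0_admissible[OF d] unfolding optimal_char_iff[OF D] by (intro antisym) auto
  have saddle: "mse_freq h0 f \<le> mse_freq h0 f0" if f: "f \<in> ?D" for f
  proof (rule saddle_of_least_favorable[OF v D f factor])
    fix g assume g: "g \<in> ?D"
    obtain h where "optimal_char n \<mu> a M \<xi> Z g h" "?mse h g \<le> ?mse h1 f0"
      using h1_max[OF g] by blast
    then have "h \<in> admissible n \<mu> g" "ennreal (mse_freq h g) \<le> ennreal (mse_freq h0 f0)"
      using h1 h1_eq by (auto simp: optimal_char_iff[OF g] optimal_char_iff[OF D] mse_eq[OF g] mse_eq[OF D])
    then show "\<exists>h\<in>admissible n \<mu> g. mse_freq h g \<le> mse_freq h0 f0"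
      by (auto simp: mse_freq_nonneg)
  qed
  have h0_H: "h0 \<in> H_class n \<mu> ?D"
    unfolding H_class_def using h0_admissible[OF D_eps_spectral] by blast
  have h0_le: "?mse h0 f \<le> ?mse h0 f0" if "f \<in> ?D" for f
    using saddle[OF that] h0_admissible[OF D_eps_spectral[OF that]] h0_admissible[OF d]
    by (simp add: mse_eq that D ennreal_leI)
  have sup: "(SUP f\<in>?D. ?mse h0 f) = ?mse h0 f0"
  proof (rule antisym)
    show "(SUP f\<in>?D. ?mse h0 f) \<le> ?mse h0 f0"
      by (rule SUP_least) (rule h0_le)
    show "?mse h0 f0 \<le> (SUP f\<in>?D. ?mse h0 f)"
      by (rule SUP_upper[OF D])
  qed
  have lower: "?mse h0 f0 \<le> ?mse h' f0" if "h' \<in> H_class n \<mu> ?D" for h'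
  proof -
    have "h' \<in> admissible n \<mu> f0" using that D by (simp add: H_class_def)
    then show ?thesis
      using opt h0_admissible[OF d] by (simp add: mse_eq D ennreal_leI)
  qed
  have inf: "(INF h\<in>H_class n \<mu> ?D. SUP f\<in>?D. ?mse h f) = ?mse h0 f0"
  proof (rule antisym)
    show "(INF h\<in>H_class n \<mu> ?D. SUP f\<in>?D. ?mse h f) \<le> ?mse h0 f0"
      using INF_lower[OF h0_H, of "\<lambda>h. SUP f\<in>?D. ?mse h f"] sup by simp
    show "?mse h0 f0 \<le> (INF h\<in>H_class n \<mu> ?D. SUP f\<in>?D. ?mse h f)"
    proof (rule INF_greatest)
      fix h' assume "h' \<in> H_class n \<mu> ?D"
      from lower[OF this] show "?mse h0 f0 \<le> (SUP f\<in>?D. ?mse h' f)"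
        by (rule order_trans) (rule SUP_upper[OF D])
    qed
  qed
  show "minimax_robust n \<mu> a M \<xi> Z ?D h0"
    unfolding minimax_robust_def using h0_H h0_le D sup inf by auto
  assume h: "minimax_robust n \<mu> a M \<xi> Z ?D h"
  then have hH: "h \<in> H_class n \<mu> ?D" and hs: "(SUP f\<in>?D. ?mse h f) = ?mse h0 f0"
    using inf by (auto simp: minimax_robust_def)
  have adm: "h \<in> admissible n \<mu> f0" using hH D by (simp add: H_class_def)
  have "?mse h f0 \<le> ?mse h0 f0" using SUP_upper[OF D, of "?mse h"] hs by simp
  then have "mse_freq h f0 \<le> mse_freq h0 f0"
    using adm h0_admissible[OF d] by (simp add: mse_eq D mse_freq_nonneg)
  then have zero: "L2_norm (spectral_measure f0) (\<lambda>t. (h0 t - h t) * K t) = 0"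
    unfolding mse_freq_pythagoras[OF d factor adm] by simp
  have "square_integrable (spectral_measure f0) (\<lambda>t. (h0 t - h t) * K t)"
    unfolding left_diff_distrib
    by (intro square_integrable_diff admissible_square_integrable[OF d] h0_admissible[OF d] adm)
  from L2_norm_eq_0_iff[OF this] zero have "AE t in spectral_measure f0. (h0 t - h t) * K t = 0" by simp
  moreover have "AE t in freq. 0 < f0 t"
    using factor by eventually_elim (simp add: seq_density_pos)
  ultimately have "AE t in freq. (h0 t - h t) * K t = 0"
    by (rule AE_spectral_measureD[OF d])
  then show "AE t in freq. h t = h0 t"
    using AE_generic[OF mu, of n] by eventually_elim simp
qed

end

theorem theorem8p1:
  fixes n \<mu> :: nat
    and a :: "nat \<Rightarrow> complex"
    and v :: "real \<Rightarrow> real"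
    and \<epsilon> :: real
    and M :: "(real \<Rightarrow> real) \<Rightarrow> 'w measure"
    and \<xi> :: "(real \<Rightarrow> real) \<Rightarrow> int \<Rightarrow> 'w \<Rightarrow> complex"
    and Z :: "(real \<Rightarrow> real) \<Rightarrow> real set \<Rightarrow> 'w \<Rightarrow> complex"
  assumes n: "n \<ge> 1" and mu: "\<mu> \<ge> 1"
    and Da_conv: "\<forall>k. summable (\<lambda>j. D_mat n \<mu> k j * a j)"
    and Da_l1: "summable (\<lambda>k. cmod (b_coeff n \<mu> a k))"
    and Da_l2: "summable (\<lambda>k. (real k + 1) * (cmod (b_coeff n \<mu> a k))\<^sup>2)"
    and v_density: "spectral_density v"
    and v_bounded: "\<exists>K. \<forall>t\<in>{-pi..pi}. v t \<le> K"
    and eps: "\<epsilon> > 0"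
    and family: "\<forall>f\<in>D_eps v \<epsilon>. stationary_increments (M f) n (\<xi> f) \<and>
                   zero_mean_increments (M f) n (\<xi> f) \<and>
                   has_spectral_density (M f) n (\<xi> f) (Z f) f"
  shows "(\<forall>\<phi>0. \<phi>0 \<in> nu_set n \<mu> a v \<epsilon> \<and>
             nu_eps n \<mu> a v \<epsilon> * ennreal (P1 v \<epsilon>) = nu_plus n \<mu> a v \<epsilon> * ennreal (P1 v \<epsilon>) \<and>
             nu_plus n \<mu> a v \<epsilon> * ennreal (P1 v \<epsilon>) = ennreal (l2_sq (DAW n \<mu> a \<phi>0)) \<longrightarrow>
             least_favorable n \<mu> a M \<xi> Z (D_eps v \<epsilon>) (seq_density \<phi>0) \<and>
             one_sided_moving_average (M (seq_density \<phi>0))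
               (incr n (\<xi> (seq_density \<phi>0)) (int \<mu>)))
       \<and> (nu_eps n \<mu> a v \<epsilon> < nu_plus n \<mu> a v \<epsilon> \<longrightarrow>
             (\<exists>c \<phi>. determines_max_density n \<mu> a v \<epsilon> c \<phi>) \<and>
             (\<forall>c \<phi>. determines_max_density n \<mu> a v \<epsilon> c \<phi> \<longrightarrow>
                least_favorable n \<mu> a M \<xi> Z (D_eps v \<epsilon>) (max_density n \<mu> a v c \<phi>)))
       \<and> (\<forall>f0 \<phi>. least_favorable n \<mu> a M \<xi> Z (D_eps v \<epsilon>) f0 \<and> canonical_factorization \<phi> f0 \<longrightarrow>
             optimal_char n \<mu> a M \<xi> Z f0 (h_char n \<mu> a \<phi>) \<and>
             minimax_robust n \<mu> a M \<xi> Z (D_eps v \<epsilon>) (h_char n \<mu> a \<phi>) \<and>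
             (\<forall>h. minimax_robust n \<mu> a M \<xi> Z (D_eps v \<epsilon>) h \<longrightarrow>
                (AE t in freq. h t = h_char n \<mu> a \<phi> t)))"
proof -
  interpret robust_extrapolation n \<mu> a v \<epsilon> M \<xi> Z
    using mu Da_conv Da_l1 v_density eps family by unfold_locales auto
  have part1: "least_favorable n \<mu> a M \<xi> Z (D_eps v \<epsilon>) (seq_density \<phi>0) \<and>
      one_sided_moving_average (M (seq_density \<phi>0)) (incr n (\<xi> (seq_density \<phi>0)) (int \<mu>))"
    if \<phi>0: "\<phi>0 \<in> nu_set n \<mu> a v \<epsilon>" for \<phi>0
  proof
    have fac: "canonical_factorization \<phi>0 (seq_density \<phi>0)" using \<phi>0 by (simp add: nu_set_def)
    note D = nu_saddle(1)[OF \<phi>0]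
    show "least_favorable n \<mu> a M \<xi> Z (D_eps v \<epsilon>) (seq_density \<phi>0)"
      by (rule least_favorable_of_saddle[OF fac D nu_saddle(2)[OF \<phi>0]])
    interpret inc: increment_spectral n \<mu> a "M (seq_density \<phi>0)" "\<xi> (seq_density \<phi>0)" "Z (seq_density \<phi>0)" "seq_density \<phi>0"
      by (rule increments[OF D])
    interpret can: canonical_extrapolation n \<mu> a \<phi>0 by (rule canonical_context(1)[OF fac])
    interpret canonical_increments n \<mu> a "M (seq_density \<phi>0)" "\<xi> (seq_density \<phi>0)" "Z (seq_density \<phi>0)" "seq_density \<phi>0" \<phi>0
      by unfold_locales simp
    show "one_sided_moving_average (M (seq_density \<phi>0)) (incr n (\<xi> (seq_density \<phi>0)) (int \<mu>))"
      by (rule moving_average)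
  qed
  have part2a: "\<exists>c \<phi>. determines_max_density n \<mu> a v \<epsilon> c \<phi>"
    if less: "nu_eps n \<mu> a v \<epsilon> < nu_plus n \<mu> a v \<epsilon>"
  proof -
    have "nu_plus_set n \<mu> a v \<epsilon> \<noteq> {}"
    proof
      assume "nu_plus_set n \<mu> a v \<epsilon> = {}"
      then have "nu_plus n \<mu> a v \<epsilon> = 0" by (simp add: nu_plus_def bot_ennreal)
      then show False using less by simp
    qed
    then show ?thesis using nu_plus_determines by blast
  qed
  have part2b: "least_favorable n \<mu> a M \<xi> Z (D_eps v \<epsilon>) (max_density n \<mu> a v c \<phi>)"
    if "determines_max_density n \<mu> a v \<epsilon> c \<phi>" for c \<phi>
  proof -
    have fac: "canonical_factorization \<phi> (max_density n \<mu> a v c \<phi>)"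
      and mass: "(\<integral>t. max_density n \<mu> a v c \<phi> t \<partial>freq) = 2 * pi * \<epsilon> + (\<integral>t. v t \<partial>freq)"
      using that by (auto simp: determines_max_density_def)
    show ?thesis
      by (rule least_favorable_of_saddle[OF fac max_density_saddle[OF fac mass]])
  qed
  have part3: "optimal_char n \<mu> a M \<xi> Z f0 (h_char n \<mu> a \<phi>)"
    if "least_favorable n \<mu> a M \<xi> Z (D_eps v \<epsilon>) f0" "canonical_factorization \<phi> f0" for f0 \<phi>
    using h_char_optimal[OF that(2)] that(1) by (simp add: least_favorable_def)
  show ?thesis
  proof (intro conjI allI impI; (elim conjE)?)
    fix \<phi>0 assume "\<phi>0 \<in> nu_set n \<mu> a v \<epsilon>"
    from part1[OF this]
    show "least_favorable n \<mu> a M \<xi> Z (D_eps v \<epsilon>) (seq_density \<phi>0)"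
      "one_sided_moving_average (M (seq_density \<phi>0)) (incr n (\<xi> (seq_density \<phi>0)) (int \<mu>))"
      by (rule conjunct1, rule conjunct2)
  next
    assume "nu_eps n \<mu> a v \<epsilon> < nu_plus n \<mu> a v \<epsilon>"
    then show "\<exists>c \<phi>. determines_max_density n \<mu> a v \<epsilon> c \<phi>" by (rule part2a)
  next
    fix c \<phi> assume "determines_max_density n \<mu> a v \<epsilon> c \<phi>"
    then show "least_favorable n \<mu> a M \<xi> Z (D_eps v \<epsilon>) (max_density n \<mu> a v c \<phi>)" by (rule part2b)
  next
    fix f0 \<phi>
    assume lf: "least_favorable n \<mu> a M \<xi> Z (D_eps v \<epsilon>) f0" and fac: "canonical_factorization \<phi> f0"
    show "optimal_char n \<mu> a M \<xi> Z f0 (h_char n \<mu> a \<phi>)" by (rule part3[OF lf fac])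
    show "minimax_robust n \<mu> a M \<xi> Z (D_eps v \<epsilon>) (h_char n \<mu> a \<phi>)" by (rule minimax(1)[OF lf fac])
    show "AE t in freq. h t = h_char n \<mu> a \<phi> t"
      if "minimax_robust n \<mu> a M \<xi> Z (D_eps v \<epsilon>) h" for h
      by (rule minimax(2)[OF lf fac that])
  qed
qed

end
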